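(* Let $K=\mathbb{F}_q(t)$, let $v\in\mathbb{F}_q[t]$ be a monic prime of degree $1$, let $r\ge1$ and let $\mathbf{s}=(s_1,\ldots,s_r)\in\mathbb{Z}^r$ with each $s_i\le 0$. Then $\zeta_v(\mathbf{s})=0$ if and only if one of the following conditions holds: (1) $r>1$ and $\mathbf{s}$ is a trivial zero; (2) $r=1$ and $s=s_1$ is $q$-even.
   Context: $q=p^f$ is a power of a prime $p$, $A=\mathbb{F}_q[t]$, $K=\mathbb{F}_q(t)$, $A_{d+}$ is the set of monic polynomials of degree $d$ in $A$, $v$ is a monic prime (irreducible polynomial) of $A$, and $K_v$ is the completion of $K$ at $v$. For $k\in\mathbb{Z}$ and $d\ge0$ let $\widetilde S_d(k)=\sum_{a\in A_{d+},\,(a,v)=1}a^{-k}\in K$. For $\mathbf{s}=(s_1,\ldots,s_r)\in\mathbb{Z}^r$ the $v$-adic multiple zeta value is $$\zeta_v(\mathbf{s}):=\sum_{d_1>\cdots>d_r\ge0}\widetilde S_{d_1}(s_1)\cdots\widetilde S_{d_r}(s_r)\in K_v$$ (the sum converges $v$-adically). An integer $s$ is $q$-even if $(q-1)\mid s$. For an integer $k\ge0$ let $l(k)$ be the sum of the base-$q$ digits of $k$ (so $l(0)=0$), and $L_k:=\min_{0\le i\le f-1} l(kp^i)/(q-1)$. Trivial zeros (for $\deg v=1$, $r>1$, all $s_i\le0$): $\mathbf{s}$ is a trivial zero if there exists $1\le i\le r$ such that $r-i>L_{-s_i}+1$. *)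

theory Defs
  imports
    "HOL-Analysis.Analysis"
    "HOL-Computational_Algebra.Computational_Algebra"
begin

text \<open>
  Throughout, the finite field with \<open>q\<close> elements is a type \<open>'a :: {field, finite}\<close> with
  \<open>q = CARD('a)\<close>, the polynomial ring \<open>A\<close> is \<open>'a poly\<close>, and \<open>K\<close> is \<open>'a poly fract\<close>.
\<close>

section \<open>The completion of \<open>K\<close> at \<open>v\<close>\<close>

definition vord :: "'a::field poly \<Rightarrow> 'a poly fract \<Rightarrow> int" where
  "vord v x = (THE n. \<exists>a b. \<not> v dvd a \<and> \<not> v dvd b \<and> x = Fract v 1 powi n * Fract a b)"

text \<open>
  All bases greater than \<open>1\<close> give the same topology and the same completion; base \<open>2\<close> is
  the one that the library uses for the metric on formal Laurent series.
\<close>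

definition vabs :: "'a::field poly \<Rightarrow> 'a poly fract \<Rightarrow> real" where
  "vabs v x = (if x = 0 then 0 else 2 powi (- vord v x))"

text \<open>
  As \<open>v\<close> is a term, its completion \<open>K\<^sub>v\<close> cannot be a type constructor applied to \<open>v\<close>. It is
  therefore given as a complete valued field \<open>'k\<close> together with an isometric embedding
  \<open>\<iota>\<close> of \<open>K\<close> with dense image, which determines it up to a unique isometric isomorphism.
\<close>

locale vadic_completion =
  fixes v :: "'a::field poly" and \<iota> :: "'a poly fract \<Rightarrow> 'k::{field,metric_space}"
  assumes complete_UNIV: "complete (UNIV :: 'k set)"
    and dist_eq_dist_diff: "dist x y = dist (x - y) (0::'k)"
    and dist_mult_0: "dist (x * y) (0::'k) = dist x 0 * dist y 0"
    and hom_1: "\<iota> 1 = 1"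
    and hom_add: "\<iota> (a + b) = \<iota> a + \<iota> b"
    and hom_mult: "\<iota> (a * b) = \<iota> a * \<iota> b"
    and dist_hom: "dist (\<iota> a) (\<iota> b) = vabs v (a - b)"
    and dense_range: "closure (range \<iota>) = UNIV"


lemma fls_dist_0:
  "dist x (0::'a::field fls) = (if x = 0 then 0 else 2 powi (- fls_subdegree x))"
  by (auto simp: dist_fls_def power_int_def power_one_over inverse_eq_divide)

lemma fls_dist_diff: "dist x y = dist (x - y) (0::'a::field fls)"
  by (simp add: dist_fls_def)

lemma fls_dist_mult: "dist (x * y) (0::'a::field fls) = dist x 0 * dist y 0"
  by (simp add: fls_dist_0 power_int_add power_int_diff power_int_minus field_simps)

lemma dist_fps_to_fls: "dist (fps_to_fls a) (fps_to_fls b) = dist a (b::'a::field fps)"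
proof -
  have "fps_to_fls a - fps_to_fls b = fps_to_fls (a - b)" by simp
  hence "fls_subdegree (fps_to_fls a - fps_to_fls b) = int (subdegree (a - b))"
    by (simp only: fls_subdegree_fls_to_fps)
  thus ?thesis by (simp add: dist_fls_def dist_fps_def)
qed

lemma fls_complete: "complete (UNIV :: 'a::field fls set)"
  unfolding complete_def
proof (intro allI impI, elim conjE)
  fix X :: "nat \<Rightarrow> 'a fls"
  assume C: "Cauchy X"
  then obtain N where N: "\<And>m. m \<ge> N \<Longrightarrow> dist (X m) (X N) < 1"
    by (metis Cauchy_def order_refl zero_less_one)
  define g where "g m = fls_regpart (X (m + N) - X N)" for m
  have g: "X (m + N) = X N + fps_to_fls (g m)" for m
  proof -
    have "X (m + N) = X N \<or> fls_subdegree (X (m + N) - X N) \<ge> 0"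
    proof (rule ccontr)
      assume *: "\<not> ?thesis"
      have "dist (X (m + N)) (X N) \<ge> 1"
        using * by (auto simp: dist_fls_def)
      with N[of "m + N"] show False by simp
    qed
    hence "fps_to_fls (g m) = X (m + N) - X N"
      unfolding g_def by (metis cancel_comm_monoid_add_class.diff_cancel fls_regpart_to_fls_trivial
          fls_zero_subdegree order_refl)
    thus ?thesis by simp
  qed
  have d: "dist (X (m + N)) (X (n + N)) = dist (g m) (g n)" for m n
    unfolding g by (subst fls_dist_diff) (simp add: fls_dist_diff[symmetric] dist_fps_to_fls)
  have "Cauchy g"
    unfolding Cauchy_def
  proof (intro allI impI)
    fix e :: real assume "e > 0"
    then obtain M where "\<forall>m\<ge>M. \<forall>n\<ge>M. dist (X m) (X n) < e" using C unfolding Cauchy_def by blast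
    thus "\<exists>M. \<forall>m\<ge>M. \<forall>n\<ge>M. dist (g m) (g n) < e"
      by (intro exI[of _ M]) (auto simp flip: d)
  qed
  then obtain G where G: "g \<longlonglongrightarrow> G" using Cauchy_convergent convergent_def by blast
  have "(\<lambda>m. X (m + N)) \<longlonglongrightarrow> X N + fps_to_fls G"
  proof (rule metric_LIMSEQ_I)
    fix e :: real assume "e > 0"
    from metric_LIMSEQ_D[OF G this] obtain M where M: "\<forall>n\<ge>M. dist (g n) G < e" by blast
    have "dist (X (m + N)) (X N + fps_to_fls G) = dist (g m) G" for m
      unfolding g by (subst fls_dist_diff) (simp add: fls_dist_diff[symmetric] dist_fps_to_fls)
    thus "\<exists>M. \<forall>m\<ge>M. dist (X (m + N)) (X N + fps_to_fls G) < e" using M by auto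
  qed
  thus "\<exists>l\<in>UNIV. X \<longlonglongrightarrow> l" by (metis LIMSEQ_offset UNIV_I)
qed

text \<open>
  For \<open>v = t - c\<close> the Laurent series field in \<open>t - c\<close> is a completion, so the assumptions
  of the locale are satisfiable there.
\<close>

theorem vadic_completion_fls:
  fixes c :: "'a::field"
  shows "\<exists>\<iota> :: 'a poly fract \<Rightarrow> 'a fls. vadic_completion [:- c, 1:] \<iota>"
proof -
  let ?v = "[:- c, 1:]"
  define \<phi> :: "'a poly \<Rightarrow> 'a fls"
    where "\<phi> a = fps_to_fls (fps_of_poly (a \<circ>\<^sub>p [:c, 1:]))" for a
  have \<phi>0: "\<phi> 0 = 0" and \<phi>1: "\<phi> 1 = 1" by (simp_all add: \<phi>_def pcompose_1)
  have \<phi>v: "\<phi> ?v = fls_X" by (simp add: \<phi>_def pcompose_pCons fps_of_poly_fps_X)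
  have \<phi>add: "\<phi> (a + b) = \<phi> a + \<phi> b" for a b
    by (simp add: \<phi>_def pcompose_add fps_of_poly_add)
  have \<phi>mult: "\<phi> (a * b) = \<phi> a * \<phi> b" for a b
    by (simp add: \<phi>_def pcompose_mult fps_of_poly_mult fls_times_fps_to_fls)
  have \<phi>pow: "\<phi> (a ^ n) = \<phi> a ^ n" for a n by (induction n) (simp_all add: \<phi>1 \<phi>mult)
  have shift: "a \<circ>\<^sub>p [:- c, 1:] \<circ>\<^sub>p [:c, 1:] = a" "a \<circ>\<^sub>p [:c, 1:] \<circ>\<^sub>p [:- c, 1:] = a" for a
    by (simp_all flip: pcompose_assoc add: pcompose_pCons)
  have \<phi>nz: "\<phi> a = 0 \<longleftrightarrow> a = 0" for a
    by (metis shift(2) \<phi>_def \<phi>0 fls_const_0 fps_of_poly_0 fps_of_poly_eq_iff fps_to_fls_eq_0_iff pcompose_0)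
  have unit: "fls_subdegree (\<phi> a) = 0" if "\<not> ?v dvd a" for a
  proof -
    have "poly a c \<noteq> 0" using that by (simp add: poly_eq_0_iff_dvd)
    hence "fps_of_poly (a \<circ>\<^sub>p [:c, 1:]) $ 0 \<noteq> 0"
      by (simp add: coeff_pcompose_0)
    thus ?thesis by (simp add: \<phi>_def fls_subdegree_fls_to_fps)
  qed
  define \<iota> where "\<iota> x = (let p = (SOME p. snd p \<noteq> 0 \<and> x = Fract (fst p) (snd p)) in
                        \<phi> (fst p) / \<phi> (snd p))" for x
  have \<iota>: "\<iota> (Fract a b) = \<phi> a / \<phi> b" if "b \<noteq> 0" for a b
  proof -
    define p where "p = (SOME p. snd p \<noteq> 0 \<and> Fract a b = Fract (fst p) (snd p))"
    have "snd p \<noteq> 0 \<and> Fract a b = Fract (fst p) (snd p)"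
      unfolding p_def by (rule someI[of _ "(a, b)"]) (use that in auto)
    hence p: "snd p \<noteq> 0" "a * snd p = fst p * b" using that by (auto simp: eq_fract)
    have "\<phi> a * \<phi> (snd p) = \<phi> (fst p) * \<phi> b" using p(2) by (metis \<phi>mult)
    thus ?thesis using p(1) that unfolding \<iota>_def p_def[symmetric] Let_def
      by (simp add: \<phi>nz field_simps)
  qed
  have hom_add: "\<iota> (x + y) = \<iota> x + \<iota> y" for x y
    by (cases x; cases y) (simp add: \<iota> \<phi>add \<phi>mult \<phi>nz field_simps)
  have hom_mult: "\<iota> (x * y) = \<iota> x * \<iota> y" for x y
    by (cases x; cases y) (simp add: \<iota> \<phi>mult)
  have hom_1: "\<iota> 1 = 1" by (simp add: One_fract_def \<iota> \<phi>1)
  have hom_0: "\<iota> 0 = 0" by (simp add: Zero_fract_def \<iota> \<phi>0)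
  have hom_diff: "\<iota> (x - y) = \<iota> x - \<iota> y" for x y
    by (metis add_diff_cancel_right' diff_add_cancel hom_add)
  have hom_inv: "\<iota> (inverse x) = inverse (\<iota> x)" for x
    by (metis hom_0 hom_1 hom_mult inverse_unique inverse_zero right_inverse)
  have hom_pow: "\<iota> (x ^ n) = \<iota> x ^ n" for x n
    by (induction n) (simp_all add: hom_1 hom_mult)
  have hom_powi: "\<iota> (x powi n) = \<iota> x powi n" for x n
    by (simp add: power_int_def hom_pow hom_inv)
  have \<iota>nz: "\<iota> x = 0 \<longleftrightarrow> x = 0" for x
    by (cases x) (simp add: \<iota> \<phi>nz Zero_fract_def eq_fract)
  have \<iota>v: "\<iota> (Fract ?v 1) = fls_X" by (simp add: \<iota> \<phi>v \<phi>1)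
  have sub: "fls_subdegree (\<iota> (Fract ?v 1 powi n * Fract a b)) = n"
    if "\<not> ?v dvd a" "\<not> ?v dvd b" for n a b
  proof -
    have nz: "a \<noteq> 0" "b \<noteq> 0" using that by auto
    have "\<iota> (Fract ?v 1 powi n * Fract a b) = fls_X powi n * (\<phi> a / \<phi> b)"
      using nz by (simp add: hom_mult hom_powi \<iota> \<phi>v \<phi>1)
    also have "fls_subdegree \<dots> = n + (fls_subdegree (\<phi> a) - fls_subdegree (\<phi> b))"
      using nz by (simp add: \<phi>nz fls_divide_subdegree del: fls_X_power_int)
    finally show ?thesis using unit that by simp
  qed
  have dec: "\<exists>n b. a = ?v ^ n * b \<and> \<not> ?v dvd b" if "a \<noteq> 0" for a
    by (metis order_decomp poly_eq_0_iff_dvd that)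
  have vord: "vord ?v x = fls_subdegree (\<iota> x)" if x: "x \<noteq> 0" for x
  proof -
    obtain a b where ab: "x = Fract a b" "b \<noteq> 0" by (cases x) auto
    with x have "a \<noteq> 0" by (auto simp: fract_collapse)
    obtain m a' where a: "a = ?v ^ m * a'" "\<not> ?v dvd a'" using dec[OF \<open>a \<noteq> 0\<close>] by blast
    obtain n b' where b: "b = ?v ^ n * b'" "\<not> ?v dvd b'" using dec[OF \<open>b \<noteq> 0\<close>] by blast
    have pw: "Fract ?v 1 ^ k = Fract (?v ^ k) 1" for k
      by (induction k) (simp_all add: One_fract_def)
    have "b' \<noteq> 0" using b by auto
    hence eq: "x = Fract ?v 1 powi (int m - int n) * Fract a' b'"
      unfolding ab(1) a(1) b(1)
      by (simp add: power_int_diff Zero_fract_def eq_fract pw)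
    show ?thesis
      unfolding vord_def
    proof (rule the_equality)
      show "\<exists>a b. \<not> ?v dvd a \<and> \<not> ?v dvd b \<and> x = Fract ?v 1 powi fls_subdegree (\<iota> x) * Fract a b"
        using sub[OF a(2) b(2), of "int m - int n", folded eq] eq a(2) b(2) by metis
    qed (use sub in auto)
  qed
  have dense: "f \<in> closure (range \<iota>)" for f
    unfolding closure_approachable
  proof (intro allI impI)
    fix e :: real assume e: "e > 0"
    define k where "k = fls_subdegree f"
    define g where "g = fls_base_factor_to_fps f"
    have f: "f = fls_X powi k * fps_to_fls g"
      unfolding g_def k_def
      using fls_conv_base_factor_to_fps_shift_subdegree[of f] by (simp add: fls_X_intpow_times_conv_shift)
    define C where "C = dist (fls_X powi k) (0 :: 'a fls)"
    have "C > 0" by (simp add: C_def)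
    obtain n where n: "inverse (2 ^ n) < e / C"
      using real_arch_pow_inv[of "e / C" "1/2"] e \<open>C > 0\<close>
      by (auto simp: power_divide inverse_eq_divide)
    define P where "P = truncate_fps n g"
    have "dist (fps_of_poly P) g \<le> inverse (2 ^ n)"
    proof (cases "fps_of_poly P = g")
      case False
      hence "subdegree (fps_of_poly P - g) \<ge> n"
        by (intro subdegree_geI) (auto simp: P_def)
      thus ?thesis by (simp add: dist_fps_def field_simps)
    qed auto
    define x where "x = Fract ?v 1 powi k * Fract (P \<circ>\<^sub>p [:- c, 1:]) 1"
    have \<iota>x: "\<iota> x = fls_X powi k * fps_to_fls (fps_of_poly P)"
      by (simp add: x_def hom_mult hom_powi \<iota> \<phi>v \<phi>1) (simp add: \<phi>_def shift)
    have "dist (\<iota> x) f = dist (fls_X powi k * (fps_to_fls (fps_of_poly P) - fps_to_fls g)) 0"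
      unfolding \<iota>x f by (subst fls_dist_diff) (simp add: algebra_simps)
    also have "\<dots> = C * dist (fps_of_poly P) g"
      by (simp add: fls_dist_mult C_def flip: fls_dist_diff add: dist_fps_to_fls)
    also have "\<dots> \<le> C * inverse (2 ^ n)"
      using \<open>C > 0\<close> \<open>dist (fps_of_poly P) g \<le> _\<close> by simp
    also have "\<dots> < e" using n \<open>C > 0\<close> by (simp add: field_simps)
    finally show "\<exists>y\<in>range \<iota>. dist y f < e" by blast
  qed
  have "vadic_completion ?v \<iota>"
  proof
    show "dist (\<iota> a) (\<iota> b) = vabs ?v (a - b)" for a b
      by (subst fls_dist_diff) (simp add: fls_dist_0 vabs_def vord \<iota>nz flip: hom_diff)
  qed (use dense fls_complete fls_dist_diff fls_dist_mult hom_1 hom_add hom_mult in auto)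
  thus ?thesis by blast
qed


section \<open>\<open>v\<close>-adic multiple zeta values\<close>

definition S_tilde :: "'a::{field,finite} poly \<Rightarrow> nat \<Rightarrow> int \<Rightarrow> 'a poly fract" where
  "S_tilde v d k =
     (\<Sum>a | lead_coeff a = 1 \<and> degree a = d \<and> coprime a v. Fract a 1 powi (- k))"

text \<open>The index \<open>(s\<^sub>1, \<dots>, s\<^sub>r)\<close> is a list, so that \<open>s\<^sub>i\<close> is \<open>s ! (i - 1)\<close>.\<close>

definition zeta_v ::
  "'a::{field,finite} poly \<Rightarrow> ('a poly fract \<Rightarrow> 'k::{field,metric_space}) \<Rightarrow> int list \<Rightarrow> 'k" where
  "zeta_v v \<iota> s =
     (\<Sum>\<^sub>\<infinity>d | length d = length s \<and> sorted_wrt (>) d.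
        \<iota> (\<Prod>i<length s. S_tilde v (d ! i) (s ! i)))"


lemma of_nat_CARD_eq_0: "of_nat CARD('a::{field,finite}) = (0 :: 'a poly)"
proof -
  have "(\<Sum>c\<in>UNIV. c + 1 :: 'a) = (\<Sum>c\<in>UNIV. c)"
    by (rule sum.reindex_bij_witness[of _ "\<lambda>c. c - 1" "\<lambda>c. c + 1"]) auto
  hence "of_nat CARD('a) = (0 :: 'a)" by (simp add: sum.distrib)
  thus ?thesis by (simp add: of_nat_poly)
qed

lemma finite_coeffs_below: "finite {b :: 'a::{zero,finite} poly. \<forall>i\<ge>n. coeff b i = 0}"
proof -
  have "{b :: 'a poly. \<forall>i\<ge>n. coeff b i = 0} \<subseteq> Poly ` {xs. set xs \<subseteq> UNIV \<and> length xs \<le> n}"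
  proof
    fix b :: "'a poly" assume "b \<in> {b. \<forall>i\<ge>n. coeff b i = 0}"
    hence "b = Poly (map (coeff b) [0..<n])" by (auto simp: poly_eq_iff coeff_Poly_eq nth_default_def)
    thus "b \<in> Poly ` {xs. set xs \<subseteq> UNIV \<and> length xs \<le> n}" by (intro image_eqI) auto
  qed
  thus ?thesis by (rule finite_subset) (intro finite_imageI finite_lists_length_le, simp)
qed

lemma power_sum_affine_eq_0:
  fixes x :: "'a::{field,finite} poly"
  assumes "k < n"
  shows "(\<Sum>b | \<forall>i\<ge>n. coeff b i = 0. (x + b) ^ k) = 0"
  using assms
proof (induction n arbitrary: k)
  case (Suc n)
  let ?B = "\<lambda>n. {b :: 'a poly. \<forall>i\<ge>n. coeff b i = 0}"
  have "(\<Sum>b\<in>?B (Suc n). (x + b) ^ k) = (\<Sum>(c,b)\<in>UNIV \<times> ?B n. (monom c n + (x + b)) ^ k)"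
  proof (rule sum.reindex_bij_witness
      [of _ "\<lambda>(c,b). monom c n + b" "\<lambda>b. (coeff b n, b - monom (coeff b n) n)"], goal_cases)
    case (2 b) thus ?case by (auto simp: Suc_le_eq nat_less_le)
  next
    case (4 p) thus ?case by (auto simp: Suc_le_eq)
  next
    case (5 b) thus ?case by (simp add: algebra_simps)
  qed (auto simp: algebra_simps)
  also have "\<dots> = (\<Sum>c\<in>UNIV. \<Sum>b\<in>?B n. \<Sum>j\<le>k. of_nat (k choose j) * monom c n ^ j * (x + b) ^ (k - j))"
    by (simp add: sum.cartesian_product[symmetric] binomial_ring[of "monom _ n" "x + _"])
  also have "\<dots> = (\<Sum>c\<in>UNIV. \<Sum>j\<le>k. \<Sum>b\<in>?B n. of_nat (k choose j) * monom c n ^ j * (x + b) ^ (k - j))"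
    by (intro sum.cong sum.swap refl)
  also have "\<dots> = (\<Sum>c\<in>(UNIV :: 'a set). \<Sum>j\<le>k. of_nat (k choose j) * monom c n ^ j *
                    (\<Sum>b\<in>?B n. (x + b) ^ (k - j)))"
    by (simp add: sum_distrib_left)
  also have "\<dots> = (\<Sum>c\<in>(UNIV :: 'a set). \<Sum>j\<le>k. if j = 0 then (\<Sum>b\<in>?B n. (x + b) ^ k) else 0)"
    using Suc by (intro sum.cong refl) auto
  also have "\<dots> = 0" by (simp add: of_nat_CARD_eq_0)
  finally show ?case .
qed simp

lemma power_sum_monic_eq_0:
  assumes "k < d"
  shows "(\<Sum>a :: 'a::{field,finite} poly | lead_coeff a = 1 \<and> degree a = d. a ^ k) = 0"
proof -
  have "(\<Sum>a :: 'a poly | lead_coeff a = 1 \<and> degree a = d. a ^ k) =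
        (\<Sum>b | \<forall>i\<ge>d. coeff b i = 0. (monom 1 d + b) ^ k)"
  proof (rule sum.reindex_bij_witness[of _ "\<lambda>b. monom 1 d + b" "\<lambda>a. a - monom 1 d"], goal_cases)
    case (4 b)
    have "degree (monom 1 d + b) = d"
      using 4 by (intro antisym degree_le le_degree) auto
    thus ?case using 4 by auto
  qed (auto simp: coeff_eq_0 algebra_simps le_less)
  with power_sum_affine_eq_0[OF assms] show ?thesis by simp
qed

lemma coprime_irreducible_iff:
  assumes "irreducible (v :: 'a::field poly)"
  shows "coprime a v \<longleftrightarrow> \<not> v dvd a"
proof
  assume "\<not> v dvd a"
  show "coprime a v"
  proof (rule coprimeI)
    fix c assume c: "c dvd a" "c dvd v"
    then obtain e where e: "v = c * e" by (elim dvdE)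
    with assms have "is_unit c \<or> is_unit e" by (simp add: irreducible_def)
    moreover have "\<not> is_unit e"
      using e c \<open>\<not> v dvd a\<close> by (metis dvd_trans mult_unit_dvd_iff dvd_refl)
    ultimately show "is_unit c" by blast
  qed
qed (use assms in \<open>metis coprime_common_divisor dvd_refl irreducible_not_unit\<close>)

lemma S_tilde_eq_0:
  fixes v :: "'a::{field,finite} poly"
  assumes v: "irreducible v" "lead_coeff v = 1" and s: "s \<le> 0" and d: "d > nat (- s) + degree v"
  shows "S_tilde v d s = 0"
proof -
  define k where "k = nat (- s)"
  let ?M = "\<lambda>d. {a :: 'a poly. lead_coeff a = 1 \<and> degree a = d}"
  have fin: "finite (?M d)" for d
    by (rule finite_subset[OF _ finite_coeffs_below[of "Suc d"]]) (auto simp: coeff_eq_0)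
  have v0: "v \<noteq> 0" using v(2) by auto
  have "(\<Sum>a\<in>?M d \<inter> {a. v dvd a}. a ^ k) = (\<Sum>a\<in>?M (d - degree v). (v * a) ^ k)"
  proof (rule sum.reindex_bij_witness[of _ "\<lambda>a. v * a" "\<lambda>a. a div v"], goal_cases)
    case (2 a)
    then obtain b where b: "a = v * b" by auto
    with 2 have "b \<noteq> 0" by auto
    moreover have "lead_coeff b = 1" using 2 b v(2) lead_coeff_mult[of v b] by auto
    ultimately show ?case using 2 b v0 by (auto simp: degree_mult_eq)
  next
    case (4 a)
    hence "a \<noteq> 0" by auto
    hence deg: "degree (v * a) = d" using 4 v0 d by (simp add: degree_mult_eq)
    have "lead_coeff (v * a) = 1" using 4 v(2) by (simp only: lead_coeff_mult) auto
    with deg v0 show ?case by simp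
  qed (use v0 in auto)
  also have "\<dots> = v ^ k * (\<Sum>a\<in>?M (d - degree v). a ^ k)"
    by (simp add: power_mult_distrib sum_distrib_left)
  also have "\<dots> = 0" using d by (subst power_sum_monic_eq_0) (auto simp: k_def)
  finally have "(\<Sum>a\<in>?M d \<inter> {a. v dvd a}. a ^ k) = 0" .
  moreover have "(\<Sum>a\<in>?M d. a ^ k) = 0" using d by (intro power_sum_monic_eq_0) (simp add: k_def)
  ultimately have sum: "(\<Sum>a\<in>?M d - {a. v dvd a}. a ^ k) = 0"
    using sum.Int_Diff[OF fin, of "\<lambda>a. a ^ k" d "{a. v dvd a}"] by simp
  have pw: "Fract a 1 powi (- s) = Fract (a ^ k) 1" for a :: "'a poly"
  proof -
    have "Fract a 1 ^ n = Fract (a ^ n) 1" for n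
      by (induction n) (simp_all add: One_fract_def)
    thus ?thesis using s by (simp add: power_int_def k_def)
  qed
  have add: "(\<Sum>a\<in>X. Fract (g a) 1) = Fract (\<Sum>a\<in>X. g a) 1" for X and g :: "'a poly \<Rightarrow> 'a poly"
    by (induction X rule: infinite_finite_induct) (simp_all add: Zero_fract_def)
  have "S_tilde v d s = (\<Sum>a\<in>?M d - {a. v dvd a}. Fract (a ^ k) 1)"
    unfolding S_tilde_def pw using v(1) by (intro sum.cong) (auto simp: coprime_irreducible_iff)
  thus ?thesis by (simp add: add sum Zero_fract_def)
qed

text \<open>
  For nonpositive \<open>s\<^sub>i\<close> almost all terms vanish, so that \<^const>\<open>zeta_v\<close> does not take the default
  value that \<^const>\<open>infsum\<close> has on divergent sums.
\<close>

lemma zeta_v_summable: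
  fixes \<iota> :: "'a::{field,finite} poly fract \<Rightarrow> 'k::{field,metric_space}"
  assumes "vadic_completion v \<iota>" and v: "irreducible v" "lead_coeff v = 1"
    and s: "\<forall>x\<in>set s. x \<le> 0"
  shows "(\<lambda>d. \<iota> (\<Prod>i<length s. S_tilde v (d ! i) (s ! i)))
           summable_on {d. length d = length s \<and> sorted_wrt (>) d}"
proof -
  interpret vadic_completion v \<iota> by fact
  have \<iota>0: "\<iota> 0 = 0" by (metis add.right_neutral add_left_imp_eq hom_add)
  define N where "N = (\<Sum>i<length s. nat (- (s ! i))) + degree v"
  let ?D = "{d. length d = length s \<and> sorted_wrt (>) d}"
  let ?F = "{d \<in> ?D. set d \<subseteq> {..N}}"
  have "finite ?F"
    by (rule finite_subset[OF _ finite_lists_length_eq[of "{..N}" "length s"]]) auto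
  hence "(\<lambda>d. \<iota> (\<Prod>i<length s. S_tilde v (d ! i) (s ! i))) summable_on ?F"
    by (rule summable_on_finite)
  also have "?this \<longleftrightarrow> ?thesis"
  proof (rule summable_on_cong_neutral)
    fix d assume d: "d \<in> ?D - ?F"
    then obtain i where i: "i < length s" "d ! i > N"
      by (auto simp: subset_eq in_set_conv_nth)
    have "nat (- (s ! i)) \<le> (\<Sum>i<length s. nat (- (s ! i)))"
      using i by (intro member_le_sum) auto
    hence "S_tilde v (d ! i) (s ! i) = 0"
      using i s v by (intro S_tilde_eq_0) (auto simp: N_def)
    thus "\<iota> (\<Prod>i<length s. S_tilde v (d ! i) (s ! i)) = 0"
      using i \<iota>0 by (subst prod_zero) auto
  qed auto
  finally show ?thesis .
qed


section \<open>\<open>q\<close>-even integers and trivial zeros\<close>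

definition q_even :: "nat \<Rightarrow> int \<Rightarrow> bool" where
  "q_even q s \<longleftrightarrow> (int q - 1) dvd s"

text \<open>For \<open>q \<ge> 2\<close>, the base-\<open>q\<close> digits of \<open>k\<close> at positions beyond \<open>k\<close> are zero.\<close>

definition digit_sum :: "nat \<Rightarrow> nat \<Rightarrow> nat" where
  "digit_sum q k = (\<Sum>i\<le>k. k div q ^ i mod q)"

definition L_min :: "nat \<Rightarrow> nat \<Rightarrow> nat \<Rightarrow> real" where
  "L_min p f k =
     Min ((\<lambda>i. real (digit_sum (p ^ f) (k * p ^ i)) / (real (p ^ f) - 1)) ` {..<f})"

definition trivial_zero :: "nat \<Rightarrow> nat \<Rightarrow> int list \<Rightarrow> bool" where
  "trivial_zero p f s \<longleftrightarrow>
     (\<exists>i\<in>{1..length s}. real (length s - i) > L_min p f (nat (- (s ! (i - 1)))) + 1)"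

end

theory Submission
  imports Defs
begin

text \<open>
  The translation by the root of \<open>v\<close> turns \<open>v\<close> into the variable \<open>t\<close>, and with \<open>k\<^sub>i = -s\<^sub>i\<close> the zeta value
  becomes a finite sum of products of the polynomials \<open>unit_sum d k\<close>, the sum of the \<open>k\<close>-th powers of
  the monic polynomials of degree \<open>d\<close> with nonzero constant coefficient; \<open>monic_sum d k\<close> is the same
  sum over all monic polynomials. The question is whether these products cancel, and the answer comes
  from the lowest power of \<open>t\<close> in each of them.

  Write a monic polynomial of degree \<open>d + 1\<close> as \<open>x + t b\<close> and expand its \<open>k\<close>-th power. The sum of
  \<open>x\<^bsup>k - j\<^esup>\<close> over the nonzero constants is \<open>-1\<close> if \<open>q - 1\<close> divides \<open>k - j\<close> and \<open>0\<close> otherwise, and by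
  Lucas the binomial coefficient survives iff the base-\<open>p\<close> digits of \<open>j\<close> are bounded by those of \<open>k\<close>.
  Hence (\<open>unit_sum_Suc\<close>, \<open>monic_sum_Suc\<close>) both sums of degree \<open>d + 1\<close> are combinations of the
  \<open>t\<^sup>j monic_sum d j\<close> for such \<open>j\<close>, where \<open>j = k\<close> is allowed only in \<open>unit_sum\<close>. Iterating this gives sums
  over descending chains of numbers, a chain contributing \<open>t\<close> to the sum of its members.

  A chain of length \<open>m\<close> can start below \<open>k\<close> iff \<open>m \<le> L\<^sub>k\<close>, which is what \<open>feasible m k\<close> says. The heart of the
  proof is \<open>greedy_least\<close>: among these chains the one that always takes the least possible next member
  is the only one with the least sum. So its term is not cancelled, the polynomial is nonzero exactly
  for feasible \<open>m\<close>, and the lowest exponent is known; it increases strictly with the degree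
  (\<open>lowest_exp_less\<close>). In depth \<open>r \<ge> 2\<close> every index \<open>d\<^sub>1 > \<dots> > d\<^sub>r\<close> dominates \<open>(r - 1, \<dots>, 1, 0)\<close>, so that
  either some factor at this smallest index vanishes, which is the condition for a trivial zero and
  kills all products, or its product alone has the lowest exponent and the sum is nonzero. The
  exponent need not grow from degree \<open>0\<close> to degree \<open>1\<close>, and this is why depth \<open>1\<close> is different. There the
  constant coefficient decides if \<open>q - 1\<close> does not divide \<open>k\<close>; if it does, the sum over monic polynomials
  is, up to sign, one over all polynomials of bounded degree, which is \<open>0\<close>.

  For \<open>greedy_least\<close>, sort the digit positions into \<open>f\<close> classes modulo \<open>f\<close>. Within a residue class modulo
  \<open>q - 1\<close>, the number \<open>n\<^sub>t\<close> of units that the digits of \<open>j\<close> have in class \<open>t\<close> has the form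
  \<open>n\<^sub>t = p x\<^sub>t - x\<^bsub>t+1\<^esub> + d\<^sub>t\<close> for one periodic sequence \<open>x\<close>, and \<open>j\<close> is feasible for \<open>m\<close> iff all \<open>x\<^sub>t \<ge> m\<close>. Such
  linear systems are closed under pointwise minima. This lets one compare two greedy chains whose
  starting points agree, and cannot be improved, from position \<open>T\<close> on: the next members agree from \<open>T - f\<close> on, and so forth
  (\<open>linked_step\<close>). The sums of the chains therefore differ by at most \<open>p\<^bsup>T-f\<^esup> + p\<^bsup>T-2f\<^esup> + \<dots>\<close>. This, or a geometric series
  in the case where no digits from \<open>T\<close> on are involved, cannot outweigh the difference of the starting points
  (\<open>greedy_least_initial\<close>).
\<close>

section \<open>Periodic potentials and their flow\<close>

text \<open>
  Walking backwards from \<open>j + f t\<close>, where the property holds by periodicity, one reaches every \<open>t\<close>.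
\<close>

lemma periodic_backward:
  assumes "\<And>t::nat. Q (t + f) \<longleftrightarrow> Q t" "f \<ge> 1" "\<And>t. Q (Suc t) \<Longrightarrow> Q t" "Q j"
  shows "Q t"
proof -
  have up: "Q (j + f * k)" for k
    by (induction k) (use assms(1)[of "j + f * _"] assms(4) in \<open>auto simp: algebra_simps\<close>)
  have dn: "Q (t + k) \<Longrightarrow> Q t" for t k
    by (induction k) (use assms(3) in auto)
  have "t \<le> j + f * t" using assms(2) by (simp add: trans_le_add2)
  then obtain k where "j + f * t = t + k" using le_Suc_ex by blast
  thus ?thesis using up[of t] dn[of t k] by simp
qed

lemma periodic_forward:
  assumes "\<And>t::nat. Q (t + f) \<longleftrightarrow> Q t" "f \<ge> 1" "\<And>t. Q t \<Longrightarrow> Q (Suc t)" "Q j"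
  shows "Q t"
proof (rule ccontr)
  assume "\<not> Q t"
  hence "\<not> Q j"
    using periodic_backward[of "\<lambda>t. \<not> Q t" f t j] assms by blast
  thus False using assms by simp
qed

lemma mod_eq_if_Suc_mod_eq:
  assumes "Suc s mod f = Suc t mod f" shows "s mod f = t mod f"
  using assms by (auto simp: mod_Suc split: if_splits)

text \<open>
  Let \<open>l\<^sub>t\<close> be the sum of the base-\<open>q\<close> digits of \<open>j p\<^sup>t\<close>, with \<open>q = p\<^sup>f\<close>, and \<open>l\<^sub>t = (q - 1) x\<^sub>t + r\<^sub>t\<close> with \<open>0 \<le> r\<^sub>t < q - 1\<close>.
  Multiplication by \<open>p\<close> carries some digits over to the next position in base \<open>q\<close>, so that
  \<open>p l\<^sub>t - l\<^bsub>t+1\<^esub> = (q - 1) n\<^sub>t\<close>, where \<open>n\<^sub>t\<close> is their sum. In terms of \<open>x\<close> this reads \<open>n\<^sub>t = p x\<^sub>t - x\<^bsub>t+1\<^esub> + d\<^sub>t\<close>, where the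
  digits \<open>d\<^sub>t\<close> depend only on the residue of \<open>j\<close> modulo \<open>q - 1\<close>. This section studies these
  linear relations for arbitrary integral \<open>x\<close>; \<open>x\<close> is the potential and \<open>n\<close> its flow.
\<close>

locale potentials =
  fixes p f :: nat and d :: "nat \<Rightarrow> int"
  assumes p2: "p \<ge> 2" and f1: "f \<ge> 1"
    and d_per: "d (t + f) = d t" and d_nonneg: "0 \<le> d t" and d_less: "d t < int p"
begin

definition periodic :: "(nat \<Rightarrow> int) \<Rightarrow> bool" where "periodic x \<longleftrightarrow> (\<forall>t. x (t + f) = x t)"

definition flow :: "(nat \<Rightarrow> int) \<Rightarrow> nat \<Rightarrow> int" where "flow x t = int p * x t - x (Suc t) + d t"

definition Pot :: "(nat \<Rightarrow> int) \<Rightarrow> (nat \<Rightarrow> int) \<Rightarrow> (nat \<Rightarrow> int) set" where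
  "Pot V b = {x. periodic x \<and> (\<forall>t. b t \<le> x t) \<and> (\<forall>t. flow x t \<le> V t)}"

lemma periodicD: "periodic x \<Longrightarrow> x (t + f) = x t"
  by (simp add: periodic_def)

lemma periodic_flow: "periodic x \<Longrightarrow> periodic (flow x)"
  using d_per by (simp add: periodic_def flow_def flip: add_Suc)

lemma periodic_mod: "periodic x \<Longrightarrow> x (t mod f) = x t"
proof -
  assume x: "periodic x"
  have "x (s + f * k) = x s" for s k
    by (induction k) (use periodicD[OF x, of "s + f * _"] in \<open>auto simp: algebra_simps\<close>)
  from this[of "t mod f" "t div f"] show ?thesis by simp
qed

lemma periodic_const [simp]: "periodic (\<lambda>_. m)" and periodic_diff: "periodic x \<Longrightarrow> periodic (\<lambda>t. x t - m)"
  and periodic_min: "periodic x \<Longrightarrow> periodic y \<Longrightarrow> periodic (\<lambda>t. min (x t) (y t))"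
  by (simp_all add: periodic_def)

lemma flow_minus_1: "flow (\<lambda>t. x t - 1) t = flow x t - (int p - 1)"
  by (simp add: flow_def algebra_simps)

text \<open>
  \<open>Pot V b\<close> is closed under pointwise minima, because \<open>x\<^bsub>t+1\<^esub>\<close> enters the flow at \<open>t\<close> negatively: a minimum
  that is attained by \<open>x\<close> at \<open>t + 1\<close> has at most the flow of \<open>x\<close> at \<open>t\<close>. So there is a least element. Lowering
  it at a single place \<open>t + 1\<close> (modulo \<open>f\<close>) above the floor violates only the cap at \<open>t\<close>, which must be attained.
\<close>

lemma Pot_least:
  assumes b: "periodic b" and V: "periodic V" and x0: "x0 \<in> Pot V b"
  obtains \<nu> where "\<nu> \<in> Pot V b" "\<And>x t. x \<in> Pot V b \<Longrightarrow> \<nu> t \<le> x t"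
    "\<And>t. b (Suc t) < \<nu> (Suc t) \<Longrightarrow> flow \<nu> t = V t"
proof -
  define N where "N t n \<longleftrightarrow> (\<exists>x\<in>Pot V b. x t = b t + int n)" for t n
  define \<nu> where "\<nu> t = b t + int (LEAST n. N t n)" for t
  have N: "N t (nat (x t - b t))" if "x \<in> Pot V b" for x t
    unfolding N_def by (rule bexI[of _ x]) (use that in \<open>auto simp: Pot_def\<close>)
  have att: "\<exists>x\<in>Pot V b. x t = \<nu> t" for t
    using LeastI[of "N t", OF N[OF x0]] unfolding \<nu>_def N_def .
  have le: "\<nu> t \<le> x t" if "x \<in> Pot V b" for x t
  proof -
    have "(LEAST n. N t n) \<le> nat (x t - b t)" by (rule Least_le) (rule N[OF that])
    moreover have "b t \<le> x t" using that by (auto simp: Pot_def)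
    ultimately show ?thesis by (simp add: \<nu>_def)
  qed
  have "N (t + f) = N t" for t
    unfolding N_def fun_eq_iff using b by (metis (no_types, lifting) Pot_def mem_Collect_eq periodicD)
  hence per\<nu>: "periodic \<nu>" using b by (simp add: periodic_def \<nu>_def)
  have mem: "\<nu> \<in> Pot V b"
  proof -
    have "flow \<nu> t \<le> V t" for t
    proof -
      obtain x where x: "x \<in> Pot V b" "x (Suc t) = \<nu> (Suc t)" using att by blast
      have "int p * \<nu> t \<le> int p * x t" using le[OF x(1), of t] by (simp add: mult_left_mono)
      hence "flow \<nu> t \<le> flow x t" using x(2) by (simp add: flow_def)
      also have "\<dots> \<le> V t" using x(1) by (auto simp: Pot_def)
      finally show ?thesis .
    qed
    thus ?thesis using per\<nu> by (auto simp: Pot_def \<nu>_def)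
  qed
  have "flow \<nu> t = V t" if t: "b (Suc t) < \<nu> (Suc t)" for t
  proof (rule ccontr)
    assume ne: "flow \<nu> t \<noteq> V t"
    \<comment> \<open>the least element, lowered by one at the places congruent to \<open>t + 1\<close>\<close>
    define y where "y s = (if s mod f = Suc t mod f then \<nu> s - 1 else \<nu> s)" for s
    have py: "periodic y" using per\<nu> by (auto simp: periodic_def y_def)
    have yb: "b s \<le> y s" for s
    proof -
      have "b s < \<nu> s" if "s mod f = Suc t mod f"
        using t that periodic_mod[OF b, of s] periodic_mod[OF b, of "Suc t"] periodic_mod[OF per\<nu>, of s] periodic_mod[OF per\<nu>, of "Suc t"]
        by simp
      thus ?thesis using mem by (auto simp: y_def Pot_def)
    qed
    have yV: "flow y s \<le> V s" for s
    proof -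
      have nV: "flow \<nu> s \<le> V s" using mem by (auto simp: Pot_def)
      show ?thesis
      proof (cases "Suc s mod f = Suc t mod f")
        case False
        have "int p * y s \<le> int p * \<nu> s" by (simp add: y_def mult_left_mono)
        hence "flow y s \<le> flow \<nu> s" using False by (simp add: flow_def y_def)
        thus ?thesis using nV by simp
      next
        case True
        have "s mod f = t mod f"
          using True by (rule mod_eq_if_Suc_mod_eq)
        hence "flow \<nu> s = flow \<nu> t" "V s = V t"
          using periodic_mod[OF periodic_flow[OF per\<nu>], of s] periodic_mod[OF periodic_flow[OF per\<nu>], of t]
            periodic_mod[OF V, of s] periodic_mod[OF V, of t] by simp_all
        hence "flow \<nu> s < V s" using nV ne by simp
        moreover have "int p * y s \<le> int p * \<nu> s" by (simp add: y_def mult_left_mono)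
        ultimately show ?thesis using True by (simp add: flow_def y_def)
      qed
    qed
    have "y \<in> Pot V b" using py yb yV by (auto simp: Pot_def)
    from le[OF this, of "Suc t"] show False by (simp add: y_def)
  qed
  thus thesis using that mem le by blast
qed

text \<open>
  Only nonnegative flows count digits. The least potential under the cap \<open>max 0 (flow x)\<close> has one: its flow
  is the cap where it exceeds the floor at \<open>t + 1\<close>, and at least \<open>p m - m\<close> where it does not.
\<close>

lemma Pot_nonneg_flow:
  assumes m: "0 \<le> m" and x: "x \<in> Pot V (\<lambda>_. m)"
  shows "\<exists>y. periodic y \<and> (\<forall>t. m \<le> y t \<and> 0 \<le> flow y t \<and> flow y t \<le> max 0 (flow x t) \<and> y t \<le> x t)"
proof -
  define U where "U t = max 0 (flow x t)" for t
  have px: "periodic x" using x by (simp add: Pot_def)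
  have pU: "periodic U" using periodic_flow[OF px] by (simp add: U_def periodic_def)
  have "x \<in> Pot U (\<lambda>_. m)" using x by (auto simp: Pot_def U_def)
  from Pot_least[OF periodic_const pU this] obtain y where y: "y \<in> Pot U (\<lambda>_. m)"
    "\<And>z t. z \<in> Pot U (\<lambda>_. m) \<Longrightarrow> y t \<le> z t" "\<And>t. m < y (Suc t) \<Longrightarrow> flow y t = U t" by blast
  have nonneg: "0 \<le> flow y t" for t
  proof (cases "m < y (Suc t)")
    case False
    hence "y (Suc t) = m" using y(1) by (auto simp: Pot_def intro: antisym)
    moreover have "m \<le> y t" using y(1) by (auto simp: Pot_def)
    hence "1 * m \<le> int p * y t" using m p2 by (intro mult_mono) auto
    ultimately show ?thesis using d_nonneg[of t] by (simp add: flow_def)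
  qed (simp add: y(3) U_def)
  show ?thesis
    by (rule exI[of _ y]) (use y nonneg \<open>x \<in> Pot U _\<close> in \<open>auto simp: Pot_def U_def\<close>)
qed

text \<open>
  The difference \<open>u = a - x\<close> satisfies \<open>u\<^bsub>t+1\<^esub> \<le> p u\<^sub>t\<close>. A negative value would keep decreasing,
  against periodicity, and a zero would force all later values to be zero.
\<close>

lemma less_if_flow_le:
  assumes a: "periodic a" and x: "periodic x" and le: "\<And>t. flow x t \<le> flow a t" and ne: "x \<noteq> a"
  shows "x t \<le> a t - 1"
proof -
  define u where "u t = a t - x t" for t
  have pu: "u (t + f) = u t" for t using a x by (simp add: u_def periodic_def)
  have step: "u (Suc t) \<le> int p * u t" for t
    using le[of t] by (simp add: flow_def u_def algebra_simps)
  have nonneg: "u t \<ge> 0" for t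
  proof (rule ccontr)
    assume "\<not> u t \<ge> 0"
    have "u (t + k) < 0 \<and> u (t + k) \<le> u t - int k" for k
    proof (induction k)
      case (Suc k)
      have "int p * u (t + k) \<le> 2 * u (t + k)"
        using Suc p2 by (intro mult_right_mono_neg) auto
      hence "u (Suc (t + k)) \<le> 2 * u (t + k)" using step[of "t + k"] by linarith
      thus ?case using Suc by simp
    qed (use \<open>\<not> u t \<ge> 0\<close> in auto)
    from this[of f] pu[of t] f1 show False by simp
  qed
  have "u t \<noteq> 0"
  proof
    assume "u t = 0"
    have "u s = 0" for s
    proof (rule periodic_forward[of "\<lambda>s. u s = 0" f t])
      fix t assume "u t = 0"
      thus "u (Suc t) = 0" using step[of t] nonneg[of "Suc t"] by simp
    qed (use pu f1 \<open>u t = 0\<close> in auto)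
    hence "x = a" by (auto simp: u_def fun_eq_iff)
    thus False using ne by simp
  qed
  thus ?thesis using nonneg[of t] by (simp add: u_def)
qed

text \<open>
  The situation in which two greedy choices \<open>a\<close> and \<open>b\<close> with floor \<open>m\<close> are compared. \<open>A t\<close> is the number of units
  of class \<open>t\<close> that are available below some position \<open>T\<close>, so that \<open>A t < V t\<close> marks the classes in which
  \<open>a\<close> or \<open>b\<close> uses a unit at \<open>T\<close> or above; the maximum of both flows will serve as the cap \<open>V\<close>. In these classes the two flows
  agree, and, by the last condition, no potential below \<open>a\<close> or below \<open>b\<close> can save a unit. \<open>\<nu>\<close> is the least potential under
  the cap.
\<close>

definition linked :: "(nat \<Rightarrow> int) \<Rightarrow> int \<Rightarrow> (nat \<Rightarrow> int) \<Rightarrow> (nat \<Rightarrow> int) \<Rightarrow> (nat \<Rightarrow> int) \<Rightarrow> (nat \<Rightarrow> int) \<Rightarrow> bool" where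
  "linked A m V \<nu> a b \<longleftrightarrow> periodic V \<and> periodic a \<and> periodic b \<and> (\<forall>t. 0 \<le> A t) \<and>
     (\<forall>t. m \<le> a t \<and> 0 \<le> flow a t \<and> flow a t \<le> V t) \<and> (\<forall>t. m \<le> b t \<and> 0 \<le> flow b t \<and> flow b t \<le> V t) \<and>
     \<nu> \<in> Pot V (\<lambda>_. m) \<and> (\<forall>y\<in>Pot V (\<lambda>_. m). \<forall>t. \<nu> t \<le> y t) \<and>
     (\<forall>t. m < \<nu> (Suc t) \<longrightarrow> flow \<nu> t = V t) \<and>
     (\<forall>t. A t < V t \<longrightarrow> flow a t = V t \<and> flow b t = V t) \<and>
     (\<forall>y\<in>Pot V (\<lambda>_. m). (\<forall>t. y t \<le> a t) \<or> (\<forall>t. y t \<le> b t) \<longrightarrow> (\<forall>t. A t < V t \<longrightarrow> flow y t = V t))"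

lemma linked_sym: "linked A m V \<nu> a b \<Longrightarrow> linked A m V \<nu> b a"
  unfolding linked_def by blast

text \<open>
  Suppose that \<open>a\<close> exceeds \<open>\<nu>\<close> at \<open>j + 1\<close>, and let \<open>y\<close> be the least potential under the cap that does so.
  As \<open>y\<close> attains the cap wherever it exceeds its floor, going backwards it exceeds \<open>\<nu>\<close> everywhere, and so does \<open>a\<close>.
  But then \<open>a - 1\<close> still respects the floor and saves \<open>p - 1\<close> units in class \<open>j\<close>, which is excluded.
\<close>

lemma linked_pinned:
  assumes I: "linked A m V \<nu> a b" and j: "A j < V j"
  shows "a (Suc j) = \<nu> (Suc j)" "a j = \<nu> j"
proof -
  have V: "periodic V" and a: "periodic a" "\<And>t. m \<le> a t" "\<And>t. flow a t \<le> V t" and \<nu>: "\<nu> \<in> Pot V (\<lambda>_. m)"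
    and least: "\<And>y t. y \<in> Pot V (\<lambda>_. m) \<Longrightarrow> \<nu> t \<le> y t"
    and full: "\<And>t. A t < V t \<Longrightarrow> flow a t = V t"
    and crit: "\<And>y t. y \<in> Pot V (\<lambda>_. m) \<Longrightarrow> (\<And>t. y t \<le> a t) \<Longrightarrow> A t < V t \<Longrightarrow> flow y t = V t"
    using I unfolding linked_def by blast+
  have aP: "a \<in> Pot V (\<lambda>_. m)" using a by (auto simp: Pot_def)
  have p\<nu>: "periodic \<nu>" and m\<nu>: "\<And>t. m \<le> \<nu> t" and c\<nu>: "\<And>t. flow \<nu> t \<le> V t" using \<nu> by (auto simp: Pot_def)
  have Vj: "V j > 0" using j I unfolding linked_def by (metis order_le_less_trans)
  have c\<nu>j: "flow \<nu> j = V j" using crit[OF \<nu> least[OF aP] j] .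
  have "\<not> \<nu> (Suc j) < a (Suc j)"
  proof
    assume less: "\<nu> (Suc j) < a (Suc j)"
    define b' where "b' t = (if t mod f = Suc j mod f then \<nu> t + 1 else m)" for t
    have pb': "periodic b'" using p\<nu> by (auto simp: periodic_def b'_def)
    have ge: "b' t \<le> a t" for t
    proof (cases "t mod f = Suc j mod f")
      case True
      hence "\<nu> t = \<nu> (Suc j)" "a t = a (Suc j)"
        using periodic_mod[OF p\<nu>, of t] periodic_mod[OF p\<nu>, of "Suc j"] periodic_mod[OF a(1), of t] periodic_mod[OF a(1), of "Suc j"] by auto
      thus ?thesis using less True by (simp add: b'_def)
    qed (simp add: b'_def a)
    have "a \<in> Pot V b'" using ge a by (auto simp: Pot_def)
    from Pot_least[OF pb' V this] obtain y where y: "y \<in> Pot V b'" "\<And>x t. x \<in> Pot V b' \<Longrightarrow> y t \<le> x t"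
      "\<And>t. b' (Suc t) < y (Suc t) \<Longrightarrow> flow y t = V t" by blast
    have py: "periodic y" using y(1) by (simp add: Pot_def)
    have mb': "m \<le> b' t" for t using m\<nu>[of t] by (simp add: b'_def)
    have yP: "y \<in> Pot V (\<lambda>_. m)" using y(1) mb' order_trans unfolding Pot_def by fastforce
    have ya: "y t \<le> a t" for t using y(2)[OF \<open>a \<in> Pot V b'\<close>] .
    have ge\<nu>: "\<nu> t \<le> y t" for t using least[OF yP] .
    have all: "\<nu> t < y t" for t
    proof (rule periodic_backward[of "\<lambda>t. \<nu> t < y t" f "Suc j"])
      show "\<nu> (t + f) < y (t + f) \<longleftrightarrow> \<nu> t < y t" for t using py p\<nu> by (simp add: periodic_def)
      show "\<nu> (Suc j) < y (Suc j)" using y(1) unfolding Pot_def b'_def by (auto dest: spec[of _ "Suc j"])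
    next
      fix t assume t: "\<nu> (Suc t) < y (Suc t)"
      have "flow y t \<ge> flow \<nu> t"
      proof (cases "Suc t mod f = Suc j mod f")
        case True
        have "t mod f = j mod f"
          using True by (rule mod_eq_if_Suc_mod_eq)
        hence eq: "flow y t = flow y j" "flow \<nu> t = flow \<nu> j"
          using periodic_mod[OF periodic_flow[OF py], of t] periodic_mod[OF periodic_flow[OF py], of j] periodic_mod[OF periodic_flow[OF p\<nu>], of t]
            periodic_mod[OF periodic_flow[OF p\<nu>], of j] by auto
        show ?thesis using crit[OF yP ya j] c\<nu>j eq by simp
      next
        case False
        hence "b' (Suc t) < y (Suc t)" using t m\<nu>[of "Suc t"] by (simp add: b'_def)
        from y(3)[OF this] c\<nu>[of t] show ?thesis by simp
      qed
      hence "int p * (y t - \<nu> t) > 0" using t by (simp add: flow_def algebra_simps)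
      thus "\<nu> t < y t" using p2 by (simp add: zero_less_mult_iff)
    qed (use f1 in auto)
    define z where "z t = a t - 1" for t
    have cz: "flow z t = flow a t - (int p - 1)" for t unfolding z_def by (rule flow_minus_1)
    have "z \<in> Pot V (\<lambda>_. m)"
    proof -
      have "m \<le> z t" for t using all[of t] ya[of t] m\<nu>[of t] by (simp add: z_def)
      moreover have "flow z t \<le> V t" for t using cz[of t] a(3)[of t] p2 by simp
      moreover have "periodic z" using periodic_diff[OF a(1), of 1] unfolding z_def .
      ultimately show ?thesis by (auto simp: Pot_def)
    qed
    moreover have "z t \<le> a t" for t by (simp add: z_def)
    ultimately have "flow z j = V j" using crit j by blast
    thus False using cz[of j] full[OF j] p2 by simp
  qed
  thus eq: "a (Suc j) = \<nu> (Suc j)" using least[OF aP, of "Suc j"] by simp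
  have "int p * a j = int p * \<nu> j" using full[OF j] c\<nu>j eq unfolding flow_def by linarith
  thus "a j = \<nu> j" using p2 by simp
qed

text \<open>
  The candidate for the next stage must stay at or below \<open>\<nu> - 1\<close>, whose flow is \<open>p - 1\<close> below that of \<open>\<nu>\<close>.
  In the marked classes \<open>a\<close> is pinned to \<open>\<nu>\<close> and \<open>y\<close> is smaller than \<open>a\<close>, so taking the minimum costs nothing there.
\<close>

lemma linked_min:
  assumes I: "linked A m V \<nu> a b" and a'a: "\<And>t. a' t \<le> a t - 1" and y: "periodic y" "\<And>t. m - 1 \<le> y t" "\<And>t. y t \<le> a' t"
  defines "z \<equiv> \<lambda>t. min (y t) (\<nu> t - 1)"
  shows "periodic z" "\<And>t. m - 1 \<le> z t" "\<And>t. z t \<le> \<nu> t - 1"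
    "\<And>t. A t < V t \<Longrightarrow> flow z t \<le> flow y t" "\<And>t. flow z t \<le> max (flow y t) (flow \<nu> t - (int p - 1))"
    "\<And>t. \<nu> (Suc t) = m \<Longrightarrow> flow z t \<le> flow \<nu> t - (int p - 1)"
proof -
  have \<nu>: "periodic \<nu>" "\<And>t. m \<le> \<nu> t" using I unfolding linked_def Pot_def by blast+
  show "periodic z" using \<nu> y by (simp add: z_def periodic_min periodic_diff)
  show mz: "m - 1 \<le> z t" for t using \<nu>(2)[of t] y(2)[of t] by (simp add: z_def)
  show z\<nu>: "z t \<le> \<nu> t - 1" for t by (simp add: z_def)
  have cy: "flow z t \<le> flow y t" if "y (Suc t) \<le> \<nu> (Suc t) - 1" for t
  proof -
    have "int p * z t \<le> int p * y t" by (simp add: z_def mult_left_mono)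
    thus ?thesis using that by (simp add: flow_def z_def)
  qed
  have c\<nu>: "flow z t \<le> flow \<nu> t - (int p - 1)" if "\<nu> (Suc t) - 1 \<le> z (Suc t)" for t
  proof -
    have "int p * z t \<le> int p * (\<nu> t - 1)" using z\<nu>[of t] by (intro mult_left_mono) auto
    thus ?thesis using that by (simp add: flow_def algebra_simps)
  qed
  show "flow z t \<le> flow y t" if "A t < V t" for t
  proof (rule cy)
    show "y (Suc t) \<le> \<nu> (Suc t) - 1" using linked_pinned(1)[OF I that] y(3)[of "Suc t"] a'a[of "Suc t"] by simp
  qed
  show "flow z t \<le> max (flow y t) (flow \<nu> t - (int p - 1))" for t
    using cy[of t] c\<nu>[of t] by (cases "y (Suc t) \<le> \<nu> (Suc t) - 1") (auto simp: z_def)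
  show "flow z t \<le> flow \<nu> t - (int p - 1)" if "\<nu> (Suc t) = m" for t
    by (rule c\<nu>) (use that mz[of "Suc t"] in auto)
qed

text \<open>
  Here \<open>a'\<close> and \<open>b'\<close> are the next members of the two chains, and \<open>A'\<close> counts the units below the lower position
  \<open>T - f\<close>. A potential \<open>y\<close> below \<open>a'\<close> can be copied to the chain of \<open>a\<close> as well as to that of \<open>b\<close>: the result \<open>x\<close> fits
  below \<open>e \<in> {a, b}\<close> and uses no more units than \<open>y\<close>, except for those below the new position.
\<close>

lemma linked_transfer:
  assumes I: "linked A m V \<nu> a b" and m: "1 \<le> m"
    and a': "periodic a'" "\<And>t. m - 1 \<le> a' t" "\<And>t. flow a' t \<le> flow a t" "\<And>t. a' t \<le> a t - 1"
    and b': "\<And>t. flow b' t \<le> flow b t"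
    and A': "\<And>t. 0 \<le> A' t" "\<And>t. A t \<le> A' t + (int p - 1)"
    and y: "periodic y" "\<And>t. m - 1 \<le> y t" "\<And>t. flow y t \<le> max (flow a' t) (flow b' t)" "\<And>t. y t \<le> a' t"
    and e: "e = a \<or> e = b"
  obtains x where "periodic x" "\<And>t. m - 1 \<le> x t" "\<And>t. 0 \<le> flow x t" "\<And>t. flow x t \<le> flow e t"
    "\<And>t. flow x t \<le> max (flow y t) (A' t)"
proof -
  have V: "periodic V" and p\<nu>: "periodic \<nu>" and m\<nu>: "\<And>t. m \<le> \<nu> t" and c\<nu>: "\<And>t. flow \<nu> t \<le> V t"
    and tight: "\<And>t. m < \<nu> (Suc t) \<Longrightarrow> flow \<nu> t = V t"
    and ab: "\<And>t. flow a t \<le> V t" "\<And>t. flow b t \<le> V t"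
    and full: "\<And>t. A t < V t \<Longrightarrow> flow a t = V t" "\<And>t. A t < V t \<Longrightarrow> flow b t = V t"
    using I unfolding linked_def Pot_def by blast+
  have Ie: "\<exists>e'. linked A m V \<nu> e e'" using I e linked_sym by blast
  have pe: "periodic e" and me: "\<And>t. m \<le> e t" and ce: "\<And>t. flow e t \<le> V t" "\<And>t. 0 \<le> flow e t"
    and \<nu>e: "\<And>t. \<nu> t \<le> e t"
    using Ie unfolding linked_def Pot_def by blast+
  have pin: "e (Suc t) = \<nu> (Suc t)" "e t = \<nu> t" if "A t < V t" for t
    using Ie linked_pinned that by blast+
  define z where "z t = min (y t) (\<nu> t - 1)" for t
  note Z = linked_min[OF I a'(4) y(1,2,4), folded z_def]
  have z\<nu>: "flow z t \<le> flow \<nu> t" for t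
  proof (cases "\<nu> (Suc t) = m")
    case True thus ?thesis using Z(6)[of t] p2 by simp
  next
    case False
    hence "flow \<nu> t = V t" using tight[of t] m\<nu>[of "Suc t"] by simp
    moreover have "max (flow a' t) (flow b' t) \<le> V t" using a'(3)[of t] b'[of t] ab[of t] by simp
    ultimately show ?thesis using Z(5)[of t] y(3)[of t] p2 by linarith
  qed
  \<comment> \<open>follow \<open>z\<close> where \<open>e\<close> touches the least potential, and step down by one elsewhere\<close>
  define w where "w t = (if e t = \<nu> t then z t else e t - 1)" for t
  have pw: "periodic w" using pe p\<nu> Z(1) by (simp add: periodic_def w_def)
  have mw: "m - 1 \<le> w t" for t using Z(2)[of t] me[of t] by (simp add: w_def)
  have cw: "flow w t \<le> flow e t - (int p - 1) \<or> (flow w t \<le> flow z t \<and> flow e t = flow \<nu> t)" for t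
  proof -
    have zt: "int p * z t \<le> int p * (\<nu> t - 1)" using Z(3)[of t] by (intro mult_left_mono) auto
    show ?thesis
    proof (cases "e t = \<nu> t"; cases "e (Suc t) = \<nu> (Suc t)")
      assume "e t = \<nu> t" "e (Suc t) = \<nu> (Suc t)"
      thus ?thesis by (simp add: flow_def w_def)
    next
      assume "e t = \<nu> t" "e (Suc t) \<noteq> \<nu> (Suc t)"
      thus ?thesis using zt by (simp add: flow_def w_def algebra_simps)
    next
      assume "e t \<noteq> \<nu> t" "e (Suc t) \<noteq> \<nu> (Suc t)"
      thus ?thesis by (simp add: flow_def w_def algebra_simps)
    next
      assume 1: "e t \<noteq> \<nu> t" "e (Suc t) = \<nu> (Suc t)"
      have "int p * \<nu> t < int p * e t" using 1 \<nu>e[of t] p2 by simp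
      hence "flow \<nu> t < flow e t" using 1 by (simp add: flow_def)
      hence "\<nu> (Suc t) = m" using tight[of t] ce(1)[of t] m\<nu>[of "Suc t"] by force
      hence "z (Suc t) = \<nu> (Suc t) - 1" using Z(2,3)[of "Suc t"] by simp
      thus ?thesis using 1 by (simp add: flow_def w_def algebra_simps)
    qed
  qed
  have cwe: "flow w t \<le> flow e t" for t using cw[of t] z\<nu>[of t] p2 by auto
  have cwA: "flow w t \<le> max (flow y t) (A' t)" for t
  proof (cases "A t < V t")
    case True
    hence "flow w t = flow z t" using pin[OF True] by (simp add: flow_def w_def)
    thus ?thesis using Z(4)[OF True] by simp
  next
    case False
    have "flow e t - (int p - 1) \<le> A' t" "flow \<nu> t - (int p - 1) \<le> A' t"
      using False ce(1)[of t] c\<nu>[of t] A'(2)[of t] by simp_all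
    thus ?thesis using cw[of t] Z(5)[of t] by linarith
  qed
  have wP: "w \<in> Pot (flow w) (\<lambda>_. m - 1)" using pw mw by (simp add: Pot_def)
  have "0 \<le> m - 1" using m by simp
  from Pot_nonneg_flow[OF this wP] obtain x where x: "periodic x" "\<And>t. m - 1 \<le> x t" "\<And>t. 0 \<le> flow x t"
    "\<And>t. flow x t \<le> max 0 (flow w t)" by blast
  show thesis
  proof (rule that[OF x(1,2,3)])
    show "flow x t \<le> flow e t" for t using x(4)[of t] cwe[of t] ce(2)[of t] by linarith
    show "flow x t \<le> max (flow y t) (A' t)" for t using x(4)[of t] cwA[of t] A'(1)[of t] by linarith
  qed
qed

end

section \<open>Base-p digits and classes of positions\<close>

lemma sum_lessThan_add:
  fixes h :: "nat \<Rightarrow> nat" and T n :: nat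
  shows "(\<Sum>s<T + n. h s) = (\<Sum>s<T. h s) + (\<Sum>s<n. h (T + s))"
  by (induction n) simp_all

text \<open>
  Summation by parts: the weight \<open>p\<^sup>s\<close> is \<open>1\<close> plus the increments \<open>p\<^bsup>u+1\<^esup> - p\<^sup>u\<close> for \<open>u < s\<close>. As the increments are
  nonnegative, the sum is monotone in the tails of \<open>g\<close>.
\<close>

lemma sum_weight_by_tails:
  fixes g :: "nat \<Rightarrow> nat"
  assumes "p \<ge> 1"
  shows "(\<Sum>s<N. g s * p ^ s) = (\<Sum>s<N. g s) + (\<Sum>u<N. (p ^ Suc u - p ^ u) * (\<Sum>s=Suc u..<N. g s))"
proof (induction N)
  case (Suc N)
  have tel: "(\<Sum>u<N. p ^ Suc u - p ^ u) = p ^ N - 1"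
  proof (induction N)
    case (Suc N)
    have "1 \<le> p ^ N" "p ^ N \<le> p ^ Suc N" using assms by simp_all
    thus ?case using Suc by simp
  qed simp
  have "(\<Sum>u<Suc N. (p ^ Suc u - p ^ u) * (\<Sum>s=Suc u..<Suc N. g s))
        = (\<Sum>u<N. (p ^ Suc u - p ^ u) * ((\<Sum>s=Suc u..<N. g s) + g N))"
    by (simp del: power_Suc)
  also have "\<dots> = (\<Sum>u<N. (p ^ Suc u - p ^ u) * (\<Sum>s=Suc u..<N. g s)) + (p ^ N - 1) * g N"
    by (simp only: distrib_left sum.distrib tel[symmetric] sum_distrib_right)
  finally have 1: "(\<Sum>u<Suc N. (p ^ Suc u - p ^ u) * (\<Sum>s=Suc u..<Suc N. g s)) =
    (\<Sum>u<N. (p ^ Suc u - p ^ u) * (\<Sum>s=Suc u..<N. g s)) + (p ^ N - 1) * g N" .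
  have "1 \<le> p ^ N" using assms by simp
  then obtain r where r: "p ^ N = Suc r" by (cases "p ^ N") auto
  show ?case unfolding 1 by (simp add: Suc r algebra_simps del: power_Suc)
qed simp

lemma sum_weight_mono_tails:
  fixes g h :: "nat \<Rightarrow> nat"
  assumes "p \<ge> 1" "\<And>T. (\<Sum>s=T..<N. g s) \<le> (\<Sum>s=T..<N. h s)"
  shows "(\<Sum>s<N. g s * p ^ s) \<le> (\<Sum>s<N. h s * p ^ s)"
  unfolding sum_weight_by_tails[OF assms(1)]
proof (rule add_mono)
  show "(\<Sum>s<N. g s) \<le> (\<Sum>s<N. h s)" using assms(2)[of 0] by (simp add: lessThan_atLeast0)
  show "(\<Sum>u<N. (p ^ Suc u - p ^ u) * (\<Sum>s=Suc u..<N. g s)) \<le> (\<Sum>u<N. (p ^ Suc u - p ^ u) * (\<Sum>s=Suc u..<N. h s))"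
    by (rule sum_mono, rule mult_left_mono, rule assms(2)) simp
qed

locale digits =
  fixes p f :: nat
  assumes p2: "p \<ge> 2" and f1: "f \<ge> 1"
begin

definition digit :: "nat \<Rightarrow> nat \<Rightarrow> nat" where "digit k s = k div p ^ s mod p"

definition digits_le :: "nat \<Rightarrow> nat \<Rightarrow> bool" where "digits_le j k \<longleftrightarrow> (\<forall>s. digit j s \<le> digit k s)"

text \<open>
  A digit is regarded as that many units. Position \<open>s\<close> belongs to class \<open>t\<close> iff multiplication by \<open>p\<^bsup>t+1\<^esup>\<close>
  moves it to a multiple of \<open>f\<close>, that is, iff going from \<open>j p\<^sup>t\<close> to \<open>j p\<^bsup>t+1\<^esup>\<close> carries it over to the next
  base-\<open>q\<close> position. The class \<open>t\<close> matters only modulo \<open>f\<close>.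
\<close>

definition count_below :: "nat \<Rightarrow> nat \<Rightarrow> nat \<Rightarrow> nat" where
  "count_below k T t = (\<Sum>s<T. if f dvd s + t + 1 then digit k s else 0)"

text \<open>
  All units of the class are counted, as the digits of \<open>k\<close> at positions from \<open>k\<close> on vanish.
\<close>

definition class_count :: "nat \<Rightarrow> nat \<Rightarrow> nat" where "class_count k t = count_below k k t"

lemma digit_less: "digit k s < p" using p2 by (simp add: digit_def)

lemma less_pow: "k < p ^ s" if "k \<le> s"
proof -
  have "k \<le> s" "s < 2 ^ s" "(2::nat) ^ s \<le> p ^ s" using that p2 by (auto intro: power_mono)
  thus ?thesis by linarith
qed

lemma digit_eq_0: "digit k s = 0" if "k < p ^ s" using that by (simp add: digit_def)

lemma digit_add: "digit k (T + s) = digit (k div p ^ T) s"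
  by (simp only: digit_def power_add div_mult2_eq)

lemma digit_zero [simp]: "digit 0 s = 0" by (simp add: digit_def)

lemma div_pow_eq: "k div p ^ T = (\<Sum>s<N. digit k (T + s) * p ^ s)" if "k < p ^ (T + N)"
  using that
proof (induction N arbitrary: T)
  case (Suc N)
  have "k div p ^ T = p * (k div p ^ Suc T) + digit k T"
    by (simp add: digit_def power_Suc2 div_mult2_eq del: power_Suc)
  also have "k div p ^ Suc T = (\<Sum>s<N. digit k (Suc T + s) * p ^ s)" using Suc.prems by (intro Suc.IH) simp
  finally show ?case by (subst sum.lessThan_Suc_shift) (simp add: sum_distrib_left mult_ac)
qed auto

lemma eq_sum_digit: "k = (\<Sum>s<N. digit k s * p ^ s)" if "k < p ^ N"
  using div_pow_eq[of k 0 N] that by simp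

lemma div_mod_pow: "(\<Sum>s<N. g s * p ^ s) div p ^ T mod p = (if T < N then g T else 0)"
  and sum_less_pow: "(\<Sum>s<N. g s * p ^ s) < p ^ N"
  if g: "\<And>s. g s < p" for g
proof -
  show less: "(\<Sum>s<N. g s * p ^ s) < p ^ N" for N
  proof (induction N)
    case (Suc N)
    have "g N * p ^ N + p ^ N \<le> p * p ^ N" using g[of N] by (metis Suc_leI add.commute mult_Suc mult_le_mono1)
    thus ?case using Suc by simp
  qed simp
  show "(\<Sum>s<N. g s * p ^ s) div p ^ T mod p = (if T < N then g T else 0)"
  proof (cases "T < N")
    case False
    have "(\<Sum>s<N. g s * p ^ s) < p ^ T" using less[of N] False p2
      by (meson linorder_not_less order_less_le_trans one_le_numeral order_trans power_increasing)
    thus ?thesis using False by simp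
  next
    case True
    then obtain r where N: "N = T + Suc r" by (metis add_Suc_right less_imp_Suc_add)
    have "(\<Sum>s<N. g s * p ^ s) = (\<Sum>s<T. g s * p ^ s) + (\<Sum>s<Suc r. g (T + s) * p ^ (T + s))"
      unfolding N by (rule sum_lessThan_add)
    also have "(\<Sum>s<Suc r. g (T + s) * p ^ (T + s)) = p ^ T * (\<Sum>s<Suc r. g (T + s) * p ^ s)"
      by (simp add: sum_distrib_left power_add mult_ac del: sum.lessThan_Suc)
    finally have "(\<Sum>s<N. g s * p ^ s) div p ^ T = (\<Sum>s<Suc r. g (T + s) * p ^ s)"
      using less[of T] p2 by simp
    also have "\<dots> = g T + p * (\<Sum>s<r. g (T + Suc s) * p ^ s)"
      by (subst sum.lessThan_Suc_shift) (simp add: sum_distrib_left mult_ac)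
    finally show ?thesis using True g[of T] by simp
  qed
qed

lemma digit_of_sum: "digit (\<Sum>s<N. g s * p ^ s) T = (if T < N then g T else 0)" if "\<And>s. g s < p"
  using div_mod_pow[OF that] by (simp add: digit_def)

lemma count_below_Suc: "count_below k (Suc T) t = count_below k T t + (if f dvd T + t + 1 then digit k T else 0)" by (simp add: count_below_def)
lemma count_below_0 [simp]: "count_below k 0 t = 0" by (simp add: count_below_def)

lemma count_below_mono: "T \<le> T' \<Longrightarrow> count_below k T t \<le> count_below k T' t"
  by (rule lift_Suc_mono_le[of "\<lambda>T. count_below k T t"]) (auto simp: count_below_Suc)

lemma count_below_stable: "count_below k (T + n) t = count_below k T t" if "k < p ^ T"
proof (induction n)
  case (Suc n)
  have "k < p ^ (T + n)" using that p2 by (meson le_add1 one_le_numeral order_less_le_trans order_trans power_increasing)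
  thus ?case using Suc by (simp add: count_below_Suc digit_eq_0)
qed simp

lemma count_below_eq_class_count: "count_below k T t = class_count k t" if "k < p ^ T"
proof -
  have "count_below k (T + k) t = count_below k (k + T) t" by (simp add: add.commute)
  thus ?thesis using count_below_stable[OF that, of k t] count_below_stable[of k k T t] less_pow[of k k] by (simp add: class_count_def)
qed

lemma count_below_le_class_count: "count_below k T t \<le> class_count k t"
proof -
  have "count_below k T t \<le> count_below k (T + k) t" by (rule count_below_mono) simp
  also have "\<dots> = class_count k t" by (rule count_below_eq_class_count) (rule less_pow, simp)
  finally show ?thesis .
qed

lemma dvd_per: "f dvd s + (t + f) + 1 \<longleftrightarrow> f dvd s + t + 1"
proof -
  have "s + (t + f) + 1 = f + (s + t + 1)" by simp
  thus ?thesis by (simp only: dvd_add_triv_left_iff)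
qed

lemma count_below_periodic: "count_below k T (t + f) = count_below k T t" unfolding count_below_def dvd_per ..
lemma class_count_periodic: "class_count k (t + f) = class_count k t" by (simp add: class_count_def count_below_periodic)

lemma digits_le_count_below: "digits_le j k \<Longrightarrow> count_below j T t \<le> count_below k T t"
  unfolding count_below_def digits_le_def by (intro sum_mono) auto

lemma digits_le_class_count: "digits_le j k \<Longrightarrow> class_count j t \<le> class_count k t"
proof -
  assume s: "digits_le j k"
  have "count_below j (j + k) t \<le> count_below k (j + k) t" by (rule digits_le_count_below[OF s])
  thus ?thesis by (simp add: count_below_eq_class_count less_pow)
qed

lemma digits_le_refl [simp]: "digits_le k k" by (simp add: digits_le_def)
lemma digits_le_trans: "digits_le i j \<Longrightarrow> digits_le j k \<Longrightarrow> digits_le i k" unfolding digits_le_def by (meson order_trans)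

lemma div_le_if_digits_le: "j div p ^ T \<le> k div p ^ T" if "\<And>s. s \<ge> T \<Longrightarrow> digit j s \<le> digit k s"
proof -
  have 1: "j < p ^ (T + (j + k))" "k < p ^ (T + (j + k))" by (auto intro: less_pow)
  show ?thesis unfolding div_pow_eq[OF 1(1)] div_pow_eq[OF 1(2)]
    by (intro sum_mono mult_right_mono that) auto
qed

lemma digits_le_imp_le: "digits_le j k \<Longrightarrow> j \<le> k"
  using div_le_if_digits_le[of 0 j k] by (simp add: digits_le_def)

text \<open>
  Among \<open>f\<close> consecutive positions there is only one of class \<open>t\<close>. For \<open>T < f\<close> the truncated difference is \<open>0\<close>
  and the bound still holds.
\<close>

lemma count_below_shift: "count_below k T t \<le> count_below k (T - f) t + (p - 1)"
proof -
  define U where "U = T - f"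
  have split: "count_below k (U + n) t \<le> count_below k U t + (p - 1)" if "n \<le> f" for n
  proof -
    have "count_below k (U + n) t = count_below k U t \<or> (\<exists>m<n. f dvd U + m + t + 1 \<and> count_below k (U + n) t = count_below k U t + digit k (U + m))"
      using that
    proof (induction n)
      case (Suc n)
      show ?case
      proof (cases "f dvd U + n + t + 1")
        case False thus ?thesis using Suc by (auto simp: count_below_Suc intro: less_SucI)
      next
        case True
        have "\<not> f dvd U + m + t + 1" if "m < n" for m
        proof
          assume "f dvd U + m + t + 1"
          from dvd_diff_nat[OF True this] have "f dvd n - m" by simp
          thus False using that Suc.prems by (auto dest: dvd_imp_le)
        qed
        thus ?thesis using Suc True by (auto simp: count_below_Suc intro!: exI[of _ n])
      qed
    qed simp
    moreover have "digit k (U + m) \<le> p - 1" for m using digit_less[of k "U + m"] by simp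
    ultimately show ?thesis by fastforce
  qed
  have "count_below k T t \<le> count_below k (U + f) t" by (rule count_below_mono) (simp add: U_def)
  also have "\<dots> \<le> count_below k U t + (p - 1)" by (rule split) simp
  finally show ?thesis by (simp add: U_def)
qed

text \<open>
  The representative below \<open>f\<close> of the class of position \<open>s\<close>.
\<close>

definition class_of :: "nat \<Rightarrow> nat" where "class_of s = f - 1 - s mod f"

lemma class_of_dvd: "f dvd s + class_of s + 1"
proof -
  have "s mod f < f" using f1 by simp
  hence "s + class_of s + 1 = f * (s div f) + f" using mult_div_mod_eq[of f s] unfolding class_of_def by linarith
  thus ?thesis by simp
qed

lemma class_of_less: "class_of s < f" using f1 by (simp add: class_of_def)

lemma dvd_iff_class_of: "t < f \<Longrightarrow> f dvd s + t + 1 \<longleftrightarrow> t = class_of s"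
proof
  assume t: "t < f" and d: "f dvd s + t + 1"
  have "f dvd (s + t + 1) - (s + class_of s + 1)" using d class_of_dvd[of s] by (rule dvd_diff_nat)
  moreover have "f dvd (s + class_of s + 1) - (s + t + 1)" using class_of_dvd[of s] d by (rule dvd_diff_nat)
  ultimately have "f dvd t - class_of s" "f dvd class_of s - t" by simp_all
  thus "t = class_of s" using t class_of_less[of s] by (auto dest!: dvd_imp_le simp: not_less[symmetric])
qed (use class_of_dvd[of s] in simp)

lemma dvd_iff_mod_class_of: "f dvd s + t + 1 \<longleftrightarrow> t mod f = class_of s"
proof -
  have "f dvd s + t + 1 \<longleftrightarrow> f dvd s + t mod f + 1"
  proof -
    have "s + t + 1 = (s + t mod f + 1) + f * (t div f)" by simp
    thus ?thesis by (metis dvd_add_times_triv_right_iff mult.commute)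
  qed
  thus ?thesis using dvd_iff_class_of[of "t mod f" s] f1 by simp
qed

lemma sum_count_below: "(\<Sum>t<f. count_below k T t) = (\<Sum>s<T. digit k s)"
proof -
  have "(\<Sum>t<f. count_below k T t) = (\<Sum>s<T. \<Sum>t<f. if f dvd s + t + 1 then digit k s else 0)"
    unfolding count_below_def by (rule sum.swap)
  also have "\<dots> = (\<Sum>s<T. \<Sum>t<f. if t = class_of s then digit k s else 0)"
    by (intro sum.cong refl if_cong dvd_iff_class_of) auto
  also have "\<dots> = (\<Sum>s<T. digit k s)" using class_of_less by (simp add: sum.delta)
  finally show ?thesis .
qed

text \<open>
  The assumption bounds the number of units of \<open>i\<close> at positions from \<open>T\<close> on by that of \<open>j\<close>, class by class; it is
  arranged so as to avoid subtraction. Adding up the classes compares the tails of the two digit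
  sequences.
\<close>

lemma le_if_tails:
  assumes "\<And>T t. class_count i t + count_below j T t \<le> class_count j t + count_below i T t"
  shows "i \<le> j"
proof -
  define N where "N = i + j"
  have N: "i < p ^ N" "j < p ^ N" by (auto simp: N_def intro: less_pow)
  have "(\<Sum>s=T..<N. digit i s) \<le> (\<Sum>s=T..<N. digit j s)" for T
  proof (cases "T \<le> N")
    case True
    have "(\<Sum>t<f. class_count i t + count_below j T t) \<le> (\<Sum>t<f. class_count j t + count_below i T t)" by (intro sum_mono assms)
    hence "(\<Sum>s<N. digit i s) + (\<Sum>s<T. digit j s) \<le> (\<Sum>s<N. digit j s) + (\<Sum>s<T. digit i s)"
      by (simp add: sum.distrib sum_count_below flip: count_below_eq_class_count[OF N(1)] count_below_eq_class_count[OF N(2)])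
    moreover have "(\<Sum>s<N. g s) = (\<Sum>s<T. g s) + (\<Sum>s=T..<N. g s)" for g :: "nat \<Rightarrow> nat"
      using True by (simp add: lessThan_atLeast0 sum.atLeastLessThan_concat)
    ultimately show ?thesis by simp
  qed simp
  hence "(\<Sum>s<N. digit i s * p ^ s) \<le> (\<Sum>s<N. digit j s * p ^ s)" using p2 by (intro sum_weight_mono_tails) auto
  thus ?thesis using eq_sum_digit[OF N(1)] eq_sum_digit[OF N(2)] by simp
qed

text \<open>
  The number that consists of the lowest \<open>n t\<close> units of \<open>K\<close> in each class \<open>t\<close>. It is the least number with digits
  bounded by those of \<open>K\<close> and class counts \<open>n\<close>, see \<open>initial_part_le\<close> below.
\<close>

definition initial_part :: "nat \<Rightarrow> (nat \<Rightarrow> nat) \<Rightarrow> nat" where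
  "initial_part K n = (\<Sum>s<K. (min (n (class_of s)) (count_below K (Suc s) (class_of s)) - min (n (class_of s)) (count_below K s (class_of s))) * p ^ s)"

lemma count_below_Suc_class_of: "count_below K (Suc s) (class_of s) = count_below K s (class_of s) + digit K s"
  using class_of_dvd[of s] by (simp add: count_below_Suc)

lemma digit_initial_part: "digit (initial_part K n) s = min (n (class_of s)) (count_below K (Suc s) (class_of s)) - min (n (class_of s)) (count_below K s (class_of s))"
proof -
  have less: "min (n (class_of s)) (count_below K (Suc s) (class_of s)) - min (n (class_of s)) (count_below K s (class_of s)) < p" for s
    using digit_less[of K s] by (auto simp: count_below_Suc_class_of min_def)
  have "digit K s = 0" if "\<not> s < K" using that by (intro digit_eq_0 less_pow) simp
  thus ?thesis unfolding initial_part_def by (subst digit_of_sum[OF less]) (auto simp: count_below_Suc_class_of)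
qed

lemma count_below_initial_part:
  assumes "\<And>t. n (t + f) = n t"
  shows "count_below (initial_part K n) T t = min (n t) (count_below K T t)"
proof -
  have nm: "n (t mod f) = n t" for t
  proof -
    have "n (s + f * k) = n s" for s k
      by (induction k) (use assms[of "s + f * _"] in \<open>auto simp: algebra_simps\<close>)
    from this[of "t mod f" "t div f"] show ?thesis by simp
  qed
  have Am: "count_below K T (t mod f) = count_below K T t" for T t
  proof -
    have "count_below K T (s + f * k) = count_below K T s" for s k
      by (induction k) (use count_below_periodic[of K T "s + f * _"] in \<open>auto simp: algebra_simps\<close>)
    from this[of "t mod f" "t div f"] show ?thesis by simp
  qed
  show ?thesis
  proof (induction T)
    case (Suc T)
    show ?case
    proof (cases "f dvd T + t + 1")
      case True
      hence c: "class_of T = t mod f" using dvd_iff_mod_class_of[of T t] by simp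
      have "digit (initial_part K n) T = min (n t) (count_below K (Suc T) t) - min (n t) (count_below K T t)"
        using digit_initial_part[of K n T] unfolding c by (simp only: nm Am)
      thus ?thesis using True Suc by (simp add: count_below_Suc)
    qed (use Suc in \<open>simp add: count_below_Suc\<close>)
  qed simp
qed

lemma initial_part_less: "initial_part K n < p ^ K"
proof -
  have "min (n (class_of s)) (count_below K (Suc s) (class_of s)) - min (n (class_of s)) (count_below K s (class_of s)) < p" for s
    using digit_less[of K s] by (auto simp: count_below_Suc_class_of min_def)
  from sum_less_pow[of "\<lambda>s. min (n (class_of s)) (count_below K (Suc s) (class_of s)) - min (n (class_of s)) (count_below K s (class_of s))", OF this]
  show ?thesis unfolding initial_part_def .
qed

lemma class_count_initial_part:
  assumes "\<And>t. n (t + f) = n t"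
  shows "class_count (initial_part K n) t = min (n t) (class_count K t)"
  using count_below_initial_part[where n = n and K = K and T = K and t = t, OF assms] count_below_eq_class_count[OF initial_part_less, of K n t] by (simp add: class_count_def)

text \<open>
  At a position from \<open>T\<close> on, the units below \<open>T\<close> have been used up, so a larger demand that these units
  can meet makes no difference.
\<close>

lemma digit_initial_part_mono:
  assumes "\<And>t. n t \<le> max (n' t) (count_below K T t)" "s \<ge> T"
  shows "digit (initial_part K n) s \<le> digit (initial_part K n') s"
proof -
  have "count_below K T (class_of s) \<le> count_below K s (class_of s)" by (rule count_below_mono) fact
  thus ?thesis using assms(1)[of "class_of s"] count_below_Suc_class_of[of K s] by (auto simp: digit_initial_part min_def max_def split: if_splits)
qed

lemma initial_part_digits_le: "digits_le (initial_part K n) K"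
  unfolding digits_le_def using count_below_Suc_class_of by (auto simp: digit_initial_part min_def)

lemma initial_part_le:
  assumes n: "\<And>t. n (t + f) = n t" and j: "digits_le j K" and class_count: "\<And>t. class_count j t = n t"
  shows "initial_part K n \<le> j"
proof (rule le_if_tails)
  fix T t
  have "class_count (initial_part K n) t = n t" using class_count_initial_part[where n = n and K = K and t = t, OF n] digits_le_class_count[OF j, of t] class_count[of t] by simp
  moreover have "count_below j T t \<le> n t" using count_below_le_class_count[of j T t] class_count[of t] by simp
  ultimately show "class_count (initial_part K n) t + count_below j T t \<le> class_count j t + count_below (initial_part K n) T t"
    using class_count[of t] digits_le_count_below[OF j, of T t] by (simp add: count_below_initial_part[where n = n, OF n])
qed

lemma class_count_eq_if_div_eq:
  assumes "i div p ^ T = j div p ^ T"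
  shows "class_count i t + count_below j T t = class_count j t + count_below i T t"
proof -
  have dg: "digit i s = digit j s" if "s \<ge> T" for s
  proof -
    from that obtain r where s: "s = T + r" by (auto simp: le_iff_add)
    show ?thesis unfolding s digit_add assms ..
  qed
  have "count_below i (T + n) t + count_below j T t = count_below j (T + n) t + count_below i T t" for n
    by (induction n) (auto simp: count_below_Suc dg)
  from this[of "i + j"] show ?thesis by (simp add: count_below_eq_class_count less_pow)
qed

end

section \<open>Feasible numbers and greedy chains\<close>

context digits
begin

text \<open>
  The base-\<open>q\<close> digit sum of \<open>j p\<^sup>t\<close>, as \<open>digit_sum_shift\<close> below shows, written so that it is periodic in \<open>t\<close>.
\<close>

definition rot_sum :: "nat \<Rightarrow> nat \<Rightarrow> nat" where "rot_sum j t = (\<Sum>s<j. digit j s * p ^ ((s + t) mod f))"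

definition rot_residue :: "nat \<Rightarrow> nat \<Rightarrow> nat" where "rot_residue \<rho> t = \<rho> * p ^ t mod (p ^ f - 1)"

text \<open>
  The digits \<open>d\<^sub>t\<close> of the linear relation between potential and flow; they are those of the expansion of \<open>\<rho> / (q - 1)\<close> in base \<open>p\<close>.
\<close>

definition rot_carry :: "nat \<Rightarrow> nat \<Rightarrow> int" where "rot_carry \<rho> t = int (p * rot_residue \<rho> t div (p ^ f - 1))"

definition potential :: "nat \<Rightarrow> nat \<Rightarrow> int" where "potential j t = int (rot_sum j t div (p ^ f - 1))"

definition feasible :: "nat \<Rightarrow> nat \<Rightarrow> bool" where "feasible m j \<longleftrightarrow> (\<forall>t. m * (p ^ f - 1) \<le> rot_sum j t)"

text \<open>
  The greedy choice of the next member of a chain below \<open>K\<close>, if \<open>m\<close> further members are to follow.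
\<close>

definition least_feasible :: "nat \<Rightarrow> nat \<Rightarrow> nat" where
  "least_feasible m K = (LEAST j. digits_le j K \<and> j mod (p ^ f - 1) = K mod (p ^ f - 1) \<and> feasible m j)"

text \<open>
  The sum of the members of the greedy chain of length \<open>n\<close> below \<open>X\<close>, with \<open>X\<close> itself not included.
\<close>

primrec chain_sum :: "nat \<Rightarrow> nat \<Rightarrow> nat" where
  "chain_sum 0 X = 0"
| "chain_sum (Suc n) X = least_feasible n X + chain_sum n (least_feasible n X)"

lemma q_ge_2: "p ^ f \<ge> 2"
proof -
  have "p ^ 1 \<le> p ^ f" using p2 f1 by (intro power_increasing) auto
  thus ?thesis using p2 by simp
qed

lemma q_minus_1_pos: "p ^ f - 1 > 0" using q_ge_2 by simp

lemma cong_q: "x * p ^ f mod (p ^ f - 1) = x mod (p ^ f - 1)"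
proof -
  have "x * p ^ f = x + x * (p ^ f - 1)" using q_ge_2 by (cases "p ^ f") auto
  thus ?thesis by simp
qed

lemma rot_sum_periodic: "rot_sum j (t + f) = rot_sum j t" by (simp add: rot_sum_def add.assoc[symmetric])

lemma rot_sum_Suc: "rot_sum j (Suc t) + (p ^ f - 1) * class_count j t = p * rot_sum j t"
proof -
  have 1: "p ^ ((s + Suc t) mod f) + (p ^ f - 1) * (if f dvd s + t + 1 then 1 else 0) = p * p ^ ((s + t) mod f)" for s
  proof (cases "f dvd s + t + 1")
    case True
    hence "(s + Suc t) mod f = 0" by simp
    moreover have "Suc ((s + t) mod f) = f" using True by (metis Suc_eq_plus1 add_Suc_right add.right_neutral dvd_imp_mod_0 mod_Suc nat.distinct(1))
    hence "p * p ^ ((s + t) mod f) = p ^ f" by (metis power_Suc)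
    ultimately show ?thesis using True q_ge_2 by simp
  next
    case False
    hence "(s + Suc t) mod f = Suc ((s + t) mod f)" by (metis Suc_eq_plus1 add_Suc_right mod_Suc mod_0_imp_dvd)
    thus ?thesis using False by simp
  qed
  have "rot_sum j (Suc t) + (p ^ f - 1) * class_count j t =
    (\<Sum>s<j. digit j s * (p ^ ((s + Suc t) mod f) + (p ^ f - 1) * (if f dvd s + t + 1 then 1 else 0)))"
    unfolding rot_sum_def class_count_def count_below_def sum_distrib_left sum.distrib[symmetric]
    by (intro sum.cong refl) (simp add: algebra_simps)
  also have "\<dots> = p * rot_sum j t" unfolding 1 by (simp add: rot_sum_def sum_distrib_left mult_ac)
  finally show ?thesis .
qed

lemma rot_sum_mod: "rot_sum j t mod (p ^ f - 1) = rot_residue (j mod (p ^ f - 1)) t"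
proof -
  have pm: "p ^ (s mod f) mod (p ^ f - 1) = p ^ s mod (p ^ f - 1)" for s
  proof -
    have "p ^ (a + f * k) mod (p ^ f - 1) = p ^ a mod (p ^ f - 1)" for a k
    proof (induction k)
      case (Suc k)
      have "p ^ (a + f * Suc k) = p ^ (a + f * k) * p ^ f" by (simp add: power_add mult_ac)
      thus ?case using Suc by (simp only: cong_q)
    qed simp
    from this[of "s mod f" "s div f"] show ?thesis by simp
  qed
  have "rot_sum j t mod (p ^ f - 1) = j * p ^ t mod (p ^ f - 1)"
  proof -
    have "rot_sum j t mod (p ^ f - 1) = (\<Sum>s<j. digit j s * (p ^ ((s + t) mod f) mod (p ^ f - 1)) mod (p ^ f - 1)) mod (p ^ f - 1)"
      unfolding rot_sum_def by (simp add: mod_sum_eq mod_mult_right_eq)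
    also have "\<dots> = (\<Sum>s<j. digit j s * p ^ (s + t)) mod (p ^ f - 1)"
      unfolding pm by (simp add: mod_sum_eq mod_mult_right_eq)
    also have "(\<Sum>s<j. digit j s * p ^ (s + t)) = j * p ^ t"
    proof -
      have e: "(\<Sum>s<j. digit j s * p ^ s) = j" by (rule eq_sum_digit[symmetric]) (rule less_pow, simp)
      have "(\<Sum>s<j. digit j s * p ^ (s + t)) = (\<Sum>s<j. digit j s * p ^ s) * p ^ t"
        by (simp add: sum_distrib_right sum_distrib_left power_add mult_ac)
      thus ?thesis by (simp only: e)
    qed
    finally show ?thesis .
  qed
  thus ?thesis by (simp add: rot_residue_def mod_mult_left_eq)
qed

lemma rot_residue_Suc: "rot_residue \<rho> (Suc t) = p * rot_residue \<rho> t mod (p ^ f - 1)"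
  by (simp add: rot_residue_def mod_mult_right_eq mult_ac)

lemma rot_residue_periodic: "rot_residue \<rho> (t + f) = rot_residue \<rho> t"
  unfolding rot_residue_def power_add mult.assoc[symmetric] by (rule cong_q)

lemma rot_carry_eq: "int p * int (rot_residue \<rho> t) = int (p ^ f - 1) * rot_carry \<rho> t + int (rot_residue \<rho> (Suc t))"
proof -
  have "p * rot_residue \<rho> t = (p ^ f - 1) * (p * rot_residue \<rho> t div (p ^ f - 1)) + rot_residue \<rho> (Suc t)"
    unfolding rot_residue_Suc by simp
  thus ?thesis unfolding rot_carry_def by (metis of_nat_add of_nat_mult)
qed

lemma potentials_rot_carry: "potentials p f (rot_carry \<rho>)"
proof
  fix t
  show "rot_carry \<rho> (t + f) = rot_carry \<rho> t" by (simp add: rot_carry_def rot_residue_periodic)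
  have "p * rot_residue \<rho> t < p * (p ^ f - 1)" using p2 q_minus_1_pos by (simp add: rot_residue_def)
  hence "p * rot_residue \<rho> t div (p ^ f - 1) < p" by (simp add: less_mult_imp_div_less)
  thus "rot_carry \<rho> t < int p" by (simp add: rot_carry_def)
qed (use p2 f1 in \<open>auto simp: rot_carry_def\<close>)

lemma feasible_iff: "feasible m j \<longleftrightarrow> (\<forall>t. int m \<le> potential j t)"
  unfolding feasible_def potential_def using q_minus_1_pos by (simp add: less_eq_div_iff_mult_less_eq)

lemma feasible_mono: "feasible m j \<Longrightarrow> m' \<le> m \<Longrightarrow> feasible m' j"
  unfolding feasible_def by (meson mult_le_mono1 le_trans)

lemma feasible_0 [simp]: "feasible 0 j" by (simp add: feasible_def)

lemma least_feasible:
  assumes "feasible m K"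
  shows "digits_le (least_feasible m K) K" "least_feasible m K mod (p ^ f - 1) = K mod (p ^ f - 1)" "feasible m (least_feasible m K)"
proof -
  have "digits_le K K \<and> K mod (p ^ f - 1) = K mod (p ^ f - 1) \<and> feasible m K" using assms by simp
  from LeastI[of "\<lambda>j. digits_le j K \<and> j mod (p ^ f - 1) = K mod (p ^ f - 1) \<and> feasible m j", OF this]
  show "digits_le (least_feasible m K) K" "least_feasible m K mod (p ^ f - 1) = K mod (p ^ f - 1)" "feasible m (least_feasible m K)"
    unfolding least_feasible_def by auto
qed

lemma least_feasible_le: "digits_le j K \<Longrightarrow> j mod (p ^ f - 1) = K mod (p ^ f - 1) \<Longrightarrow> feasible m j \<Longrightarrow> least_feasible m K \<le> j"
  unfolding least_feasible_def by (rule Least_le) simp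

end

text \<open>
  Potentials represent the numbers of one fixed residue class modulo \<open>q - 1\<close>.
\<close>

locale residue = digits +
  fixes \<rho> :: nat
  assumes \<rho>: "\<rho> < p ^ f - 1"
begin

sublocale potentials p f "rot_carry \<rho>" by (rule potentials_rot_carry)

lemma periodic_potential: "periodic (potential j)" by (simp add: periodic_def potential_def rot_sum_periodic)

lemma rot_sum_potential: "j mod (p ^ f - 1) = \<rho> \<Longrightarrow> int (rot_sum j t) = int (p ^ f - 1) * potential j t + int (rot_residue \<rho> t)"
  unfolding potential_def using rot_sum_mod[of j t] by (metis mult_div_mod_eq of_nat_add of_nat_mult)

lemma flow_potential:
  assumes j: "j mod (p ^ f - 1) = \<rho>"
  shows "flow (potential j) t = int (class_count j t)"
proof -
  define Q where "Q = int (p ^ f - 1)"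
  have Q: "Q > 0" unfolding Q_def using q_minus_1_pos by (simp only: of_nat_0_less_iff)
  have 1: "int (rot_sum j (Suc t)) + Q * int (class_count j t) = int p * int (rot_sum j t)"
    using rot_sum_Suc[of j t] unfolding Q_def by (metis of_nat_add of_nat_mult)
  have "Q * flow (potential j) t = int p * (Q * potential j t) - Q * potential j (Suc t) + Q * rot_carry \<rho> t"
    by (simp add: flow_def algebra_simps)
  also have "\<dots> = Q * int (class_count j t)"
    using 1 rot_sum_potential[OF j, of t] rot_sum_potential[OF j, of "Suc t"] rot_carry_eq[of \<rho> t] unfolding Q_def[symmetric]
    by (simp add: algebra_simps)
  finally show ?thesis using Q by simp
qed

text \<open>
  Two periodic solutions of the same linear relation differ by a sequence that is multiplied by \<open>p\<close> in each step,
  hence by \<open>0\<close>. So class counts of the right form determine the potential, and the residue is read off at \<open>t = 0\<close>.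
\<close>

lemma potential_unique:
  assumes x: "periodic x" and cx: "\<And>t. flow x t = int (class_count j t)"
  shows "j mod (p ^ f - 1) = \<rho>" "potential j = x"
proof -
  define Q where "Q = int (p ^ f - 1)"
  have Q: "Q > 0" unfolding Q_def using q_minus_1_pos by (simp only: of_nat_0_less_iff)
  \<comment> \<open>the deviation of \<open>x\<close> from the potential of \<open>j\<close>, multiplied by \<open>q - 1\<close>\<close>
  define \<delta> where "\<delta> t = int (rot_sum j t) - (Q * x t + int (rot_residue \<rho> t))" for t
  have st: "\<delta> (Suc t) = int p * \<delta> t" for t
  proof -
    have 1: "int (rot_sum j (Suc t)) + Q * int (class_count j t) = int p * int (rot_sum j t)"
      using rot_sum_Suc[of j t] unfolding Q_def by (metis of_nat_add of_nat_mult)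
    have 2: "Q * int (class_count j t) = int p * (Q * x t) - Q * x (Suc t) + Q * rot_carry \<rho> t"
      using cx[of t] by (simp add: flow_def algebra_simps flip: cx)
    show ?thesis using 1 2 rot_carry_eq[of \<rho> t] unfolding \<delta>_def Q_def[symmetric] by (simp add: algebra_simps)
  qed
  have pw: "\<delta> (t + n) = int p ^ n * \<delta> t" for t n by (induction n) (auto simp: st)
  have "int (p ^ f) \<ge> 2" using q_ge_2 by linarith
  hence pf: "int p ^ f \<ge> 2" by simp
  have 0: "\<delta> t = 0" for t
  proof -
    have "\<delta> (t + f) = \<delta> t" by (simp add: \<delta>_def rot_sum_periodic rot_residue_periodic periodicD[OF x])
    hence "(int p ^ f - 1) * \<delta> t = 0" using pw[of t f] by (simp add: algebra_simps)
    thus ?thesis using pf by simp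
  qed
  have eq: "rot_sum j t = (p ^ f - 1) * nat (x t) + rot_residue \<rho> t \<and> x t \<ge> 0" for t
  proof -
    have e: "int (rot_sum j t) = Q * x t + int (rot_residue \<rho> t)" using 0[of t] by (simp add: \<delta>_def)
    have "rot_residue \<rho> t < p ^ f - 1" using q_minus_1_pos by (simp add: rot_residue_def)
    hence "int (rot_residue \<rho> t) < Q" unfolding Q_def by (simp only: of_nat_less_iff)
    hence "Q * x t > - Q" using e by linarith
    hence "Q * (x t + 1) > 0" by (simp add: algebra_simps)
    hence "x t > -1" using Q by (simp add: zero_less_mult_iff)
    hence x0: "x t \<ge> 0" by simp
    have "int (rot_sum j t) = int ((p ^ f - 1) * nat (x t) + rot_residue \<rho> t)" using e x0 unfolding Q_def of_nat_add of_nat_mult by (simp only: int_nat_eq if_True)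
    thus ?thesis using x0 by linarith
  qed
  have rl: "rot_residue \<rho> t < p ^ f - 1" for t using q_minus_1_pos by (simp add: rot_residue_def)
  have dm: "rot_sum j t div (p ^ f - 1) = nat (x t)" "rot_sum j t mod (p ^ f - 1) = rot_residue \<rho> t" for t
    using rl[of t] unfolding conjunct1[OF eq[of t]] by simp_all
  show "potential j = x" using dm(1) eq by (auto simp: potential_def fun_eq_iff)
  have "rot_residue (j mod (p ^ f - 1)) 0 = rot_residue \<rho> 0" using dm(2)[of 0] rot_sum_mod[of j 0] by simp
  thus "j mod (p ^ f - 1) = \<rho>" using \<rho> by (simp add: rot_residue_def)
qed

text \<open>
  The least number with potential \<open>x\<close> whose digits are bounded by those of \<open>K\<close>, provided that there is one.
\<close>

definition initial_of :: "nat \<Rightarrow> (nat \<Rightarrow> int) \<Rightarrow> nat" where "initial_of K x = initial_part K (\<lambda>t. nat (flow x t))"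

text \<open>
  \<open>K\<close> has enough units in every class to realise \<open>x\<close>.
\<close>

definition admissible :: "nat \<Rightarrow> (nat \<Rightarrow> int) \<Rightarrow> bool" where
  "admissible K x \<longleftrightarrow> periodic x \<and> (\<forall>t. 0 \<le> flow x t \<and> flow x t \<le> int (class_count K t))"

lemma nat_flow_periodic: "periodic x \<Longrightarrow> nat (flow x (t + f)) = nat (flow x t)"
  using periodic_flow[of x] by (simp add: periodic_def)

lemma admissible_mono: "admissible K y \<Longrightarrow> periodic x \<Longrightarrow> (\<And>t. 0 \<le> flow x t \<and> flow x t \<le> flow y t) \<Longrightarrow> admissible K x"
  unfolding admissible_def by (meson order_trans)

lemma initial_of:
  assumes "admissible K x"
  shows class_count_initial_of: "int (class_count (initial_of K x) t) = flow x t" and initial_of_mod: "initial_of K x mod (p ^ f - 1) = \<rho>" and potential_initial_of: "potential (initial_of K x) = x"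
    and count_below_initial_of: "count_below (initial_of K x) T t = min (nat (flow x t)) (count_below K T t)" and initial_of_digits_le: "digits_le (initial_of K x) K"
proof -
  have x: "periodic x" using assms by (simp add: admissible_def)
  have ub: "0 \<le> flow x t" "flow x t \<le> int (class_count K t)" for t using assms by (auto simp: admissible_def)
  show class_count: "int (class_count (initial_of K x) t) = flow x t" for t
    unfolding initial_of_def using class_count_initial_part[where n = "\<lambda>t. nat (flow x t)", OF nat_flow_periodic[OF x], of K t] ub[of t] by simp
  show "initial_of K x mod (p ^ f - 1) = \<rho>" "potential (initial_of K x) = x" using potential_unique[OF x, of "initial_of K x"] class_count by simp_all
  show "count_below (initial_of K x) T t = min (nat (flow x t)) (count_below K T t)"
    unfolding initial_of_def by (rule count_below_initial_part) (rule nat_flow_periodic[OF x])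
  show "digits_le (initial_of K x) K" unfolding initial_of_def by (rule initial_part_digits_le)
qed

lemma initial_of_div_le:
  assumes "\<And>t. flow x t \<le> max (flow y t) (int (count_below K T t))"
  shows "initial_of K x div p ^ T \<le> initial_of K y div p ^ T"
  unfolding initial_of_def
proof (rule div_le_if_digits_le, rule digit_initial_part_mono)
  fix t show "nat (flow x t) \<le> max (nat (flow y t)) (count_below K T t)" using assms[of t] by linarith
qed

lemma initial_of_mono: "(\<And>t. flow x t \<le> flow y t) \<Longrightarrow> digits_le (initial_of K x) (initial_of K y)"
  unfolding digits_le_def initial_of_def by (intro allI digit_initial_part_mono[of _ _ K 0]) (auto simp: nat_mono)

lemma potential_admissible:
  assumes "digits_le j K" "j mod (p ^ f - 1) = \<rho>"
  shows "admissible K (potential j)" "initial_of K (potential j) \<le> j"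
proof -
  show "admissible K (potential j)" using digits_le_class_count[OF assms(1)] by (simp add: admissible_def periodic_potential flow_potential[OF assms(2)])
  show "initial_of K (potential j) \<le> j" unfolding initial_of_def flow_potential[OF assms(2)]
    by (rule initial_part_le) (auto simp: class_count_periodic assms(1))
qed

lemma flow_eq_if_div_eq:
  assumes x: "admissible K x" and y: "admissible K y" and e: "initial_of K x div p ^ T = initial_of K y div p ^ T"
    and T: "int (count_below K T t) < flow x t"
  shows "flow y t = flow x t"
proof -
  have "class_count (initial_of K x) t + count_below (initial_of K y) T t = class_count (initial_of K y) t + count_below (initial_of K x) T t" by (rule class_count_eq_if_div_eq[OF e])
  hence "flow x t + int (min (nat (flow y t)) (count_below K T t)) = flow y t + int (min (nat (flow x t)) (count_below K T t))"
    unfolding count_below_initial_of[OF x] count_below_initial_of[OF y] class_count_initial_of[OF x, symmetric] class_count_initial_of[OF y, symmetric] by linarith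
  thus ?thesis using T y unfolding admissible_def by (auto simp: min_def split: if_splits)
qed

text \<open>
  The least feasible number is initial, because replacing it by the initial number with the same potential
  keeps it feasible and can only decrease it. So greedy choices can be studied on potentials.
\<close>

lemma least_feasible_initial:
  assumes a: "admissible K a" and m: "\<And>t. int m \<le> a t"
  defines "J \<equiv> least_feasible m (initial_of K a)"
  defines "a' \<equiv> potential J"
  shows "admissible K a'" "\<And>t. flow a' t \<le> flow a t" "initial_of K a' = J" "\<And>t. int m \<le> a' t"
    and "\<And>x. periodic x \<Longrightarrow> (\<And>t. int m \<le> x t) \<Longrightarrow> (\<And>t. 0 \<le> flow x t) \<Longrightarrow> (\<And>t. flow x t \<le> flow a t) \<Longrightarrow> J \<le> initial_of K x"
proof -
  have fe: "feasible m (initial_of K a)" using m by (simp add: feasible_iff potential_initial_of[OF a])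
  note J = least_feasible[OF fe, folded J_def]
  have Jm: "J mod (p ^ f - 1) = \<rho>" using J(2) initial_of_mod[OF a] by simp
  have JK: "digits_le J K" using digits_le_trans[OF J(1) initial_of_digits_le[OF a]] .
  show adm': "admissible K a'" unfolding a'_def by (rule potential_admissible(1)[OF JK Jm])
  show ca: "flow a' t \<le> flow a t" for t
    using digits_le_class_count[OF J(1), of t] class_count_initial_of[OF a, of t] flow_potential[OF Jm, of t] by (simp add: a'_def)
  show m': "int m \<le> a' t" for t using J(3) by (simp add: feasible_iff a'_def)
  show cand: "J \<le> initial_of K x" if "periodic x" "\<And>t. int m \<le> x t" "\<And>t. 0 \<le> flow x t" "\<And>t. flow x t \<le> flow a t" for x
  proof -
    have ax: "admissible K x" using a that(1) by (rule admissible_mono) (use that in auto)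
    show ?thesis unfolding J_def
      by (rule least_feasible_le) (use initial_of_mono that initial_of_mod[OF ax] initial_of_mod[OF a] in \<open>auto simp: feasible_iff potential_initial_of[OF ax]\<close>)
  qed
  have "J \<le> initial_of K a'" by (rule cand) (use adm' ca m' in \<open>auto simp: admissible_def\<close>)
  moreover have "initial_of K a' \<le> J" unfolding a'_def by (rule potential_admissible(2)[OF JK Jm])
  ultimately show "initial_of K a' = J" by simp
qed

text \<open>
  Multiplication by \<open>q\<close> moves all digits up by \<open>f\<close> positions and so preserves their classes.
\<close>

lemma count_below_mult_q: "count_below (k * p ^ f) T t = count_below k (T - f) t"
proof -
  have dg: "digit (k * p ^ f) s = (if s < f then 0 else digit k (s - f))" for s
  proof (cases "s < f")
    case True
    have "k * p ^ f = p * (k * p ^ (f - s - 1)) * p ^ s"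
      using True by (simp add: power_add[symmetric] mult_ac flip: power_Suc)
    hence "k * p ^ f div p ^ s = p * (k * p ^ (f - s - 1))" using p2 by (simp only: nonzero_mult_div_cancel_right) simp
    thus ?thesis using True by (simp add: digit_def)
  next
    case False
    then obtain n where s: "s = f + n" by (auto simp: le_iff_add not_less)
    have "digit (k * p ^ f) s = digit (k * p ^ f div p ^ f) n" unfolding s by (rule digit_add)
    thus ?thesis using p2 s by simp
  qed
  have small: "count_below (k * p ^ f) n t = 0" if "n \<le> f" for n
    using that by (induction n) (auto simp: count_below_Suc dg)
  have "count_below (k * p ^ f) (f + n) t = count_below k n t" for n
  proof (induction n)
    case (Suc n)
    have "f + n + t + 1 = f + (n + t + 1)" by simp
    hence "f dvd f + n + t + 1 \<longleftrightarrow> f dvd n + t + 1" by (simp only: dvd_add_triv_left_iff)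
    thus ?case using Suc by (simp add: count_below_Suc dg)
  qed (simp add: small)
  from this[of "T - f"] small[of T] show ?thesis by (cases "T \<le> f") auto
qed

lemma class_count_mult_q: "class_count (k * p ^ f) t = class_count k t"
proof -
  define T where "T = f + k * p ^ f + k"
  have "k * p ^ f < p ^ T" "k < p ^ (T - f)" by (rule less_pow, simp add: T_def)+
  thus ?thesis using count_below_mult_q[of k T t] count_below_eq_class_count by metis
qed

text \<open>
  If \<open>m + 1\<close> members can follow, then \<open>a - 1\<close> is feasible for \<open>m\<close>, and its flow saves \<open>p - 1\<close> units in each class. As a
  window of \<open>f\<close> positions has at most \<open>p - 1\<close> units of a class, the greedy choice
  is at most the starting number with all digits moved down by \<open>f\<close> positions. This gives the factor \<open>q\<close>.
\<close>

lemma least_feasible_drop: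
  assumes a: "admissible K a" and m: "\<And>t. int (Suc m) \<le> a t"
  defines "J \<equiv> least_feasible m (initial_of K a)"
  shows "potential J t \<le> a t - 1" "p ^ f * J \<le> initial_of K a"
proof -
  have pa: "periodic a" using a by (simp add: admissible_def)
  have m': "int m \<le> a t" for t using m[of t] by simp
  note J = least_feasible_initial[OF a m', folded J_def]
  define w where "w t = a t - 1" for t
  have cw: "flow w t = flow a t - (int p - 1)" for t unfolding w_def by (rule flow_minus_1)
  have pw: "periodic w" unfolding w_def by (rule periodic_diff[OF pa])
  have "int m \<le> w t" for t using m[of t] by (simp add: w_def)
  hence "w \<in> Pot (flow w) (\<lambda>_. int m)" using pw by (simp add: Pot_def)
  obtain x where x: "periodic x" "\<And>t. int m \<le> x t" "\<And>t. 0 \<le> flow x t"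
    "\<And>t. flow x t \<le> max 0 (flow w t)" "\<And>t. x t \<le> w t"
    using Pot_nonneg_flow[OF of_nat_0_le_iff \<open>w \<in> _\<close>] by blast
  have ca0: "0 \<le> flow a t" for t using a by (simp add: admissible_def)
  have cx: "flow x t \<le> flow a t" for t using x(4)[of t] cw[of t] ca0[of t] p2 by simp
  have ax: "admissible K x" using a x(1) by (rule admissible_mono) (use x cx in auto)
  have Jx: "J \<le> initial_of K x" by (rule J(5)) (use x cx in auto)
  have "initial_of K x \<noteq> initial_of K a"
  proof
    assume "initial_of K x = initial_of K a"
    hence "potential (initial_of K x) = potential (initial_of K a)" by (simp only:)
    hence "x = a" unfolding potential_initial_of[OF ax] potential_initial_of[OF a] .
    thus False using x(5)[of 0] by (simp add: w_def)
  qed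
  moreover have "initial_of K x \<le> initial_of K a" by (rule digits_le_imp_le, rule initial_of_mono, rule cx)
  ultimately have "J \<noteq> initial_of K a" using Jx by simp
  hence ne: "potential J \<noteq> a" using J(3) by auto
  show "potential J t \<le> a t - 1"
    by (rule less_if_flow_le[OF pa _ _ ne]) (use J in \<open>auto simp: admissible_def\<close>)
  have "initial_of K x * p ^ f \<le> initial_of K a"
  proof (rule le_if_tails)
    fix T t
    have "flow x t \<le> flow a t - (int p - 1) \<or> flow x t \<le> 0" using x(4)[of t] cw[of t] by linarith
    moreover have "count_below K T t \<le> count_below K (T - f) t + (p - 1)" by (rule count_below_shift)
    ultimately have "int (class_count (initial_of K x) t) + int (count_below (initial_of K a) T t) \<le> int (class_count (initial_of K a) t) + int (count_below (initial_of K x) (T - f) t)"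
      unfolding count_below_initial_of[OF ax] count_below_initial_of[OF a] class_count_initial_of[OF ax] class_count_initial_of[OF a] using p2 ca0[of t] x(3)[of t]
      by (auto simp: min_def)
    thus "class_count (initial_of K x * p ^ f) t + count_below (initial_of K a) T t \<le> class_count (initial_of K a) t + count_below (initial_of K x * p ^ f) T t"
      by (simp add: count_below_mult_q class_count_mult_q)
  qed
  thus "p ^ f * J \<le> initial_of K a" using Jx by (metis mult.commute mult_le_mono1 order_trans)
qed

end

section \<open>Comparing two greedy chains\<close>

context residue
begin

text \<open>
  By \<open>linked_transfer\<close>, each of the two greedy choices \<open>a'\<close>, \<open>b'\<close> can be imitated below the other chain at no cost from position
  \<open>T - f\<close> on. As both are least, they agree there. The same transfer turns a saving below \<open>a'\<close> or \<open>b'\<close> into a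
  number smaller than the greedy choice, so the new pair is linked again.
\<close>

lemma linked_step:
  assumes I: "linked (\<lambda>t. int (count_below K T t)) (int (Suc m)) V \<nu> a b" and a: "admissible K a" and b: "admissible K b"
  defines "a' \<equiv> potential (least_feasible m (initial_of K a))" and "b' \<equiv> potential (least_feasible m (initial_of K b))"
  shows "initial_of K a' div p ^ (T - f) = initial_of K b' div p ^ (T - f)"
    and "\<exists>V' \<nu>'. linked (\<lambda>t. int (count_below K (T - f) t)) (int m) V' \<nu>' a' b'"
proof -
  define T' where "T' = T - f"
  define V' where "V' t = max (flow a' t) (flow b' t)" for t
  have ma: "\<And>t. int (Suc m) \<le> a t" and mb: "\<And>t. int (Suc m) \<le> b t"
    using I unfolding linked_def Pot_def by blast+
  have ma': "int m \<le> a t" and mb': "int m \<le> b t" for t using ma[of t] mb[of t] by simp_all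
  note a' = least_feasible_initial[OF a ma', folded a'_def] and b' = least_feasible_initial[OF b mb', folded b'_def]
  have a'a: "a' t \<le> a t - 1" and b'b: "b' t \<le> b t - 1" for t
    unfolding a'_def b'_def by (rule least_feasible_drop(1)[OF a ma] least_feasible_drop(1)[OF b mb])+
  have pa': "periodic a'" "\<And>t. 0 \<le> flow a' t" and pb': "periodic b'" "\<And>t. 0 \<le> flow b' t" using a'(1) b'(1) by (auto simp: admissible_def)
  have As: "int (count_below K T t) \<le> int (count_below K T' t) + (int p - 1)" for t
    using count_below_shift[of K T t] p2 unfolding T'_def by linarith
  have trans: "\<exists>x. periodic x \<and> (\<forall>t. int m \<le> x t) \<and> (\<forall>t. 0 \<le> flow x t) \<and> (\<forall>t. flow x t \<le> flow e t) \<and>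
      (\<forall>t. flow x t \<le> max (flow y t) (int (count_below K T' t)))"
    if y: "y \<in> Pot V' (\<lambda>_. int m)" and ya: "(\<forall>t. y t \<le> a' t) \<or> (\<forall>t. y t \<le> b' t)" and e: "e = a \<or> e = b" for y e
  proof -
    have y': "periodic y" "\<And>t. int (Suc m) - 1 \<le> y t" "\<And>t. flow y t \<le> V' t" using y by (auto simp: Pot_def)
    from ya show ?thesis
    proof
      assume ya: "\<forall>t. y t \<le> a' t"
      show ?thesis
        by (rule linked_transfer[OF I _ pa'(1) _ a'(2) a'a b'(2) _ As y'(1,2) _ _ e])
          (use a' ya y'(3) in \<open>auto simp: V'_def\<close>)
    next
      assume yb: "\<forall>t. y t \<le> b' t"
      have e': "e = b \<or> e = a" using e by blast
      show ?thesis
        by (rule linked_transfer[OF linked_sym[OF I] _ pb'(1) _ b'(2) b'b a'(2) _ As y'(1,2) _ _ e'])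
          (use b' yb y'(3) in \<open>auto simp: V'_def max.commute\<close>)
    qed
  qed
  have perV': "periodic V'"
    using periodic_flow[OF pa'(1)] periodic_flow[OF pb'(1)] by (simp add: periodic_def V'_def)
  have ab'V: "flow a' t \<le> V' t" "flow b' t \<le> V' t" for t by (simp_all add: V'_def)
  have aPot: "a' \<in> Pot V' (\<lambda>_. int m)" using pa' a'(4) ab'V by (simp add: Pot_def)
  have bPot: "b' \<in> Pot V' (\<lambda>_. int m)" using pb' b'(4) ab'V by (simp add: Pot_def)
  have le1: "initial_of K b' div p ^ T' \<le> initial_of K a' div p ^ T'"
  proof -
    obtain x where x: "periodic x" "\<And>t. int m \<le> x t" "\<And>t. 0 \<le> flow x t" "\<And>t. flow x t \<le> flow b t"
      "\<And>t. flow x t \<le> max (flow a' t) (int (count_below K T' t))" using trans[OF aPot, of b] by auto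
    have "initial_of K b' \<le> initial_of K x" unfolding b'(3) by (rule b'(5)) (use x in auto)
    hence "initial_of K b' div p ^ T' \<le> initial_of K x div p ^ T'" by (rule div_le_mono)
    also have "\<dots> \<le> initial_of K a' div p ^ T'" by (rule initial_of_div_le) (rule x(5))
    finally show ?thesis .
  qed
  have le2: "initial_of K a' div p ^ T' \<le> initial_of K b' div p ^ T'"
  proof -
    obtain x where x: "periodic x" "\<And>t. int m \<le> x t" "\<And>t. 0 \<le> flow x t" "\<And>t. flow x t \<le> flow a t"
      "\<And>t. flow x t \<le> max (flow b' t) (int (count_below K T' t))" using trans[OF bPot, of a] by auto
    have "initial_of K a' \<le> initial_of K x" unfolding a'(3) by (rule a'(5)) (use x in auto)
    hence "initial_of K a' div p ^ T' \<le> initial_of K x div p ^ T'" by (rule div_le_mono)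
    also have "\<dots> \<le> initial_of K b' div p ^ T'" by (rule initial_of_div_le) (rule x(5))
    finally show ?thesis .
  qed
  show eq: "initial_of K a' div p ^ (T - f) = initial_of K b' div p ^ (T - f)" using le1 le2 by (simp add: T'_def)
  have full: "flow a' t = V' t \<and> flow b' t = V' t" if t: "int (count_below K T' t) < V' t" for t
  proof (cases "flow b' t \<le> flow a' t")
    case True
    have "flow b' t = flow a' t" by (rule flow_eq_if_div_eq[OF a'(1) b'(1) eq[folded T'_def]]) (use t True in \<open>simp add: V'_def\<close>)
    thus ?thesis by (simp add: V'_def)
  next
    case False
    have "flow a' t = flow b' t" by (rule flow_eq_if_div_eq[OF b'(1) a'(1) eq[folded T'_def, symmetric]]) (use t False in \<open>simp add: V'_def\<close>)
    thus ?thesis by (simp add: V'_def)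
  qed
  have crit: "flow y t = V' t" if y: "y \<in> Pot V' (\<lambda>_. int m)" and ya: "(\<forall>t. y t \<le> a' t) \<or> (\<forall>t. y t \<le> b' t)"
    and t: "int (count_below K T' t) < V' t" for y t
  proof -
    obtain x where x: "periodic x" "\<And>t. int m \<le> x t" "\<And>t. 0 \<le> flow x t" "\<And>t. flow x t \<le> flow a t"
      "\<And>t. flow x t \<le> max (flow y t) (int (count_below K T' t))" using trans[OF y ya, of a] by auto
    have yV: "flow y t \<le> V' t" for t using y by (simp add: Pot_def)
    have ax: "admissible K x" using a x(1) by (rule admissible_mono) (use x in auto)
    have "initial_of K a' \<le> initial_of K x" unfolding a'(3) by (rule a'(5)) (use x in auto)
    hence 1: "initial_of K a' div p ^ T' \<le> initial_of K x div p ^ T'" by (rule div_le_mono)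
    have "flow x t \<le> max (flow a' t) (int (count_below K T' t))" for t
      using x(5)[of t] yV[of t] full[of t] by linarith
    hence 2: "initial_of K x div p ^ T' \<le> initial_of K a' div p ^ T'" by (rule initial_of_div_le)
    have "flow x t = flow a' t" by (rule flow_eq_if_div_eq[OF a'(1) ax]) (use 1 2 t full in auto)
    thus ?thesis using x(5)[of t] yV[of t] full[OF t] t by linarith
  qed
  obtain \<nu>' where \<nu>': "\<nu>' \<in> Pot V' (\<lambda>_. int m)" "\<And>x t. x \<in> Pot V' (\<lambda>_. int m) \<Longrightarrow> \<nu>' t \<le> x t"
    "\<And>t. int m < \<nu>' (Suc t) \<Longrightarrow> flow \<nu>' t = V' t" using Pot_least[OF periodic_const perV' aPot] by blast
  have "linked (\<lambda>t. int (count_below K T' t)) (int m) V' \<nu>' a' b'"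
    unfolding linked_def using perV' pa' pb' a'(4) b'(4) ab'V \<nu>' full crit by simp
  thus "\<exists>V' \<nu>'. linked (\<lambda>t. int (count_below K (T - f) t)) (int m) V' \<nu>' a' b'" unfolding T'_def by blast
qed

lemma class_shift: "f dvd E' + f + t + 1 \<longleftrightarrow> f dvd E' + t + 1"
proof -
  have "E' + f + t + 1 = f + (E' + t + 1)" by simp
  thus ?thesis by (simp only: dvd_add_triv_left_iff)
qed

text \<open>
  What the members of two linked chains below the starting points can differ by in total: the
  \<open>i\<close>-th members agree from position \<open>T - i f\<close> on. The truncated difference becomes \<open>0\<close> eventually, and
  \<open>p\<^sup>0 - 1\<close> contributes nothing.
\<close>

primrec gap_bound :: "nat \<Rightarrow> nat \<Rightarrow> nat" where
  "gap_bound 0 T = 0"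
| "gap_bound (Suc m) T = (p ^ (T - f) - 1) + gap_bound m (T - f)"

lemma chain_sum_diff:
  assumes "linked (\<lambda>t. int (count_below K T t)) (int m) V \<nu> a b" "admissible K a" "admissible K b"
  shows "chain_sum m (initial_of K a) \<le> chain_sum m (initial_of K b) + gap_bound m T"
  using assms
proof (induction m arbitrary: T V \<nu> a b)
  case (Suc m)
  define a' where "a' = potential (least_feasible m (initial_of K a))"
  define b' where "b' = potential (least_feasible m (initial_of K b))"
  have "int m \<le> a t" "int m \<le> b t" for t
  proof -
    have "int (Suc m) \<le> a t" "int (Suc m) \<le> b t" using Suc.prems(1) unfolding linked_def by blast+
    thus "int m \<le> a t" "int m \<le> b t" by simp_all
  qed
  note a' = least_feasible_initial[OF Suc.prems(2) this(1), folded a'_def] and b' = least_feasible_initial[OF Suc.prems(3) this(2), folded b'_def]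
  note st = linked_step[OF Suc.prems, folded a'_def b'_def]
  have IH: "chain_sum m (initial_of K a') \<le> chain_sum m (initial_of K b') + gap_bound m (T - f)"
    using st(2) Suc.IH[OF _ a'(1) b'(1)] by blast
  have "initial_of K a' = p ^ (T - f) * (initial_of K b' div p ^ (T - f)) + initial_of K a' mod p ^ (T - f)"
    using st(1) mult_div_mod_eq[of "p ^ (T - f)" "initial_of K a'"] by simp
  also have "initial_of K a' mod p ^ (T - f) \<le> p ^ (T - f) - 1"
    using p2 by (metis Suc_pred' less_Suc_eq_le mod_less_divisor pos2 zero_less_power order_less_le_trans)
  also have "p ^ (T - f) * (initial_of K b' div p ^ (T - f)) \<le> initial_of K b'" by simp
  finally have "initial_of K a' \<le> initial_of K b' + (p ^ (T - f) - 1)" by simp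
  thus ?case using IH a'(3) b'(3) by simp
qed simp

text \<open>
  As \<open>E\<close> is not of class \<open>t\<close>, each of the windows of \<open>f - 1\<close> positions between \<open>E - i f\<close> and \<open>E - (i - 1) f\<close> contains
  a position of class \<open>t\<close>, whose weight is at least \<open>p\<^bsup>E - i f + 1\<^esup>\<close>.
\<close>

lemma gap_bound_le:
  assumes "\<not> f dvd E + t + 1"
  shows "gap_bound m (Suc E) \<le> (\<Sum>s<E. if f dvd s + t + 1 then p ^ s else 0)"
  using assms
proof (induction m arbitrary: E)
  case (Suc m)
  have bnd0: "gap_bound m 0 = 0" for m by (induction m) auto
  show ?case
  proof (cases "Suc E \<le> f")
    case True thus ?thesis by (simp add: bnd0)
  next
    case False
    define E' where "E' = E - f"
    have E: "E = E' + f" using False by (simp add: E'_def)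
    have nd: "\<not> f dvd E' + t + 1"
      using Suc.prems unfolding E class_shift .
    have IH: "gap_bound m (Suc E') \<le> (\<Sum>s<E'. if f dvd s + t + 1 then p ^ s else 0)" by (rule Suc.IH[OF nd])
    \<comment> \<open>\<open>E' + k\<close> is the next position of class \<open>t\<close> after \<open>E'\<close>\<close>
    define k where "k = f - (E' + t + 1) mod f"
    have mf: "(E' + t + 1) mod f < f" "(E' + t + 1) mod f > 0" using nd f1 by (auto simp: dvd_eq_mod_eq_0)
    have k: "k > 0" "k < f" using mf by (auto simp: k_def)
    have "E' + k + t + 1 = f * ((E' + t + 1) div f) + f"
      using mult_div_mod_eq[of f "E' + t + 1"] mf unfolding k_def by linarith
    hence dk: "f dvd E' + k + t + 1" by simp
    have "(\<Sum>s<E'. if f dvd s + t + 1 then p ^ s else 0) + p ^ (E' + k)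
          \<le> (\<Sum>s\<in>insert (E' + k) {..<E'}. if f dvd s + t + 1 then p ^ s else 0)"
      using dk by simp
    also have "\<dots> \<le> (\<Sum>s<E. if f dvd s + t + 1 then p ^ s else 0)"
      by (rule sum_mono2) (use k E in auto)
    finally have 1: "(\<Sum>s<E'. if f dvd s + t + 1 then p ^ s else 0) + p ^ (E' + k) \<le> (\<Sum>s<E. if f dvd s + t + 1 then p ^ s else 0)" .
    have "p ^ Suc E' \<le> p ^ (E' + k)" using k p2 by (intro power_increasing) auto
    moreover have "Suc E - f = Suc E'" using E by simp
    ultimately show ?thesis using IH 1 by (simp del: power_Suc)
  qed
qed simp

text \<open>
  Each member is at most the \<open>q\<close>-th part of the previous one, so the geometric series bounds the sum.
\<close>

lemma chain_sum_le:
  assumes "admissible K a" "\<And>t. int m \<le> a t"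
  shows "(p ^ f - 1) * chain_sum m (initial_of K a) \<le> initial_of K a"
  using assms
proof (induction m arbitrary: a)
  case (Suc m)
  define a' where "a' = potential (least_feasible m (initial_of K a))"
  have ma: "int m \<le> a t" for t using Suc.prems(2)[of t] by simp
  note a' = least_feasible_initial[OF Suc.prems(1) ma, folded a'_def]
  have "(p ^ f - 1) * chain_sum m (initial_of K a') \<le> initial_of K a'" by (rule Suc.IH[OF a'(1,4)])
  moreover have "p ^ f * initial_of K a' \<le> initial_of K a" using least_feasible_drop(2)[OF Suc.prems] a'(3) by simp
  moreover have "p ^ f * initial_of K a' = (p ^ f - 1) * initial_of K a' + initial_of K a'"
  proof -
    have "p ^ f = Suc (p ^ f - 1)" using q_minus_1_pos by simp
    thus ?thesis by (metis mult_Suc add.commute)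
  qed
  ultimately have "(p ^ f - 1) * initial_of K a' + (p ^ f - 1) * chain_sum m (initial_of K a') \<le> initial_of K a" by linarith
  thus ?case unfolding chain_sum.simps a'(3)[symmetric] distrib_left .
qed simp

text \<open>
  The positions \<open>E - f\<close>, \<open>E - 2 f\<close>, \<open>\<dots>\<close> have the class of \<open>E\<close>; filled with the largest digit they give a geometric
  series with ratio \<open>q\<close>, which nearly reaches \<open>(p - 1) p\<^sup>E / (q - 1)\<close>.
\<close>

lemma class_sum_bound:
  assumes "f dvd E + u + 1"
  shows "(p - 1) * p ^ E < p ^ f + (p ^ f - 1) * (\<Sum>s<E. if f dvd s + u + 1 then (p - 1) * p ^ s else 0)"
  using assms
proof (induction E rule: less_induct)
  case (less E)
  show ?case
  proof (cases "E < f")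
    case True
    have "p ^ E \<le> p ^ (f - 1)" using True p2 by (intro power_increasing) auto
    hence "p * p ^ E \<le> p * p ^ (f - 1)" by simp
    also have "\<dots> = p ^ f" using f1 by (metis Suc_pred' less_eq_Suc_le power_Suc One_nat_def)
    finally have "p * p ^ E \<le> p ^ f" .
    moreover have "(p - 1) * p ^ E < p * p ^ E" using p2 by simp
    ultimately show ?thesis by linarith
  next
    case False
    define E' where "E' = E - f"
    have E: "E = E' + f" using False by (simp add: E'_def)
    have d': "f dvd E' + u + 1"
      using less.prems unfolding E class_shift .
    define Y where "Y = (\<Sum>s<E'. if f dvd s + u + 1 then (p - 1) * p ^ s else 0)"
    have IH: "(p - 1) * p ^ E' < p ^ f + (p ^ f - 1) * Y"
      unfolding Y_def by (rule less.IH[OF _ d']) (use E f1 in simp)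
    have "Y + (p - 1) * p ^ E' = (\<Sum>s\<in>insert E' {..<E'}. if f dvd s + u + 1 then (p - 1) * p ^ s else 0)"
      using d' by (simp add: Y_def)
    also have "\<dots> \<le> (\<Sum>s<E. if f dvd s + u + 1 then (p - 1) * p ^ s else 0)"
      by (rule sum_mono2) (use E f1 in auto)
    finally have "(p ^ f - 1) * (Y + (p - 1) * p ^ E') \<le>
      (p ^ f - 1) * (\<Sum>s<E. if f dvd s + u + 1 then (p - 1) * p ^ s else 0)" by (rule mult_le_mono2)
    moreover have "(p - 1) * p ^ E = (p - 1) * p ^ E' + (p ^ f - 1) * ((p - 1) * p ^ E')"
    proof -
      have "(p - 1) * p ^ E = p ^ f * ((p - 1) * p ^ E')" by (simp add: E power_add)
      moreover have "p ^ f = Suc (p ^ f - 1)" using q_minus_1_pos by simp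
      ultimately show ?thesis by (metis mult_Suc)
    qed
    ultimately show ?thesis using IH by (simp only: distrib_left)
  qed
qed

end

section \<open>The greedy chain has the least sum\<close>

context digits
begin

lemma split_at: "k = (\<Sum>s<T. digit k s * p ^ s) + p ^ T * (k div p ^ T)"
proof (induction T)
  case (Suc T)
  have "k div p ^ T = p * (k div p ^ Suc T) + digit k T"
    by (simp add: digit_def power_Suc2 div_mult2_eq del: power_Suc)
  hence "p ^ T * (k div p ^ T) = p ^ Suc T * (k div p ^ Suc T) + digit k T * p ^ T"
    by (simp add: algebra_simps)
  thus ?case using Suc by simp
qed simp

lemma sum_full_digits: "(\<Sum>s<E. (p - 1) * p ^ s) + 1 = p ^ E"
proof (induction E)
  case (Suc E)
  have "(p - 1) * p ^ E + p ^ E = p * p ^ E" using p2 by (cases p) auto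
  thus ?case using Suc by simp
qed simp

lemma rot_sum_0 [simp]: "rot_sum 0 t = 0" by (simp add: rot_sum_def)

end

context residue
begin

text \<open>
  \<open>K\<close> is the initial number for its own potential, as it uses all of its units.
\<close>

lemma initial_of_potential:
  assumes "K mod (p ^ f - 1) = \<rho>"
  shows "admissible K (potential K)" "initial_of K (potential K) = K"
proof -
  show a: "admissible K (potential K)" using potential_admissible(1)[OF digits_le_refl assms] .
  have "K \<le> initial_of K (potential K)"
  proof (rule le_if_tails)
    fix T t
    have "int (class_count (initial_of K (potential K)) t) = int (class_count K t)" using class_count_initial_of[OF a, of t] flow_potential[OF assms, of t] by simp
    moreover have "count_below (initial_of K (potential K)) T t = count_below K T t"
      unfolding count_below_initial_of[OF a] flow_potential[OF assms] using count_below_le_class_count[of K T t] by simp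
    ultimately show "class_count K t + count_below (initial_of K (potential K)) T t \<le> class_count (initial_of K (potential K)) t + count_below K T t" by simp
  qed
  thus "initial_of K (potential K) = K" using potential_admissible(2)[OF digits_le_refl assms] by simp
qed

lemma count_below_mod: "count_below K T (t mod f) = count_below K T t"
  using periodic_mod[of "\<lambda>t. int (count_below K T t)" t] by (simp add: periodic_def count_below_periodic)

lemma digit_initial_of_full:
  assumes x: "periodic x" and s: "f dvd s + t + 1" "s < T" and t: "int (count_below K T t) \<le> flow x t"
  shows "digit (initial_of K x) s = digit K s"
proof -
  have class_of: "class_of s = t mod f" using s(1) dvd_iff_mod_class_of[of s t] by simp
  have flow: "flow x (class_of s) = flow x t" unfolding class_of by (rule periodic_mod[OF periodic_flow[OF x]])
  have "count_below K (Suc s) (class_of s) \<le> count_below K T (class_of s)" by (rule count_below_mono) (use s in simp)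
  also have "\<dots> = count_below K T t" unfolding class_of by (rule count_below_mod)
  finally have "count_below K (Suc s) (class_of s) \<le> nat (flow x (class_of s))" using t flow by simp
  thus ?thesis unfolding initial_of_def digit_initial_part using count_below_Suc_class_of[of K s] by simp
qed

text \<open>
  Let \<open>M\<close> be the greedy choice, \<open>B\<close> the competitor, and \<open>T\<close> the position from which on they agree. The minimality of \<open>M\<close> makes
  them linked at \<open>T\<close>, so the sum of the chain below \<open>B\<close> is smaller than that of the chain below \<open>M\<close> by at most \<open>gap_bound m T\<close>. It remains to see that
  \<open>B - M\<close> is larger than that. If some class is used at \<open>T\<close> or above, then \<open>M\<close> and \<open>B\<close> have the same digits in this class
  below \<open>T\<close>. So below the top position at which they differ \<open>M\<close> can gain on \<open>B\<close> only outside this class, and what it misses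
  exceeds the bound. Otherwise both numbers are less than
  \<open>p\<^sup>T\<close>, and the crude bound \<open>M / (q - 1)\<close> for the whole chain below \<open>M\<close> suffices, since the class of the top position
  already makes \<open>B\<close> exceed \<open>q M / (q - 1)\<close>.
\<close>

lemma greedy_least_initial:
  assumes K: "K mod (p ^ f - 1) = \<rho>" "feasible m K"
    and \<beta>: "admissible K \<beta>" "\<And>t. int m \<le> \<beta> t" and ne: "initial_of K \<beta> \<noteq> least_feasible m K"
  shows "least_feasible m K + chain_sum m (least_feasible m K) < initial_of K \<beta> + chain_sum m (initial_of K \<beta>)"
proof -
  define \<mu> where "\<mu> = potential (least_feasible m K)"
  define M where "M = initial_of K \<mu>"
  define B where "B = initial_of K \<beta>"
  have mK: "int m \<le> potential K t" for t using K(2) by (simp add: feasible_iff)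
  note \<mu> = least_feasible_initial[OF initial_of_potential(1)[OF K(1)] mK, unfolded initial_of_potential(2)[OF K(1)], folded \<mu>_def]
  have M: "M = least_feasible m K" using \<mu>(3) by (simp add: M_def)
  have p\<mu>: "periodic \<mu>" "\<And>t. 0 \<le> flow \<mu> t" and p\<beta>: "periodic \<beta>" "\<And>t. 0 \<le> flow \<beta> t"
    and u\<mu>: "\<And>t. flow \<mu> t \<le> int (class_count K t)" and u\<beta>: "\<And>t. flow \<beta> t \<le> int (class_count K t)" using \<mu>(1) \<beta>(1) by (auto simp: admissible_def)
  have minM: "M \<le> initial_of K x" if "periodic x" "\<And>t. int m \<le> x t" "\<And>t. 0 \<le> flow x t" "\<And>t. flow x t \<le> int (class_count K t)" for x
    unfolding M by (rule \<mu>(5)) (use that in \<open>auto simp: flow_potential[OF K(1)]\<close>)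
  have "M \<le> B" unfolding B_def by (rule minM) (use p\<beta> \<beta> u\<beta> in auto)
  hence MB: "M < B" using ne M by (simp add: B_def)
  \<comment> \<open>the position from which on \<open>M\<close> and \<open>B\<close> agree; \<open>E = T - 1\<close> is the top position at which they differ\<close>
  define T where "T = (LEAST T. M div p ^ T = B div p ^ T)"
  have "M div p ^ (M + B) = B div p ^ (M + B)" using less_pow[of M "M + B"] less_pow[of B "M + B"] by simp
  hence eqT: "M div p ^ T = B div p ^ T" unfolding T_def by (rule LeastI)
  have "T \<noteq> 0"
  proof
    assume "T = 0"
    thus False using eqT MB by simp
  qed
  then obtain E where E: "T = Suc E" using not0_implies_Suc by blast
  have "M div p ^ E \<noteq> B div p ^ E" using not_less_Least[of E "\<lambda>T. M div p ^ T = B div p ^ T"] E unfolding T_def by auto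
  moreover have "M div p ^ E \<le> B div p ^ E" using MB by (simp add: div_le_mono)
  ultimately have lessE: "M div p ^ E < B div p ^ E" by simp
  have divE: "k div p ^ E = p * (k div p ^ T) + digit k E" for k
    unfolding E by (simp add: digit_def power_Suc2 div_mult2_eq del: power_Suc)
  have digE: "digit M E < digit B E" using lessE unfolding divE eqT by simp
  have splitT: "k = (\<Sum>s<E. digit k s * p ^ s) + digit k E * p ^ E + p ^ T * (k div p ^ T)" for k
    using split_at[of k T] unfolding E by simp

  define V where "V t = max (flow \<mu> t) (flow \<beta> t)" for t
  have pV: "periodic V" using periodic_flow[OF p\<mu>(1)] periodic_flow[OF p\<beta>(1)] by (simp add: periodic_def V_def)
  have full: "flow \<mu> t = V t \<and> flow \<beta> t = V t" if t: "int (count_below K T t) < V t" for t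
  proof (cases "flow \<beta> t \<le> flow \<mu> t")
    case True
    have "flow \<beta> t = flow \<mu> t" by (rule flow_eq_if_div_eq[OF \<mu>(1) \<beta>(1) eqT[unfolded M_def B_def]]) (use t True in \<open>simp add: V_def\<close>)
    thus ?thesis by (simp add: V_def)
  next
    case False
    have "flow \<mu> t = flow \<beta> t" by (rule flow_eq_if_div_eq[OF \<beta>(1) \<mu>(1) eqT[unfolded M_def B_def, symmetric]]) (use t False in \<open>simp add: V_def\<close>)
    thus ?thesis by (simp add: V_def)
  qed
  have \<mu>Pot: "\<mu> \<in> Pot V (\<lambda>_. int m)" using p\<mu> \<mu>(4) by (simp add: Pot_def V_def)
  \<comment> \<open>A saving in a class used at \<open>T\<close> or above would give a number less than \<open>M\<close>.\<close>
  have crit: "flow y t = V t" if y: "y \<in> Pot V (\<lambda>_. int m)" and t: "int (count_below K T t) < V t" for y t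
  proof -
    have py: "periodic y" and yV: "\<And>t. flow y t \<le> V t" using y by (auto simp: Pot_def)
    from Pot_nonneg_flow[OF of_nat_0_le_iff y] obtain x where x: "periodic x" "\<And>t. int m \<le> x t" "\<And>t. 0 \<le> flow x t"
      "\<And>t. flow x t \<le> max 0 (flow y t)" by blast
    have xV: "flow x t \<le> V t" for t using x(4)[of t] yV[of t] p\<mu>(2)[of t] by (simp add: V_def)
    have xK: "flow x t \<le> int (class_count K t)" for t using xV[of t] u\<mu>[of t] u\<beta>[of t] by (simp add: V_def)
    have ax: "admissible K x" using x xK by (simp add: admissible_def)
    have 1: "M div p ^ T \<le> initial_of K x div p ^ T" by (rule div_le_mono, rule minM) (use x xK in auto)
    have "flow x t \<le> max (flow \<mu> t) (int (count_below K T t))" for t using xV[of t] full[of t] by linarith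
    hence 2: "initial_of K x div p ^ T \<le> M div p ^ T" unfolding M_def by (rule initial_of_div_le)
    have "flow x t = flow \<mu> t" by (rule flow_eq_if_div_eq[OF \<mu>(1) ax]) (use 1 2 t full in \<open>auto simp: M_def\<close>)
    thus ?thesis using full[OF t] x(4)[of t] yV[of t] t by linarith
  qed
  obtain \<nu> where \<nu>: "\<nu> \<in> Pot V (\<lambda>_. int m)" "\<And>x t. x \<in> Pot V (\<lambda>_. int m) \<Longrightarrow> \<nu> t \<le> x t"
    "\<And>t. int m < \<nu> (Suc t) \<Longrightarrow> flow \<nu> t = V t" using Pot_least[OF periodic_const pV \<mu>Pot] by blast
  have cV: "flow \<mu> t \<le> V t" "flow \<beta> t \<le> V t" for t by (simp_all add: V_def)
  have "linked (\<lambda>t. int (count_below K T t)) (int m) V \<nu> \<mu> \<beta>"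
    unfolding linked_def using pV p\<mu> p\<beta> \<mu>(4) \<beta>(2) \<nu> full crit cV by simp
  from chain_sum_diff[OF this \<mu>(1) \<beta>(1)] have Fd: "chain_sum m M \<le> chain_sum m B + gap_bound m T" by (simp add: M_def B_def)

  show ?thesis
  proof (cases "\<exists>t. int (count_below K T t) < V t")
    case True
    then obtain t where t: "int (count_below K T t) < V t" by blast
    have dK: "digit M s = digit K s \<and> digit B s = digit K s" if "f dvd s + t + 1" "s < T" for s
      unfolding M_def B_def using digit_initial_of_full[OF p\<mu>(1) that] digit_initial_of_full[OF p\<beta>(1) that] full[OF t] t by simp
    have ndE: "\<not> f dvd E + t + 1" using dK[of E] digE E by auto
    have "(\<Sum>s<E. digit M s * p ^ s) + (\<Sum>s<E. if f dvd s + t + 1 then p ^ s else 0)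
          \<le> (\<Sum>s<E. digit B s * p ^ s) + (\<Sum>s<E. (p - 1) * p ^ s)"
      unfolding sum.distrib[symmetric]
    proof (rule sum_mono)
      fix s assume "s \<in> {..<E}"
      hence s: "s < T" using E by simp
      show "digit M s * p ^ s + (if f dvd s + t + 1 then p ^ s else 0) \<le> digit B s * p ^ s + (p - 1) * p ^ s"
      proof (cases "f dvd s + t + 1")
        case True
        have "1 * p ^ s \<le> (p - 1) * p ^ s" using p2 by (intro mult_right_mono) auto
        thus ?thesis using dK[OF True s] True by simp
      next
        case False
        have "digit M s * p ^ s \<le> (p - 1) * p ^ s" using digit_less[of M s] by (intro mult_right_mono) auto
        hence "digit M s * p ^ s + 0 \<le> digit B s * p ^ s + (p - 1) * p ^ s" by linarith
        thus ?thesis using False by (simp only: if_False)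
      qed
    qed
    hence "(\<Sum>s<E. digit M s * p ^ s) + gap_bound m T < (\<Sum>s<E. digit B s * p ^ s) + p ^ E"
      using gap_bound_le[OF ndE, of m] sum_full_digits[of E] unfolding E by linarith
    moreover have "Suc (digit M E) * p ^ E \<le> digit B E * p ^ E" using digE by (intro mult_right_mono) auto
    ultimately have "M + gap_bound m T < B"
      using splitT[of M] splitT[of B] unfolding eqT mult_Suc by linarith
    thus ?thesis using Fd unfolding M[symmetric] B_def[symmetric] by simp
  next
    case False
    hence low: "flow \<mu> t \<le> int (count_below K T t)" "flow \<beta> t \<le> int (count_below K T t)" for t by (auto simp: V_def not_less)
    have "initial_of K x div p ^ T \<le> 0 div p ^ T" if "\<And>t. flow x t \<le> int (count_below K T t)" for x
    proof (rule div_le_if_digits_le)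
      fix s assume "T \<le> s"
      hence "count_below K T (class_of s) \<le> count_below K s (class_of s)" by (rule count_below_mono)
      hence "nat (flow x (class_of s)) \<le> count_below K s (class_of s)" using that[of "class_of s"] by simp
      thus "digit (initial_of K x) s \<le> digit 0 s" unfolding initial_of_def digit_initial_part using count_below_Suc_class_of[of K s] by simp
    qed
    hence div0: "M div p ^ T = 0" "B div p ^ T = 0" using low by (simp_all add: M_def B_def)
    \<comment> \<open>\<open>B\<close> has a unit at \<open>E\<close>, so it uses all units of this class below \<open>E\<close>, and \<open>M\<close> uses at most these\<close>
    define u where "u = class_of E"
    have u: "f dvd E + u + 1" unfolding u_def by (rule class_of_dvd)
    have cu: "int (count_below K E u) \<le> flow \<beta> u"
    proof (rule ccontr)
      assume "\<not> ?thesis"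
      hence "nat (flow \<beta> u) \<le> count_below K E u" by simp
      hence "digit B E = 0" unfolding B_def initial_of_def digit_initial_part u_def[symmetric] using count_below_mono[of E "Suc E" K u] by simp
      thus False using digE by simp
    qed
    have dK: "digit M s \<le> digit B s" if "f dvd s + u + 1" "s < E" for s
      using digit_initial_of_full[OF p\<beta>(1) that cu] initial_of_digits_le[OF \<mu>(1)] unfolding M_def B_def digits_le_def by simp
    define P where "P = p ^ E"
    define Q where "Q = p ^ f - 1"
    \<comment> \<open>\<open>M\<close> below \<open>E\<close> splits into the part \<open>a\<close> in class \<open>u\<close>, which is at most \<open>Y\<close>, and the rest \<open>z\<close>\<close>
    define Y where "Y = (\<Sum>s<E. if f dvd s + u + 1 then (p - 1) * p ^ s else 0)"
    define D where "D = digit M E"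
    define a where "a = (\<Sum>s<E. if f dvd s + u + 1 then digit M s * p ^ s else 0)"
    define z where "z = (\<Sum>s<E. if f dvd s + u + 1 then 0 else digit M s * p ^ s)"
    have sumM: "(\<Sum>s<E. digit M s * p ^ s) = a + z"
      unfolding a_def z_def sum.distrib[symmetric] by (intro sum.cong) auto
    have sumB: "a \<le> (\<Sum>s<E. digit B s * p ^ s)"
      unfolding a_def by (intro sum_mono) (auto simp: dK)
    have aY: "a \<le> Y" unfolding a_def Y_def
    proof (rule sum_mono)
      fix s show "(if f dvd s + u + 1 then digit M s * p ^ s else 0) \<le> (if f dvd s + u + 1 then (p - 1) * p ^ s else 0)"
        using digit_less[of M s] by auto
    qed
    have "z + Y \<le> (\<Sum>s<E. (p - 1) * p ^ s)" unfolding z_def Y_def sum.distrib[symmetric]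
    proof (rule sum_mono)
      fix s show "(if f dvd s + u + 1 then 0 else digit M s * p ^ s) + (if f dvd s + u + 1 then (p - 1) * p ^ s else 0) \<le> (p - 1) * p ^ s"
        using digit_less[of M s] by auto
    qed
    hence zY: "z + Y + 1 \<le> P" using sum_full_digits[of E] unfolding P_def by linarith
    have cs: "(p - 1) * P < Q + 1 + Q * Y"
      using class_sum_bound[OF u] q_ge_2 unfolding Y_def[symmetric] P_def[symmetric] Q_def by simp
    have "digit M E + 2 \<le> p" using digE digit_less[of B E] by simp
    hence "p - 1 = D + 1 + (p - 2 - D)" unfolding D_def by linarith
    then obtain w where w: "p - 1 = D + 1 + w" by blast
    have "(Q + 1) * (z + Y + 1) \<le> (Q + 1) * P" using zY by (rule mult_le_mono2)
    moreover have "(p - 1) * P = D * P + P + w * P" by (simp only: w add_mult_distrib mult_1)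
    ultimately have key: "a + (Q + 1) * z + D * P < Q * P" using cs aY
      unfolding add_mult_distrib add_mult_distrib2 mult_1 mult_1_right by linarith
    have MM: "M = a + z + D * P" using splitT[of M] unfolding div0 sumM P_def D_def mult_0_right add_0_right .
    have "Suc D * P \<le> digit B E * P" using digE unfolding D_def by (intro mult_right_mono) auto
    hence BB: "a + Suc D * P \<le> B" using splitT[of B] sumB unfolding div0 P_def mult_0_right by linarith
    have "(Q + 1) * (a + z + D * P) < Q * (a + Suc D * P)"
      using key unfolding mult_Suc add_mult_distrib add_mult_distrib2 mult_1 by linarith
    hence "(Q + 1) * M < Q * (a + Suc D * P)" by (simp only: MM[symmetric])
    also have "\<dots> \<le> Q * B" using BB by (rule mult_le_mono2)
    finally have "(Q + 1) * M < Q * B" .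
    moreover have "Q * chain_sum m M \<le> M" unfolding Q_def M_def by (rule chain_sum_le[OF \<mu>(1,4)])
    ultimately have "Q * (M + chain_sum m M) < Q * B" by (simp add: algebra_simps)
    hence "M + chain_sum m M < B" by simp
    thus ?thesis unfolding M[symmetric] B_def[symmetric] by simp
  qed
qed

text \<open>
  \<open>X\<close> and \<open>Y\<close> have the same units per class, but those of \<open>X\<close> sit lower. The units that the greedy choice takes from \<open>Y\<close> can be
  taken from the bottom of \<open>X\<close> instead, and they are not higher there.
\<close>

lemma chain_sum_dominated:
  assumes "X mod (p ^ f - 1) = \<rho>" "Y mod (p ^ f - 1) = \<rho>" "feasible m Y"
    "\<And>t. class_count X t = class_count Y t" "\<And>T t. count_below Y T t \<le> count_below X T t"
  shows "chain_sum m X \<le> chain_sum m Y"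
  using assms
proof (induction m arbitrary: X Y)
  case (Suc m)
  note prems = Suc.prems
  have fY: "feasible m Y" using prems(3) by (rule feasible_mono) simp
  define J where "J = least_feasible m Y"
  note J = least_feasible[OF fY, folded J_def]
  have Jm: "J mod (p ^ f - 1) = \<rho>" using J(2) prems(2) by simp
  have vXY: "potential X = potential Y"
    by (rule potential_unique(2)) (auto simp: periodic_potential flow_potential[OF prems(2)] prems(4))
  have fX: "feasible m X" using fY by (simp add: feasible_iff vXY)
  have aJ: "admissible X (potential J)" using digits_le_class_count[OF J(1)] by (simp add: admissible_def periodic_potential flow_potential[OF Jm] prems(4))
  define x where "x = initial_of X (potential J)"
  have cx: "class_count x t = class_count J t" for t using class_count_initial_of[OF aJ, of t] flow_potential[OF Jm, of t] by (simp add: x_def)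
  have Ax: "count_below J T t \<le> count_below x T t" for T t
    unfolding x_def count_below_initial_of[OF aJ] flow_potential[OF Jm]
    using count_below_le_class_count[of J T t] digits_le_count_below[OF J(1), of T t] prems(5)[of T t] by simp
  have "x \<le> J" by (rule le_if_tails) (simp add: cx Ax)
  moreover have "chain_sum m x \<le> chain_sum m J"
    by (rule Suc.IH) (use Jm J(3) cx Ax initial_of_mod[OF aJ] in \<open>auto simp: x_def\<close>)
  moreover have "least_feasible m X + chain_sum m (least_feasible m X) \<le> x + chain_sum m x"
  proof (cases "x = least_feasible m X")
    case False
    have "least_feasible m X + chain_sum m (least_feasible m X) < initial_of X (potential J) + chain_sum m (initial_of X (potential J))"
      by (rule greedy_least_initial[OF prems(1) fX aJ]) (use J(3) False in \<open>auto simp: feasible_iff x_def\<close>)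
    thus ?thesis unfolding x_def by simp
  qed simp
  ultimately show ?case by (simp add: J_def)
qed simp

text \<open>
  A competitor that is not initial is no better than the initial number with the same potential: neither that number nor,
  by \<open>chain_sum_dominated\<close>, the sum of the chain below it is larger.
\<close>

lemma greedy_least_residue:
  assumes K: "K mod (p ^ f - 1) = \<rho>" "feasible m K"
    and B: "digits_le B K" "B mod (p ^ f - 1) = \<rho>" "feasible m B" "B \<noteq> least_feasible m K"
  shows "least_feasible m K + chain_sum m (least_feasible m K) < B + chain_sum m B"
proof -
  note a = potential_admissible[OF B(1,2)]
  have FB: "chain_sum m (initial_of K (potential B)) \<le> chain_sum m B"
  proof (rule chain_sum_dominated[OF initial_of_mod[OF a(1)] B(2,3)])
    show "class_count (initial_of K (potential B)) t = class_count B t" for t using class_count_initial_of[OF a(1), of t] flow_potential[OF B(2), of t] by simp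
    show "count_below B T t \<le> count_below (initial_of K (potential B)) T t" for T t
      unfolding count_below_initial_of[OF a(1)] flow_potential[OF B(2)] using count_below_le_class_count[of B T t] digits_le_count_below[OF B(1), of T t] by simp
  qed
  show ?thesis
  proof (cases "initial_of K (potential B) = least_feasible m K")
    case True
    thus ?thesis using a(2) B(4) FB by simp
  next
    case False
    have "least_feasible m K + chain_sum m (least_feasible m K) < initial_of K (potential B) + chain_sum m (initial_of K (potential B))"
      by (rule greedy_least_initial[OF K a(1) _ False]) (use B(3) in \<open>simp add: feasible_iff\<close>)
    thus ?thesis using a(2) FB by linarith
  qed
qed

text \<open>
  A proper loss of units within the same residue class lowers the potential everywhere, by \<open>less_if_flow_le\<close>.
\<close>

lemma feasible_Suc_if_proper:
  assumes j: "digits_le j X" "j \<noteq> X" "j mod (p ^ f - 1) = \<rho>" "X mod (p ^ f - 1) = \<rho>" "feasible m j"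
  shows "feasible (Suc m) X"
proof -
  have "potential j \<noteq> potential X"
  proof
    assume "potential j = potential X"
    hence class_count: "class_count j t = class_count X t" for t using flow_potential[OF j(3), of t] flow_potential[OF j(4), of t] by simp
    have "X \<le> j" by (rule le_if_tails) (simp add: class_count digits_le_count_below[OF j(1)])
    thus False using digits_le_imp_le[OF j(1)] j(2) by simp
  qed
  from less_if_flow_le[OF periodic_potential periodic_potential _ this]
  have "potential j t \<le> potential X t - 1" for t
    using digits_le_class_count[OF j(1)] by (simp add: flow_potential[OF j(3)] flow_potential[OF j(4)])
  thus ?thesis using j(5) unfolding feasible_iff by (smt (verit) of_nat_Suc)
qed

lemma least_feasible_proper:
  assumes "X mod (p ^ f - 1) = \<rho>" "feasible (Suc m) X"
  shows "least_feasible m X \<noteq> X"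
proof
  assume e: "least_feasible m X = X"
  have "int (Suc m) \<le> potential X t" for t using assms(2) by (simp add: feasible_iff)
  from least_feasible_drop(1)[OF initial_of_potential(1)[OF assms(1)] this, of 0]
  show False by (simp add: initial_of_potential(2)[OF assms(1)] e)
qed

end

context digits
begin

lemma residue_mod: "residue p f (K mod (p ^ f - 1))"
  by unfold_locales (use p2 f1 q_minus_1_pos in auto)

text \<open>
  The right-hand side will be the lowest exponent in \<open>t\<^sup>B monic_sum m B\<close>, so the strictness is what prevents cancellation of
  the lowest term.
\<close>

theorem greedy_least:
  assumes "feasible m K" "digits_le B K" "B mod (p ^ f - 1) = K mod (p ^ f - 1)" "feasible m B" "B \<noteq> least_feasible m K"
  shows "least_feasible m K + chain_sum m (least_feasible m K) < B + chain_sum m B"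
  using residue.greedy_least_residue[OF residue_mod refl assms(1,2,3,4,5)] .

lemma feasible_Suc_iff:
  "feasible (Suc m) X \<longleftrightarrow> (\<exists>j. digits_le j X \<and> j \<noteq> X \<and> j mod (p ^ f - 1) = X mod (p ^ f - 1) \<and> feasible m j)"
proof
  assume a: "feasible (Suc m) X"
  have "feasible m X" using a by (rule feasible_mono) simp
  thus "\<exists>j. digits_le j X \<and> j \<noteq> X \<and> j mod (p ^ f - 1) = X mod (p ^ f - 1) \<and> feasible m j"
    using least_feasible[of m X] residue.least_feasible_proper[OF residue_mod refl a] by blast
qed (use residue.feasible_Suc_if_proper[OF residue_mod _ _ _ refl] in blast)

text \<open>
  The sum of the greedy chain of length \<open>m + 1\<close> below \<open>k\<close> whose first member may be \<open>k\<close> itself; it will be the lowest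
  exponent of \<open>unit_sum (m + 1) k\<close>.
\<close>

definition lowest_exp :: "nat \<Rightarrow> nat \<Rightarrow> nat" where "lowest_exp m k = least_feasible m k + chain_sum m (least_feasible m k)"

text \<open>
  Dropping the first member of the longer chain leaves a chain that competes with the shorter greedy chain.
\<close>

lemma lowest_exp_less_Suc:
  assumes "feasible (Suc m) k" shows "lowest_exp m k < lowest_exp (Suc m) k"
proof -
  define M where "M = least_feasible (Suc m) k"
  note M = least_feasible[OF assms, folded M_def]
  have fM: "feasible m M" using M(3) by (rule feasible_mono) simp
  note N = least_feasible[OF fM]
  have fk: "feasible m k" using assms by (rule feasible_mono) simp
  have "lowest_exp m k \<le> least_feasible m M + chain_sum m (least_feasible m M)"
  proof (cases "least_feasible m M = least_feasible m k")
    case False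
    have "least_feasible m k + chain_sum m (least_feasible m k) < least_feasible m M + chain_sum m (least_feasible m M)"
      by (rule greedy_least[OF fk digits_le_trans[OF N(1) M(1)]]) (use M N False in auto)
    thus ?thesis unfolding lowest_exp_def by simp
  qed (simp add: lowest_exp_def)
  also have "\<dots> = chain_sum (Suc m) M" by simp
  also have "\<dots> < M + chain_sum (Suc m) M"
  proof -
    have "M \<noteq> 0"
    proof
      assume "M = 0"
      thus False using M(3) q_minus_1_pos by (auto simp: feasible_def)
    qed
    thus ?thesis by simp
  qed
  finally show ?thesis by (simp add: lowest_exp_def M_def)
qed

lemma lowest_exp_less: "i < j \<Longrightarrow> feasible j k \<Longrightarrow> lowest_exp i k < lowest_exp j k"
proof (induction j)
  case (Suc j)
  have "feasible j k" using Suc.prems(2) by (rule feasible_mono) simp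
  thus ?case using Suc lowest_exp_less_Suc[of j k] by (cases "i = j") auto
qed simp

end

section \<open>Power sums of monic polynomials\<close>

lemma coeff_one_plus_X_power: "coeff ([:1, 1:] ^ k) j = (of_nat (k choose j) :: 'a::comm_semiring_1)"
  by (cases "j \<le> k") (simp_all add: coeff_linear_poly_power coeff_eq_0 degree_linear_power binomial_eq_0)

lemma smult_sum_right: "smult c (\<Sum>i\<in>S. g i) = (\<Sum>i\<in>S. smult c (g i))"
  by (induction S rule: infinite_finite_induct) (simp_all add: smult_add_right)

locale finite_field_card = digits p f for p f +
  fixes ty :: "'a::{field,finite} itself"
  assumes prime_p: "prime p" and card_q: "CARD('a) = p ^ f"
begin

lemma of_nat_p_poly: "of_nat p = (0 :: 'a poly)"
proof -
  have "of_nat p ^ f = (0 :: 'a poly)" using of_nat_CARD_eq_0[where 'a = 'a] unfolding card_q by simp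
  thus ?thesis by simp
qed

lemma of_nat_p: "of_nat p = (0 :: 'a)"
  using of_nat_p_poly by (simp add: of_nat_poly)

lemma of_nat_eq_0_iff: "of_nat n = (0 :: 'a) \<longleftrightarrow> p dvd n"
proof -
  have "CHAR('a) dvd p" using of_nat_p by (simp only: of_nat_eq_0_iff_char_dvd)
  hence "CHAR('a) = p" using prime_p CHAR_not_1[where 'a = 'a] by (auto simp: prime_nat_iff)
  thus ?thesis by (simp only: of_nat_eq_0_iff_char_dvd)
qed

lemma one_plus_X_power_p: "[:1, 1:] ^ p = (1 + monom 1 p :: 'a poly)"
proof (rule poly_eqI)
  fix n
  show "coeff ([:1, 1:] ^ p) n = coeff (1 + monom 1 p :: 'a poly) n"
  proof (cases "n = 0 \<or> n \<ge> p")
    case True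
    thus ?thesis using p2 by (auto simp: coeff_one_plus_X_power binomial_eq_0 le_less)
  next
    case False
    hence "p dvd (p choose n)" by (intro dvd_choose_prime prime_p) auto
    thus ?thesis using False by (simp add: coeff_one_plus_X_power of_nat_eq_0_iff)
  qed
qed

text \<open>
  Compare coefficients in \<open>(1 + X)\<^sup>k = (1 + X\<^sup>p)\<^bsup>k div p\<^esup> (1 + X)\<^bsup>k mod p\<^esup>\<close>.
\<close>

lemma binomial_Lucas:
  "(of_nat (k choose j) :: 'a) = of_nat ((k div p) choose (j div p)) * of_nat ((k mod p) choose (j mod p))"
proof -
  have "[:1, 1:] ^ k = ([:1, 1:] ^ p) ^ (k div p) * ([:1, 1:] ^ (k mod p) :: 'a poly)"
    by (simp flip: power_mult power_add)
  also have "([:1, 1:] ^ p) ^ (k div p) = (\<Sum>i\<le>k div p. monom (of_nat ((k div p) choose i)) (p * i) :: 'a poly)"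
    unfolding one_plus_X_power_p
    by (subst add.commute, subst binomial_ring)
       (simp add: monom_power of_nat_poly smult_monom mult.commute)
  finally have "coeff ([:1, 1:] ^ k :: 'a poly) j =
     (\<Sum>i\<le>k div p. if j < p * i then 0 else of_nat ((k div p) choose i) * of_nat ((k mod p) choose (j - p * i)))"
    by (simp add: sum_distrib_right coeff_sum coeff_monom_mult coeff_one_plus_X_power cong: if_cong)
  also have "\<dots> = (\<Sum>i\<le>k div p. if i = j div p then of_nat ((k div p) choose i) * of_nat ((k mod p) choose (j mod p)) else 0)"
  proof (intro sum.cong refl)
    fix i
    show "(if j < p * i then 0 else of_nat ((k div p) choose i) * of_nat ((k mod p) choose (j - p * i))) =
      (if i = j div p then of_nat ((k div p) choose i) * of_nat ((k mod p) choose (j mod p)) else (0 :: 'a))"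
    proof (cases "i = j div p")
      case True
      moreover have "\<not> j < p * (j div p)" by (simp add: not_less)
      ultimately show ?thesis by (simp add: minus_mult_div_eq_mod)
    next
      case False
      have "j - p * i \<ge> p" if "p * i \<le> j"
      proof -
        have "i \<le> j div p" using that p2 by (simp add: less_eq_div_iff_mult_less_eq mult.commute)
        hence "Suc i \<le> j div p" using False by simp
        hence "p * Suc i \<le> j" using p2 by (simp add: less_eq_div_iff_mult_less_eq mult.commute)
        thus ?thesis by simp
      qed
      moreover have "k mod p < p" using p2 by simp
      ultimately show ?thesis using False by (auto simp: binomial_eq_0)
    qed
  qed
  also have "\<dots> = of_nat ((k div p) choose (j div p)) * of_nat ((k mod p) choose (j mod p))"
    by (simp add: binomial_eq_0)
  finally show ?thesis by (simp add: coeff_one_plus_X_power)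
qed

lemma digits_le_div_mod: "digits_le j k \<longleftrightarrow> j mod p \<le> k mod p \<and> digits_le (j div p) (k div p)"
proof -
  have "digit k (Suc s) = digit (k div p) s" for k s by (simp add: digit_def div_mult2_eq)
  moreover have "digit k 0 = k mod p" for k by (simp add: digit_def)
  ultimately show ?thesis unfolding digits_le_def by (metis not0_implies_Suc)
qed

lemma binomial_nonzero_iff: "(of_nat (k choose j) :: 'a) \<noteq> 0 \<longleftrightarrow> digits_le j k"
proof (induction k arbitrary: j rule: less_induct)
  case (less k)
  have small: "of_nat (r choose s) \<noteq> (0 :: 'a) \<longleftrightarrow> s \<le> r" if "r < p" for r s
  proof (cases "s \<le> r")
    case True
    have "\<not> p dvd (r choose s)"
    proof
      assume "p dvd (r choose s)"
      hence "p dvd fact r" using binomial_fact_lemma[OF True] by (metis dvd_mult)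
      thus False using that prime_p by (simp add: prime_dvd_fact_iff)
    qed
    thus ?thesis using True by (simp add: of_nat_eq_0_iff)
  qed (simp add: binomial_eq_0)
  have sm: "of_nat ((k mod p) choose (j mod p)) \<noteq> (0 :: 'a) \<longleftrightarrow> j mod p \<le> k mod p" using small p2 by simp
  show ?case
  proof (cases "k = 0")
    case True
    have "digits_le j 0 \<longleftrightarrow> j = 0" using digits_le_imp_le[of j 0] by auto
    thus ?thesis using True by (cases j) auto
  next
    case False
    hence "k div p < k" using p2 by simp
    from less.IH[OF this, of "j div p"] show ?thesis
      by (subst binomial_Lucas, subst digits_le_div_mod) (simp add: sm conj_commute)
  qed
qed

lemma power_card_minus_1: "x ^ (p ^ f - 1) = (1 :: 'a)" if x: "x \<noteq> 0"
proof -
  have "(\<Prod>y\<in>UNIV - {0}. x * y) = (\<Prod>y\<in>UNIV - {0}. y :: 'a)"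
    by (rule prod.reindex_bij_witness[of _ "\<lambda>y. y / x" "\<lambda>y. x * y"]) (use x in auto)
  hence "x ^ card (UNIV - {0 :: 'a}) * (\<Prod>y\<in>UNIV - {0}. y) = (\<Prod>y\<in>UNIV - {0}. y :: 'a)"
    by (simp add: prod.distrib)
  moreover have "(\<Prod>y\<in>UNIV - {0}. y :: 'a) \<noteq> 0" by simp
  moreover have "card (UNIV - {0 :: 'a}) = p ^ f - 1" by (simp add: card_q)
  ultimately show ?thesis by simp
qed

text \<open>
  If \<open>q - 1\<close> does not divide \<open>i\<close>, some \<open>y\<close> has \<open>y\<^sup>i \<noteq> 1\<close>, as a polynomial of degree less than \<open>q - 1\<close> does not vanish on all units;
  multiplication by \<open>y\<close> permutes the units and so multiplies the sum by \<open>y\<^sup>i\<close>.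
\<close>

lemma power_sum_units:
  "(\<Sum>x\<in>UNIV - {0}. x ^ i) = (if (p ^ f - 1) dvd i then -1 else (0 :: 'a))"
proof (cases "(p ^ f - 1) dvd i")
  case True
  then obtain n where i: "i = (p ^ f - 1) * n" by blast
  have "(\<Sum>x\<in>UNIV - {0}. x ^ i) = (\<Sum>x\<in>UNIV - {0 :: 'a}. 1 :: 'a)"
    by (intro sum.cong refl) (simp add: i power_mult power_card_minus_1 del: One_nat_def)
  also have "\<dots> = of_nat (p ^ f - 1)" by (simp add: card_q)
  also have "\<dots> = of_nat (p ^ f) - 1" using q_ge_2 by (simp add: of_nat_diff)
  also have "\<dots> = -1" using f1 by (simp add: of_nat_p)
  finally show ?thesis using True by simp
next
  case False
  define n where "n = i mod (p ^ f - 1)"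
  have n: "n > 0" "n < p ^ f - 1" using False q_minus_1_pos by (auto simp: n_def dvd_eq_mod_eq_0)
  have pn: "x ^ i = x ^ n" if "x \<noteq> 0" for x :: 'a
  proof -
    have "x ^ i = (x ^ (p ^ f - 1)) ^ (i div (p ^ f - 1)) * x ^ n"
      unfolding n_def by (simp flip: power_mult power_add)
    thus ?thesis using power_card_minus_1[OF that] by simp
  qed
  have "\<exists>y :: 'a. y \<noteq> 0 \<and> y ^ n \<noteq> 1"
  proof (rule ccontr)
    assume "\<not> ?thesis"
    hence "UNIV - {0 :: 'a} \<subseteq> {x. poly (monom 1 n - 1) x = 0}" by (auto simp: poly_monom)
    hence "card (UNIV - {0 :: 'a}) \<le> card {x :: 'a. poly (monom 1 n - 1) x = 0}" by (intro card_mono) auto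
    also have "\<dots> \<le> degree (monom 1 n - 1 :: 'a poly)"
    proof (rule card_poly_roots_bound)
      have "coeff (monom 1 n - 1 :: 'a poly) n = 1" using n by (simp add: coeff_1)
      thus "monom 1 n - 1 \<noteq> (0 :: 'a poly)" by (metis coeff_0 zero_neq_one)
    qed
    also have "\<dots> \<le> n" by (rule degree_diff_le) (simp_all add: degree_monom_le)
    finally show False using n by (simp add: card_q)
  qed
  then obtain y :: 'a where y: "y \<noteq> 0" "y ^ n \<noteq> 1" by blast
  define S where "S = (\<Sum>x\<in>UNIV - {0}. x ^ i :: 'a)"
  have "S = (\<Sum>x\<in>UNIV - {0}. (y * x) ^ i)"
    unfolding S_def by (rule sum.reindex_bij_witness[of _ "\<lambda>x. y * x" "\<lambda>x. x / y"]) (use y in auto)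
  also have "\<dots> = y ^ n * S" unfolding S_def using pn[OF y(1)] by (simp add: power_mult_distrib sum_distrib_left)
  finally have "(1 - y ^ n) * S = 0" by (simp add: algebra_simps)
  hence "S = 0" using y by simp
  thus ?thesis using False by (simp add: S_def)
qed

lemma power_sum_UNIV:
  "(\<Sum>x\<in>UNIV. x ^ i) = (if i \<noteq> 0 \<and> (p ^ f - 1) dvd i then -1 else (0 :: 'a))"
proof -
  have zero: "of_nat CARD('a) = (0 :: 'a)" using f1 by (simp add: card_q of_nat_p)
  have "(\<Sum>x\<in>UNIV. x ^ i :: 'a) = 0 ^ i + (\<Sum>x\<in>UNIV - {0}. x ^ i)" by (subst sum.remove[of _ 0]) auto
  thus ?thesis using zero by (cases "i = 0") (auto simp: power_sum_units power_0_left)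
qed

definition monic :: "nat \<Rightarrow> 'a poly set" where "monic d = {a. lead_coeff a = 1 \<and> degree a = d}"

definition monic_sum :: "nat \<Rightarrow> nat \<Rightarrow> 'a poly" where "monic_sum d k = (\<Sum>a\<in>monic d. a ^ k)"

definition unit_sum :: "nat \<Rightarrow> nat \<Rightarrow> 'a poly" where "unit_sum d k = (\<Sum>a\<in>{a\<in>monic d. coeff a 0 \<noteq> 0}. a ^ k)"

lemma finite_monic [simp]: "finite (monic d)"
  unfolding monic_def by (rule finite_subset[OF _ finite_coeffs_below[of "Suc d"]]) (auto simp: coeff_eq_0)

lemma monic_0: "monic 0 = {1}"
proof -
  have "a = 1" if "lead_coeff a = 1" "degree a = 0" for a :: "'a poly"
    using that by (metis degree_eq_zeroE lead_coeff_pCons(2) one_pCons)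
  thus ?thesis by (auto simp: monic_def)
qed

lemma monic_sum_0 [simp]: "monic_sum 0 k = 1" and unit_sum_0 [simp]: "unit_sum 0 k = 1"
proof -
  show "monic_sum 0 k = 1" by (simp add: monic_sum_def monic_0)
  have "{a \<in> monic 0. coeff a 0 \<noteq> 0} = {1 :: 'a poly}" by (auto simp: monic_0)
  thus "unit_sum 0 k = 1" by (simp add: unit_sum_def)
qed

lemma sum_monic_Suc:
  "(\<Sum>a\<in>{a\<in>monic (Suc d). coeff a 0 \<in> X}. g a) = (\<Sum>x\<in>X. \<Sum>b\<in>monic d. g (pCons x b))"
proof -
  have "(\<Sum>a\<in>{a\<in>monic (Suc d). coeff a 0 \<in> X}. g a) = (\<Sum>(x, b)\<in>X \<times> monic d. g (pCons x b))"
  proof (rule sum.reindex_bij_witness[of _ "\<lambda>(x, b). pCons x b" "\<lambda>a. (coeff a 0, poly_shift 1 a)"], goal_cases)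
    case (1 a)
    show ?case by (auto simp: poly_eq_iff coeff_pCons coeff_poly_shift split: nat.splits)
  next
    case (2 a)
    then show ?case
    proof (cases a)
      case (pCons x b)
      have "poly_shift 1 a = b" unfolding pCons by (auto simp: poly_eq_iff coeff_poly_shift)
      thus ?thesis using 2 pCons by (auto simp: monic_def split: if_splits)
    qed
  next
    case (3 z)
    obtain x b where z: "z = (x, b)" by (cases z)
    have "poly_shift 1 (pCons x b) = b" by (auto simp: poly_eq_iff coeff_poly_shift)
    thus ?case using z by simp
  next
    case (4 z)
    thus ?case by (auto simp: monic_def)
  next
    case (5 a)
    show ?case
    proof (cases a)
      case (pCons x b)
      have "poly_shift 1 a = b" unfolding pCons by (auto simp: poly_eq_iff coeff_poly_shift)
      thus ?thesis using pCons by simp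
    qed
  qed
  thus ?thesis by (simp add: sum.cartesian_product)
qed

lemma sum_power_pCons:
  fixes X :: "'a set"
  shows "(\<Sum>x\<in>X. \<Sum>b\<in>monic d. pCons x b ^ k) =
     (\<Sum>j\<le>k. smult (of_nat (k choose j) * (\<Sum>x\<in>X. x ^ (k - j))) (monom 1 j * monic_sum d j))"
proof -
  have pw: "pCons x b ^ k = (\<Sum>j\<le>k. smult (of_nat (k choose j) * x ^ (k - j)) (monom 1 j * b ^ j))" for x and b :: "'a poly"
  proof -
    have "pCons x b = monom 1 1 * b + [:x:]" by (simp add: monom_Suc monom_0)
    hence "pCons x b ^ k = (\<Sum>j\<le>k. of_nat (k choose j) * (monom 1 1 * b) ^ j * [:x:] ^ (k - j))"
      by (simp only: binomial_ring)
    also have "\<dots> = (\<Sum>j\<le>k. smult (of_nat (k choose j) * x ^ (k - j)) (monom 1 j * b ^ j))"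
      by (intro sum.cong refl) (simp add: power_mult_distrib monom_power poly_const_pow of_nat_poly mult_ac)
    finally show ?thesis .
  qed
  have "(\<Sum>x\<in>X. \<Sum>b\<in>monic d. pCons x b ^ k) =
     (\<Sum>x\<in>X. \<Sum>j\<le>k. smult (of_nat (k choose j) * x ^ (k - j)) (monom 1 j * monic_sum d j))"
    unfolding pw by (subst sum.swap) (simp add: monic_sum_def smult_sum_right sum_distrib_left)
  also have "\<dots> = (\<Sum>j\<le>k. smult (of_nat (k choose j) * (\<Sum>x\<in>X. x ^ (k - j))) (monom 1 j * monic_sum d j))"
    by (subst sum.swap) (simp add: smult_sum sum_distrib_left)
  finally show ?thesis .
qed

text \<open>
  The exponents whose terms remain in the binomial expansion of a power sum.
\<close>

definition surviving :: "nat \<Rightarrow> nat set" where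
  "surviving k = {j. digits_le j k \<and> j mod (p ^ f - 1) = k mod (p ^ f - 1)}"

lemma surviving_le: "j \<in> surviving k \<Longrightarrow> j \<le> k" unfolding surviving_def using digits_le_imp_le by blast

lemma finite_surviving [simp]: "finite (surviving k)"
  by (rule finite_subset[of _ "{..k}"]) (auto dest: surviving_le)

lemma dvd_diff_iff: "j \<le> k \<Longrightarrow> (p ^ f - 1) dvd (k - j) \<longleftrightarrow> j mod (p ^ f - 1) = k mod (p ^ f - 1)"
  by (metis mod_eq_dvd_iff_nat)

lemma unit_sum_Suc: "unit_sum (Suc d) k = - (\<Sum>j\<in>surviving k. smult (of_nat (k choose j)) (monom 1 j * monic_sum d j))"
proof -
  have "unit_sum (Suc d) k = (\<Sum>a\<in>{a\<in>monic (Suc d). coeff a 0 \<in> UNIV - {0}}. a ^ k)" by (simp add: unit_sum_def)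
  also have "\<dots> = (\<Sum>j\<le>k. smult (of_nat (k choose j) * (\<Sum>x\<in>UNIV - {0}. x ^ (k - j))) (monom 1 j * monic_sum d j))"
    unfolding sum_monic_Suc sum_power_pCons ..
  also have "\<dots> = (\<Sum>j\<in>surviving k. smult (of_nat (k choose j) * (\<Sum>x\<in>UNIV - {0}. x ^ (k - j))) (monom 1 j * monic_sum d j))"
  proof (rule sum.mono_neutral_right)
    show "\<forall>j\<in>{..k} - (surviving k). smult (of_nat (k choose j) * (\<Sum>x\<in>UNIV - {0}. x ^ (k - j))) (monom 1 j * monic_sum d j) = 0"
    proof
      fix j assume j: "j \<in> {..k} - (surviving k)"
      show "smult (of_nat (k choose j) * (\<Sum>x\<in>UNIV - {0}. x ^ (k - j))) (monom 1 j * monic_sum d j) = 0"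
      proof (cases "digits_le j k")
        case True
        thus ?thesis using j by (auto simp: surviving_def power_sum_units dvd_diff_iff simp del: One_nat_def)
      next
        case False
        thus ?thesis using binomial_nonzero_iff[of k j] by simp
      qed
    qed
  qed (auto dest: surviving_le)
  also have "\<dots> = (\<Sum>j\<in>surviving k. - smult (of_nat (k choose j)) (monom 1 j * monic_sum d j))"
    by (intro sum.cong refl) (auto simp: surviving_def power_sum_units dvd_diff_iff simp del: One_nat_def dest: digits_le_imp_le)
  finally show ?thesis by (simp add: sum_negf)
qed

lemma monic_sum_Suc: "monic_sum (Suc d) k = - (\<Sum>j\<in>surviving k - {k}. smult (of_nat (k choose j)) (monom 1 j * monic_sum d j))"
proof -
  have "monic_sum (Suc d) k = (\<Sum>a\<in>{a\<in>monic (Suc d). coeff a 0 \<in> UNIV}. a ^ k)" by (simp add: monic_sum_def)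
  also have "\<dots> = (\<Sum>j\<le>k. smult (of_nat (k choose j) * (\<Sum>x\<in>UNIV. x ^ (k - j))) (monom 1 j * monic_sum d j))"
    unfolding sum_monic_Suc sum_power_pCons ..
  also have "\<dots> = (\<Sum>j\<in>surviving k - {k}. smult (of_nat (k choose j) * (\<Sum>x\<in>UNIV. x ^ (k - j))) (monom 1 j * monic_sum d j))"
  proof (rule sum.mono_neutral_right)
    show "\<forall>j\<in>{..k} - (surviving k - {k}). smult (of_nat (k choose j) * (\<Sum>x\<in>UNIV. x ^ (k - j))) (monom 1 j * monic_sum d j) = 0"
    proof
      fix j assume j: "j \<in> {..k} - (surviving k - {k})"
      show "smult (of_nat (k choose j) * (\<Sum>x\<in>UNIV. x ^ (k - j))) (monom 1 j * monic_sum d j) = 0"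
      proof (cases "digits_le j k")
        case True
        thus ?thesis using j by (auto simp: surviving_def power_sum_UNIV dvd_diff_iff simp del: One_nat_def)
      next
        case False
        thus ?thesis using binomial_nonzero_iff[of k j] by simp
      qed
    qed
  qed (auto dest: surviving_le)
  also have "\<dots> = (\<Sum>j\<in>surviving k - {k}. - smult (of_nat (k choose j)) (monom 1 j * monic_sum d j))"
    by (intro sum.cong refl) (auto simp: surviving_def power_sum_UNIV dvd_diff_iff simp del: One_nat_def dest: digits_le_imp_le)
  finally show ?thesis by (simp add: sum_negf)
qed

text \<open>
  The order of vanishing at \<open>0\<close>, for nonzero polynomials only.
\<close>

definition lowest :: "'a poly \<Rightarrow> nat \<Rightarrow> bool" where "lowest P e \<longleftrightarrow> coeff P e \<noteq> 0 \<and> (\<forall>i<e. coeff P i = 0)"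

lemma lowest_shift: "lowest P e \<Longrightarrow> x \<noteq> 0 \<Longrightarrow> lowest (smult x (monom 1 j * P)) (j + e)"
  by (auto simp: lowest_def coeff_monom_mult)

lemma lowest_uminus: "lowest P e \<Longrightarrow> lowest (- P) e" by (simp add: lowest_def)

lemma lowest_sum:
  assumes "finite S" "j \<in> S" "lowest (g j) e" "\<And>i. i \<in> S \<Longrightarrow> i \<noteq> j \<Longrightarrow> g i = 0 \<or> (\<exists>e'>e. lowest (g i) e')"
  shows "lowest (\<Sum>i\<in>S. g i) e"
proof -
  have 0: "coeff (g i) n = 0" if "i \<in> S" "i \<noteq> j" "n \<le> e" for i n
    using assms(4)[OF that(1,2)] that(3) by (auto simp: lowest_def)
  have "coeff (\<Sum>i\<in>S. g i) n = coeff (g j) n" if "n \<le> e" for n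
    unfolding coeff_sum by (subst sum.remove[OF assms(1,2)]) (simp add: 0 that)
  thus ?thesis using assms(3) by (simp add: lowest_def)
qed

text \<open>
  By \<open>greedy_least\<close>, exactly one term of the recursion \<open>monic_sum_Suc\<close> has the lowest exponent, namely the one of the
  greedy choice; by \<open>feasible_Suc_iff\<close>, it is there iff the next length is feasible.
\<close>

lemma monic_sum_lowest: "(feasible m k \<longrightarrow> lowest (monic_sum m k) (chain_sum m k)) \<and> (\<not> feasible m k \<longrightarrow> monic_sum m k = 0)"
proof (induction m arbitrary: k)
  case 0
  show ?case by (simp add: lowest_def)
next
  case (Suc m)
  let ?g = "\<lambda>j. smult (of_nat (k choose j)) (monom 1 j * monic_sum m j)"
  show ?case
  proof (intro conjI impI)
    assume a: "feasible (Suc m) k"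
    have fk: "feasible m k" using a by (rule feasible_mono) simp
    define M where "M = least_feasible m k"
    note M = least_feasible[OF fk, folded M_def]
    have "M \<noteq> k"
      unfolding M_def using residue.least_feasible_proper[OF residue_mod refl a] by simp
    have "lowest (\<Sum>j\<in>surviving k - {k}. ?g j) (M + chain_sum m M)"
    proof (rule lowest_sum[of _ M])
      show "M \<in> surviving k - {k}" using M \<open>M \<noteq> k\<close> by (simp add: surviving_def)
      show "lowest (?g M) (M + chain_sum m M)"
        by (rule lowest_shift) (use Suc M binomial_nonzero_iff in auto)
    next
      fix j assume j: "j \<in> surviving k - {k}" "j \<noteq> M"
      show "?g j = 0 \<or> (\<exists>e'>M + chain_sum m M. lowest (?g j) e')"
      proof (cases "feasible m j")
        case False thus ?thesis using Suc by simp
      next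
        case True
        have "lowest (?g j) (j + chain_sum m j)"
          by (rule lowest_shift) (use Suc True j binomial_nonzero_iff in \<open>auto simp: surviving_def\<close>)
        moreover have "M + chain_sum m M < j + chain_sum m j"
          unfolding M_def by (rule greedy_least[OF fk]) (use j True in \<open>auto simp: surviving_def M_def\<close>)
        ultimately show ?thesis by blast
      qed
    qed simp
    thus "lowest (monic_sum (Suc m) k) (chain_sum (Suc m) k)" unfolding monic_sum_Suc by (simp add: lowest_uminus M_def)
  next
    assume "\<not> feasible (Suc m) k"
    hence "\<not> feasible m j" if "j \<in> surviving k - {k}" for j using that feasible_Suc_iff by (auto simp: surviving_def)
    thus "monic_sum (Suc m) k = 0" unfolding monic_sum_Suc using Suc by simp
  qed
qed

lemma unit_sum_lowest:
  assumes "feasible m k" shows "lowest (unit_sum (Suc m) k) (lowest_exp m k)"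
proof -
  let ?g = "\<lambda>j. smult (of_nat (k choose j)) (monom 1 j * monic_sum m j)"
  define M where "M = least_feasible m k"
  note M = least_feasible[OF assms, folded M_def]
  have "lowest (\<Sum>j\<in>surviving k. ?g j) (M + chain_sum m M)"
  proof (rule lowest_sum[of _ M])
    show "M \<in> surviving k" using M by (simp add: surviving_def)
    show "lowest (?g M) (M + chain_sum m M)"
      by (rule lowest_shift) (use monic_sum_lowest M binomial_nonzero_iff in auto)
  next
    fix j assume j: "j \<in> surviving k" "j \<noteq> M"
    show "?g j = 0 \<or> (\<exists>e'>M + chain_sum m M. lowest (?g j) e')"
    proof (cases "feasible m j")
      case False thus ?thesis using monic_sum_lowest by simp
    next
      case True
      have "lowest (?g j) (j + chain_sum m j)"
        by (rule lowest_shift) (use monic_sum_lowest True j binomial_nonzero_iff in \<open>auto simp: surviving_def\<close>)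
      moreover have "M + chain_sum m M < j + chain_sum m j"
        unfolding M_def by (rule greedy_least[OF assms]) (use j True in \<open>auto simp: surviving_def M_def\<close>)
      ultimately show ?thesis by blast
    qed
  qed simp
  thus ?thesis unfolding unit_sum_Suc lowest_exp_def by (simp add: lowest_uminus M_def)
qed

text \<open>
  A number from which a chain of length \<open>m\<close> descends makes every number properly above it feasible for \<open>m + 1\<close>.
\<close>

lemma unit_sum_Suc_eq_0:
  assumes "\<not> feasible m k" shows "unit_sum (Suc m) k = 0"
proof -
  have "\<not> feasible m j" if j: "j \<in> surviving k" for j
  proof
    assume fj: "feasible m j"
    hence "j \<noteq> k" using assms by auto
    hence "feasible (Suc m) k" using feasible_Suc_iff j fj by (auto simp: surviving_def)
    hence "feasible m k" by (rule feasible_mono) simp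
    thus False using assms by simp
  qed
  thus ?thesis unfolding unit_sum_Suc using monic_sum_lowest by simp
qed

end

section \<open>Digit sums and the numbers L\<close>

context digits
begin

lemma base_q_digit: "n div (p ^ f) ^ i mod p ^ f = (\<Sum>e<f. digit n (f * i + e) * p ^ e)"
proof -
  define n' where "n' = n div p ^ (f * i)"
  have "n' mod p ^ f = n' - p ^ f * (n' div p ^ f)" by (simp add: minus_mult_div_eq_mod)
  also have "\<dots> = (\<Sum>e<f. digit n' e * p ^ e)" using split_at[of n' f] by linarith
  also have "\<dots> = (\<Sum>e<f. digit n (f * i + e) * p ^ e)" by (simp add: digit_add n'_def)
  finally show ?thesis by (simp add: n'_def power_mult)
qed

lemma sum_blocks: "(\<Sum>i<N. \<Sum>e<f. g (f * i + e)) = (\<Sum>s<f * N. g s :: nat)"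
proof (induction N)
  case (Suc N)
  have "(\<Sum>s<f * Suc N. g s) = (\<Sum>s<f * N + f. g s)" by (simp add: add.commute)
  also have "\<dots> = (\<Sum>s<f * N. g s) + (\<Sum>e<f. g (f * N + e))" by (rule sum_lessThan_add)
  finally show ?case using Suc by simp
qed simp

text \<open>
  A base-\<open>q\<close> digit consists of \<open>f\<close> base-\<open>p\<close> digits, and the shift by \<open>t\<close> changes the position \<open>s\<close> of a digit to \<open>s + t\<close>,
  where its weight is \<open>p\<close> to the power \<open>(s + t) mod f\<close>.
\<close>

lemma digit_sum_shift:
  assumes t: "t < f" shows "digit_sum (p ^ f) (k * p ^ t) = rot_sum k t"
proof -
  define n where "n = k * p ^ t"
  \<comment> \<open>the digit sum runs over the positions below \<open>f (n + 1)\<close>, which cover all of \<open>k\<close> after the shift\<close>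
  have kn: "k \<le> n" using p2 by (simp add: n_def)
  define N where "N = f * Suc n - t"
  have fn: "n \<le> f * n" using f1 by simp
  have N: "f * Suc n = t + N" "k \<le> N" using t kn fn unfolding N_def mult_Suc_right by linarith+
  have lowest: "digit n s = 0" if "s < t" for s
  proof -
    have "n = k * p ^ (t - s) * p ^ s" using that by (simp add: n_def flip: power_add)
    hence "n div p ^ s = k * p ^ (t - s)" using p2 by (metis nonzero_mult_div_cancel_right not_numeral_le_zero power_not_zero)
    moreover have "p dvd p ^ (t - s)" using that by (intro dvd_power) simp
    ultimately show ?thesis by (simp add: digit_def)
  qed
  have high: "digit n (t + s) = digit k s" for s using p2 by (simp add: digit_add n_def)
  have "digit_sum (p ^ f) n = (\<Sum>i<Suc n. \<Sum>e<f. digit n (f * i + e) * p ^ e)"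
    unfolding digit_sum_def base_q_digit lessThan_Suc_atMost ..
  also have "\<dots> = (\<Sum>i<Suc n. \<Sum>e<f. digit n (f * i + e) * p ^ ((f * i + e) mod f))"
    by (intro sum.cong refl) simp
  also have "\<dots> = (\<Sum>s<t + N. digit n s * p ^ (s mod f))"
    unfolding N(1)[symmetric] by (rule sum_blocks)
  also have "\<dots> = (\<Sum>s<N. digit k s * p ^ ((s + t) mod f))"
    unfolding sum_lessThan_add high by (simp add: lowest add.commute[of t])
  also have "\<dots> = rot_sum k t" unfolding rot_sum_def
    by (rule sum.mono_neutral_right) (use N(2) in \<open>auto simp: digit_eq_0 less_pow\<close>)
  finally show ?thesis by (simp add: n_def)
qed

lemma feasible_iff_L_min: "feasible m k \<longleftrightarrow> real m \<le> L_min p f k"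
proof -
  have per: "rot_sum k t = rot_sum k (t mod f)" for t by (simp add: rot_sum_def mod_add_right_eq)
  have q: "real (p ^ f) - 1 > 0" using q_ge_2 by (simp del: of_nat_power)
  have eq: "real m \<le> real x / (real (p ^ f) - 1) \<longleftrightarrow> m * (p ^ f - 1) \<le> x" for x
  proof -
    have "real m * (real (p ^ f) - 1) = real (m * (p ^ f - 1))" using q_ge_2 by (simp add: of_nat_diff del: of_nat_power)
    thus ?thesis using q by (simp add: pos_le_divide_eq del: of_nat_power of_nat_mult)
  qed
  have "real m \<le> L_min p f k \<longleftrightarrow> (\<forall>t<f. m * (p ^ f - 1) \<le> rot_sum k t)"
    unfolding L_min_def using f1 by (subst Min_ge_iff) (auto simp: eq digit_sum_shift lessThan_empty_iff simp del: of_nat_power)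
  also have "\<dots> \<longleftrightarrow> feasible m k" unfolding feasible_def
  proof
    assume *: "\<forall>t<f. m * (p ^ f - 1) \<le> rot_sum k t"
    show "\<forall>t. m * (p ^ f - 1) \<le> rot_sum k t"
    proof
      fix t have "t mod f < f" using f1 by simp
      thus "m * (p ^ f - 1) \<le> rot_sum k t" using * per[of t] by simp
    qed
  qed simp
  finally show ?thesis by simp
qed

end

section \<open>Multiple power sums\<close>

lemma sorted_wrt_greater_nth_ge:
  assumes "sorted_wrt (>) (d :: nat list)" "i < length d"
  shows "length d - 1 - i \<le> d ! i"
  using assms
proof (induction d arbitrary: i)
  case (Cons x d)
  show ?case
  proof (cases i)
    case 0
    show ?thesis
    proof (cases d)
      case (Cons y e)
      have "length d - 1 - 0 \<le> d ! 0" by (rule Cons.IH) (use Cons.prems Cons in auto)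
      moreover have "d ! 0 < x" using Cons.prems Cons by auto
      ultimately show ?thesis using 0 Cons by simp
    qed (use 0 in simp)
  next
    case (Suc j)
    have "length d - 1 - j \<le> d ! j" by (rule Cons.IH) (use Cons.prems Suc in auto)
    thus ?thesis using Suc by simp
  qed
qed simp

context finite_field_card
begin

lemma lowest_1: "lowest 1 0" by (simp add: lowest_def)

lemma lowest_mult: assumes "lowest P e" "lowest P' e'" shows "lowest (P * P') (e + e')"
proof -
  have z: "coeff P i * coeff P' (n - i) = 0" if "i \<le> n" "n < e + e' \<or> n = e + e' \<and> i \<noteq> e" for i n
  proof (cases "i < e")
    case False
    hence "n - i < e'" using that by linarith
    thus ?thesis using assms by (simp add: lowest_def)
  qed (use assms in \<open>simp add: lowest_def\<close>)
  have "coeff (P * P') (e + e') = coeff P e * coeff P' e'"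
    unfolding coeff_mult by (subst sum.remove[of _ e]) (auto intro!: sum.neutral simp: z)
  moreover have "coeff (P * P') n = 0" if "n < e + e'" for n
    unfolding coeff_mult by (rule sum.neutral) (use z that in auto)
  ultimately show ?thesis using assms by (simp add: lowest_def)
qed

lemma lowest_prod: fixes n :: nat shows "(\<And>i. i < n \<Longrightarrow> lowest (P i) (e i)) \<Longrightarrow> lowest (\<Prod>i<n. P i) (\<Sum>i<n. e i)"
  by (induction n) (auto simp: lowest_1 intro: lowest_mult)

lemma lowest_nonzero: "lowest P e \<Longrightarrow> P \<noteq> 0" by (auto simp: lowest_def)

text \<open>
  The zeta value for \<open>v = t\<close> and \<open>s = -k\<close>, cut off at degree \<open>N\<close>.
\<close>

definition multi_sum :: "nat list \<Rightarrow> nat \<Rightarrow> 'a poly" where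
  "multi_sum k N = (\<Sum>d | length d = length k \<and> sorted_wrt (>) d \<and> set d \<subseteq> {..N}. \<Prod>i<length k. unit_sum (d ! i) (k ! i))"

text \<open>
  In degree \<open>0\<close> the only monic polynomial is \<open>1\<close>, so the lowest exponent is \<open>0\<close> for every \<open>k\<close>.
\<close>

definition unit_exp :: "nat \<Rightarrow> nat \<Rightarrow> nat" where "unit_exp d k = (if d = 0 then 0 else lowest_exp (d - 1) k)"

lemma unit_sum_lowest_exp: "d = 0 \<or> feasible (d - 1) k \<Longrightarrow> lowest (unit_sum d k) (unit_exp d k)"
  using unit_sum_lowest by (cases d) (auto simp: unit_exp_def lowest_1)

lemma unit_sum_eq_0: "d \<noteq> 0 \<Longrightarrow> \<not> feasible (d - 1) k \<Longrightarrow> unit_sum d k = 0"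
  using unit_sum_Suc_eq_0 by (cases d) auto

text \<open>
  The factor at \<open>i\<close> vanishes at the smallest index \<open>(r - 1, \<dots>, 0)\<close>, hence at every other index, whose degrees are at least
  as large.
\<close>

lemma multi_sum_eq_0:
  assumes "i < length k" "length k - 1 - i \<noteq> 0" "\<not> feasible (length k - 1 - i - 1) (k ! i)"
  shows "multi_sum k N = 0"
  unfolding multi_sum_def
proof (rule sum.neutral, safe)
  fix d :: "nat list" assume d: "length d = length k" "sorted_wrt (>) d"
  have ge: "length k - 1 - i \<le> d ! i" using sorted_wrt_greater_nth_ge[OF d(2), of i] assms(1) d(1) by simp
  have "\<not> feasible (d ! i - 1) (k ! i)"
  proof
    assume "feasible (d ! i - 1) (k ! i)"
    hence "feasible (length k - 1 - i - 1) (k ! i)" by (rule feasible_mono) (use ge in simp)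
    thus False using assms(3) by simp
  qed
  hence "unit_sum (d ! i) (k ! i) = 0" by (intro unit_sum_eq_0) (use ge assms(2) in simp_all)
  thus "(\<Prod>i<length k. unit_sum (d ! i) (k ! i)) = 0" using assms(1) by (intro prod_zero) auto
qed

text \<open>
  The product at the smallest index \<open>(r - 1, \<dots>, 0)\<close> is nonzero, and every other nonzero product has a larger lowest exponent,
  as some degree above \<open>0\<close> has increased. That degree exists because of \<open>r \<ge> 2\<close>: if the last degree is not \<open>0\<close>,
  then the degree before it exceeds \<open>1\<close>.
\<close>

lemma multi_sum_neq_0:
  assumes r: "length k \<ge> 2" and N: "length k \<le> N"
    and fs: "\<And>i. i < length k \<Longrightarrow> length k - 1 - i = 0 \<or> feasible (length k - 1 - i - 1) (k ! i)"
  shows "multi_sum k N \<noteq> 0"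
proof -
  define n where "n = length k"
  let ?D = "{d. length d = length k \<and> sorted_wrt (>) d \<and> set d \<subseteq> {..N}}"
  let ?g = "\<lambda>d. \<Prod>i<length k. unit_sum (d ! i) (k ! i)"
  define d0 where "d0 = rev [0..<n]"
  have d0: "length d0 = n" "\<And>i. i < n \<Longrightarrow> d0 ! i = n - 1 - i"
    by (simp_all add: d0_def rev_nth)
  have "sorted_wrt (>) d0" by (simp add: d0_def sorted_wrt_rev)
  hence d0D: "d0 \<in> ?D" using N by (auto simp: d0_def n_def)
  have fin: "finite ?D"
    by (rule finite_subset[OF _ finite_lists_length_eq[of "{..N}" "length k"]]) auto
  have low0: "lowest (?g d0) (\<Sum>i<length k. unit_exp (d0 ! i) (k ! i))"
    by (rule lowest_prod, rule unit_sum_lowest_exp) (use fs d0 in \<open>auto simp: n_def\<close>)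
  have "lowest (\<Sum>d\<in>?D. ?g d) (\<Sum>i<length k. unit_exp (d0 ! i) (k ! i))"
  proof (rule lowest_sum[where g = ?g, OF fin d0D low0])
    fix d assume d: "d \<in> ?D" "d \<noteq> d0"
    hence len: "length d = n" and srt: "sorted_wrt (>) d" by (auto simp: n_def)
    have ge: "d0 ! i \<le> d ! i" if "i < n" for i
      using sorted_wrt_greater_nth_ge[OF srt, of i] that len d0 by simp
    show "?g d = 0 \<or> (\<exists>e'>\<Sum>i<length k. unit_exp (d0 ! i) (k ! i). lowest (?g d) e')"
    proof (cases "\<exists>i<n. d ! i \<noteq> 0 \<and> \<not> feasible (d ! i - 1) (k ! i)")
      case True
      then obtain i where "i < n" "unit_sum (d ! i) (k ! i) = 0" using unit_sum_eq_0 by blast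
      hence "?g d = 0" by (intro prod_zero) (auto simp: n_def)
      thus ?thesis ..
    next
      case False
      have lo: "lowest (?g d) (\<Sum>i<length k. unit_exp (d ! i) (k ! i))"
        by (rule lowest_prod, rule unit_sum_lowest_exp) (use False in \<open>auto simp: n_def\<close>)
      have less: "unit_exp a (k ! i) < unit_exp b (k ! i)" if "i < n" "a < b" "b = d ! i" "a \<noteq> 0" for i a b
      proof -
        have "feasible (b - 1) (k ! i)" using False that by auto
        thus ?thesis using lowest_exp_less[of "a - 1" "b - 1" "k ! i"] that by (simp add: unit_exp_def)
      qed
      have le: "unit_exp (d0 ! i) (k ! i) \<le> unit_exp (d ! i) (k ! i)" if "i < n" for i
      proof (cases "d0 ! i = 0 \<or> d0 ! i = d ! i")
        case True thus ?thesis by (auto simp: unit_exp_def)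
      next
        case F: False
        thus ?thesis using less[of i "d0 ! i" "d ! i"] ge[of i] that by simp
      qed
      obtain i where i: "i < n" "d ! i \<noteq> d0 ! i" using d(2) len d0(1) by (metis nth_equalityI)
      \<comment> \<open>the exponent need not increase from degree \<open>0\<close> on, so a change at the last place alone would not do\<close>
      have "\<exists>i<n. d0 ! i \<noteq> 0 \<and> d0 ! i < d ! i"
      proof (cases "d0 ! i = 0")
        case False
        thus ?thesis using i ge[of i] by (intro exI[of _ i]) auto
      next
        case True
        hence i1: "i = n - 1" using i d0 by simp
        hence n2: "n - 2 < i" "i < length d" using r i len by (auto simp: n_def)
        have "d ! i < d ! (n - 2)" using sorted_wrt_nth_less[OF srt n2] .
        moreover have "d0 ! (n - 2) = 1" using d0(2)[of "n - 2"] r by (simp add: n_def)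
        moreover have "d ! i \<noteq> 0" using i True by simp
        ultimately show ?thesis using r by (intro exI[of _ "n - 2"]) (auto simp: n_def)
      qed
      then obtain j where j: "j < n" "d0 ! j \<noteq> 0" "d0 ! j < d ! j" by blast
      have "unit_exp (d0 ! j) (k ! j) < unit_exp (d ! j) (k ! j)" by (rule less[OF j(1,3) refl j(2)])
      hence "(\<Sum>i<length k. unit_exp (d0 ! i) (k ! i)) < (\<Sum>i<length k. unit_exp (d ! i) (k ! i))"
        by (intro sum_strict_mono_ex1) (use le j in \<open>auto simp: n_def\<close>)
      thus ?thesis using lo by blast
    qed
  qed
  thus ?thesis unfolding multi_sum_def by (rule lowest_nonzero)
qed

lemma multi_sum_single: "multi_sum [k] N = (\<Sum>d\<le>N. unit_sum d k)"
proof -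
  have "multi_sum [k] N = (\<Sum>d | length d = 1 \<and> sorted_wrt (>) d \<and> set d \<subseteq> {..N}. unit_sum (d ! 0) k)"
    by (simp add: multi_sum_def)
  also have "\<dots> = (\<Sum>d\<le>N. unit_sum d k)"
    by (rule sum.reindex_bij_witness[of _ "\<lambda>d. [d]" hd]) (auto simp: length_Suc_conv)
  finally show ?thesis .
qed

lemma coeff_0_unit_sum_Suc: "\<not> (p ^ f - 1) dvd k \<Longrightarrow> coeff (unit_sum (Suc d) k) 0 = 0"
  unfolding unit_sum_Suc coeff_minus coeff_sum
  by (auto intro!: sum.neutral simp: coeff_monom_mult surviving_def dvd_eq_mod_eq_0)

text \<open>
  Only the exponent \<open>j = 0\<close> of the recursion \<open>unit_sum_Suc\<close> can reach the constant coefficient, and it does not survive.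
  So the constant coefficient is that of degree \<open>0\<close>, which is \<open>1\<close>.
\<close>

lemma multi_sum_odd:
  assumes "\<not> (p ^ f - 1) dvd k" shows "multi_sum [k] N \<noteq> 0"
proof -
  have "coeff (multi_sum [k] N) 0 = (\<Sum>d\<le>N. coeff (unit_sum d k) 0)" unfolding multi_sum_single by (simp add: coeff_sum)
  also have "\<dots> = coeff (unit_sum 0 k) 0"
    by (subst sum.atMost_shift) (simp add: coeff_0_unit_sum_Suc[OF assms])
  finally show ?thesis by auto
qed

text \<open>
  For even \<open>k\<close> scaling by a unit does not change a \<open>k\<close>-th power, so the sum over the monic polynomials is, up to the factor
  \<open>q - 1 = -1\<close>, the sum over all polynomials of degree at most \<open>N\<close> with nonzero constant coefficient. The same sums without the condition
  and with constant coefficient \<open>0\<close> vanish, since power sums over a vector space of dimension greater than \<open>k\<close> do.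
\<close>

lemma multi_sum_even:
  assumes even: "(p ^ f - 1) dvd k" and N: "k < N" shows "multi_sum [k] N = 0"
proof -
  let ?B = "\<lambda>n. {b :: 'a poly. \<forall>i\<ge>n. coeff b i = 0}"
  let ?M = "\<lambda>d. {a\<in>monic d. coeff a 0 \<noteq> 0}"
  have deg: "b \<in> ?B (Suc n) \<longleftrightarrow> degree b \<le> n" for b :: "'a poly" and n
    by (auto simp: coeff_eq_0 intro!: degree_le)
  have fin: "finite (?B n)" for n by (rule finite_coeffs_below)
  have "(\<Sum>b\<in>{b\<in>?B (Suc N). coeff b 0 = 0}. b ^ k) = (\<Sum>b\<in>?B N. pCons 0 b ^ k)"
  proof (rule sum.reindex_bij_witness[of _ "pCons 0" "poly_shift 1"], goal_cases)
    case (1 a) thus ?case by (auto simp: poly_eq_iff coeff_poly_shift coeff_pCons split: nat.splits)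
  next
    case (2 a) thus ?case by (auto simp: coeff_poly_shift)
  next
    case (3 a) show ?case by (auto simp: poly_eq_iff coeff_poly_shift coeff_pCons)
  next
    case (4 a) thus ?case by (auto simp: coeff_pCons split: nat.splits)
  next
    case (5 a)
    hence "pCons 0 (poly_shift 1 a) = a" by (auto simp: poly_eq_iff coeff_poly_shift coeff_pCons split: nat.splits)
    thus ?case by simp
  qed
  also have "\<dots> = monom 1 k * (\<Sum>b\<in>?B N. b ^ k)"
  proof -
    have "pCons 0 b ^ k = monom 1 k * b ^ k" for b :: "'a poly"
    proof -
      have "pCons 0 b = monom 1 1 * b" by (simp add: monom_Suc monom_0)
      thus ?thesis by (simp add: power_mult_distrib monom_power)
    qed
    thus ?thesis by (simp add: sum_distrib_left)
  qed
  also have "\<dots> = 0" using power_sum_affine_eq_0[OF N, of "0 :: 'a poly"] by simp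
  finally have "(\<Sum>b\<in>{b\<in>?B (Suc N). coeff b 0 = 0}. b ^ k) = 0" .
  moreover have "(\<Sum>b\<in>?B (Suc N). b ^ k) = 0"
    using power_sum_affine_eq_0[of k "Suc N" "0 :: 'a poly"] N by simp
  moreover have "(\<Sum>b\<in>?B (Suc N). b ^ k) = (\<Sum>b\<in>{b\<in>?B (Suc N). coeff b 0 = 0}. b ^ k) + (\<Sum>b\<in>{b\<in>?B (Suc N). coeff b 0 \<noteq> 0}. b ^ k)"
    by (subst sum.union_disjoint[symmetric]) (use fin in \<open>auto intro!: sum.cong\<close>)
  ultimately have 0: "(\<Sum>b\<in>{b\<in>?B (Suc N). coeff b 0 \<noteq> 0}. b ^ k) = 0" by simp
  have "(\<Sum>b\<in>{b\<in>?B (Suc N). coeff b 0 \<noteq> 0}. b ^ k) = (\<Sum>(x, b)\<in>(UNIV - {0}) \<times> (\<Union>d\<le>N. ?M d). smult x b ^ k)"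
  proof (rule sum.reindex_bij_witness[of _ "\<lambda>(x, b). smult x b" "\<lambda>b. (lead_coeff b, smult (inverse (lead_coeff b)) b)"], goal_cases)
    case (2 a)
    hence "a \<noteq> 0" by auto
    thus ?case using 2 deg by (auto simp: monic_def)
  next
    case (4 z)
    thus ?case using deg by (auto simp: monic_def)
  next
    case (1 a)
    hence "a \<noteq> 0" by auto
    thus ?case by simp
  next
    case (5 a)
    hence "a \<noteq> 0" by auto
    thus ?case by simp
  qed (auto simp: monic_def)
  also have "\<dots> = (\<Sum>x\<in>UNIV - {0}. \<Sum>b\<in>(\<Union>d\<le>N. ?M d). smult (x ^ k) (b ^ k))"
    by (simp add: sum.cartesian_product smult_power)
  also have "\<dots> = smult (\<Sum>x\<in>UNIV - {0}. x ^ k) (\<Sum>b\<in>(\<Union>d\<le>N. ?M d). b ^ k)"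
    by (simp only: smult_sum smult_sum_right) (rule sum.swap)
  also have "\<dots> = - (\<Sum>b\<in>(\<Union>d\<le>N. ?M d). b ^ k)" using even by (simp add: power_sum_units)
  also have "(\<Sum>b\<in>(\<Union>d\<le>N. ?M d). b ^ k) = (\<Sum>d\<le>N. unit_sum d k)"
    unfolding unit_sum_def
  proof (rule sum.UNION_disjoint)
    show "\<forall>d\<in>{..N}. finite (?M d)" by simp
  qed (auto simp: monic_def)
  finally show ?thesis using 0 by (simp add: multi_sum_single)
qed

section \<open>The zeta value\<close>

text \<open>
  The substitution of \<open>v = t - c\<close> for \<open>t\<close> permutes the monic polynomials of degree \<open>d\<close> and maps those with nonzero constant
  coefficient to those that do not vanish at \<open>c\<close>, which are the ones prime to \<open>v\<close>.
\<close>

lemma S_tilde_eq_unit_sum: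
  assumes v: "v = [:- c, 1:]" "irreducible (v :: 'a poly)" and s: "s \<le> 0"
  shows "S_tilde v d s = Fract (unit_sum d (nat (- s)) \<circ>\<^sub>p v) 1"
proof -
  define k where "k = nat (- s)"
  have pw: "Fract a 1 powi (- s) = Fract (a ^ k) 1" for a :: "'a poly"
  proof -
    have "Fract a 1 ^ n = Fract (a ^ n) 1" for n
      by (induction n) (simp_all add: One_fract_def)
    thus ?thesis using s by (simp add: power_int_def k_def)
  qed
  have add: "(\<Sum>a\<in>X. Fract (g a) 1) = Fract (\<Sum>a\<in>X. g a) 1" for X and g :: "'a poly \<Rightarrow> 'a poly"
    by (induction X rule: infinite_finite_induct) (simp_all add: Zero_fract_def)
  have cop: "coprime a v \<longleftrightarrow> poly a c \<noteq> 0" for a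
    using coprime_irreducible_iff[OF v(2)] by (simp add: v(1) poly_eq_0_iff_dvd)
  have shift: "a \<circ>\<^sub>p [:- c, 1:] \<circ>\<^sub>p [:c, 1:] = a" "a \<circ>\<^sub>p [:c, 1:] \<circ>\<^sub>p [:- c, 1:] = a" for a
    by (simp_all flip: pcompose_assoc add: pcompose_pCons)
  have mon: "a \<circ>\<^sub>p [:x, 1:] \<in> monic d" if "a \<in> monic d" for a x
    using that lead_coeff_comp[of "[:x, 1:]" a] by (auto simp: monic_def degree_pcompose)
  have pcp: "(a ^ n) \<circ>\<^sub>p b = (a \<circ>\<^sub>p b) ^ n" for a b :: "'a poly" and n
    by (induction n) (simp_all add: pcompose_1 pcompose_mult)
  have "S_tilde v d s = Fract (\<Sum>a\<in>{a\<in>monic d. poly a c \<noteq> 0}. a ^ k) 1"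
    unfolding S_tilde_def pw add by (rule arg_cong[where f = "\<lambda>x. Fract x 1"]) (auto intro!: sum.cong simp: cop monic_def)
  also have "(\<Sum>a\<in>{a\<in>monic d. poly a c \<noteq> 0}. a ^ k) = (\<Sum>a\<in>{a\<in>monic d. coeff a 0 \<noteq> 0}. (a \<circ>\<^sub>p v) ^ k)"
    by (rule sum.reindex_bij_witness[of _ "\<lambda>a. a \<circ>\<^sub>p v" "\<lambda>a. a \<circ>\<^sub>p [:c, 1:]"])
      (auto simp: v(1) shift mon poly_pcompose coeff_pcompose_0 poly_0_coeff_0)
  also have "\<dots> = unit_sum d k \<circ>\<^sub>p v" by (simp add: unit_sum_def pcompose_sum pcp)
  finally show ?thesis by (simp add: k_def)
qed

text \<open>
  All terms of degree above \<open>N\<close> vanish, so the infinite sum is a finite one, and \<open>\<iota>\<close> is injective.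
\<close>

lemma zeta_v_eq_0_iff:
  fixes \<iota> :: "'a poly fract \<Rightarrow> 'k::{field,metric_space}"
  assumes v: "v = [:- c, 1:]" "irreducible v" and comp: "vadic_completion v \<iota>"
    and s: "\<forall>x\<in>set s. x \<le> 0" and N: "(\<Sum>i<length s. nat (- (s ! i))) + 1 \<le> N"
  shows "zeta_v v \<iota> s = 0 \<longleftrightarrow> multi_sum (map (\<lambda>x. nat (- x)) s) N = 0"
proof -
  interpret vadic_completion v \<iota> by fact
  have \<iota>0: "\<iota> 0 = 0" by (metis add.right_neutral add_left_imp_eq hom_add)
  have \<iota>sum: "\<iota> (\<Sum>x\<in>X. g x) = (\<Sum>x\<in>X. \<iota> (g x))" for X and g :: "nat list \<Rightarrow> 'a poly fract"
    by (induction X rule: infinite_finite_induct) (simp_all add: hom_add \<iota>0)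
  have \<iota>inj: "\<iota> x = 0 \<longleftrightarrow> x = 0" for x
  proof
    assume "\<iota> x = 0"
    hence "vabs v (x - 0) = 0" using dist_hom[of x 0] \<iota>0 by simp
    thus "x = 0" by (simp add: vabs_def split: if_splits)
  qed (simp add: \<iota>0)
  let ?T = "\<lambda>d. \<Prod>i<length s. S_tilde v (d ! i) (s ! i)"
  let ?D = "{d. length d = length s \<and> sorted_wrt (>) d}"
  let ?F = "{d. length d = length s \<and> sorted_wrt (>) d \<and> set d \<subseteq> {..N}}"
  have fin: "finite ?F"
    by (rule finite_subset[OF _ finite_lists_length_eq[of "{..N}" "length s"]]) auto
  have "zeta_v v \<iota> s = (\<Sum>\<^sub>\<infinity>d\<in>?F. \<iota> (?T d))"
    unfolding zeta_v_def
  proof (rule infsum_cong_neutral)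
    fix d assume d: "d \<in> ?D - ?F"
    then obtain i where i: "i < length s" "d ! i > N"
      by (auto simp: subset_eq in_set_conv_nth)
    have "nat (- (s ! i)) \<le> (\<Sum>i<length s. nat (- (s ! i)))"
      using i by (intro member_le_sum) auto
    hence "S_tilde v (d ! i) (s ! i) = 0"
      using i s v N by (intro S_tilde_eq_0) auto
    thus "\<iota> (?T d) = 0" using i \<iota>0 by (subst prod_zero) auto
  qed auto
  also have "\<dots> = \<iota> (\<Sum>d\<in>?F. ?T d)" using fin by (simp add: \<iota>sum)
  finally have 1: "zeta_v v \<iota> s = 0 \<longleftrightarrow> (\<Sum>d\<in>?F. ?T d) = 0" by (simp add: \<iota>inj)
  have T: "?T d = Fract ((\<Prod>i<length s. unit_sum (d ! i) (nat (- (s ! i)))) \<circ>\<^sub>p v) 1" for d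
  proof -
    have "(\<Prod>i\<in>I. Fract (g i) 1) = Fract (\<Prod>i\<in>I. g i) 1" for I and g :: "nat \<Rightarrow> 'a poly"
      by (induction I rule: infinite_finite_induct) (simp_all add: One_fract_def)
    moreover have "?T d = (\<Prod>i<length s. Fract (unit_sum (d ! i) (nat (- (s ! i))) \<circ>\<^sub>p v) 1)"
      using s v by (intro prod.cong refl S_tilde_eq_unit_sum) auto
    ultimately show ?thesis by (simp add: pcompose_prod)
  qed
  have add: "(\<Sum>a\<in>X. Fract (g a) 1) = Fract (\<Sum>a\<in>X. g a) 1" for X and g :: "nat list \<Rightarrow> 'a poly"
    by (induction X rule: infinite_finite_induct) (simp_all add: Zero_fract_def)
  have "(\<Sum>d\<in>?F. ?T d) = Fract (multi_sum (map (\<lambda>x. nat (- x)) s) N \<circ>\<^sub>p v) 1"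
    unfolding T add multi_sum_def pcompose_sum by simp
  also have "\<dots> = 0 \<longleftrightarrow> multi_sum (map (\<lambda>x. nat (- x)) s) N = 0"
  proof -
    have "Fract a 1 = 0 \<longleftrightarrow> a = (0 :: 'a poly)" for a by (simp add: Zero_fract_def eq_fract)
    thus ?thesis by (simp add: pcompose_eq_0_iff v(1))
  qed
  finally show ?thesis using 1 by simp
qed

text \<open>
  With \<open>i\<close> counted from \<open>0\<close>, the number \<open>r - 1 - i\<close> is the degree at place \<open>i\<close> of the smallest index. The degree \<open>d > 0\<close> leads to a zero
  factor iff \<open>d - 1\<close> is not feasible, that is, iff \<open>d > L\<^sub>k + 1\<close>.
\<close>

lemma trivial_zero_iff:
  "trivial_zero p f s \<longleftrightarrow> (\<exists>i<length s. length s - 1 - i \<noteq> 0 \<and>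
     \<not> feasible (length s - 1 - i - 1) (map (\<lambda>x. nat (- x)) s ! i))"
proof -
  have L: "L_min p f k \<ge> 0" for k using feasible_iff_L_min[of 0 k] feasible_0 by simp
  have "real n > L_min p f k + 1 \<longleftrightarrow> n \<noteq> 0 \<and> \<not> feasible (n - 1) k" for n k
  proof (cases n)
    case 0
    thus ?thesis using L[of k] by simp
  next
    case (Suc m)
    thus ?thesis by (simp add: feasible_iff_L_min not_le)
  qed
  note eq = this
  show ?thesis unfolding trivial_zero_def eq
  proof (intro iffI; elim bexE exE conjE)
    fix i assume "i \<in> {1..length s}" "length s - i \<noteq> 0" "\<not> feasible (length s - i - 1) (nat (- (s ! (i - 1))))"
    thus "\<exists>i<length s. length s - 1 - i \<noteq> 0 \<and> \<not> feasible (length s - 1 - i - 1) (map (\<lambda>x. nat (- x)) s ! i)"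
      by (intro exI[of _ "i - 1"]) auto
  next
    fix i assume "i < length s" "length s - 1 - i \<noteq> 0" "\<not> feasible (length s - 1 - i - 1) (map (\<lambda>x. nat (- x)) s ! i)"
    thus "\<exists>i\<in>{1..length s}. length s - i \<noteq> 0 \<and> \<not> feasible (length s - i - 1) (nat (- (s ! (i - 1))))"
      by (intro bexI[of _ "Suc i"]) auto
  qed
qed

lemma q_even_iff: "s \<le> 0 \<Longrightarrow> q_even (p ^ f) s \<longleftrightarrow> (p ^ f - 1) dvd nat (- s)"
proof -
  assume s: "s \<le> 0"
  have "int (p ^ f) - 1 = int (p ^ f - 1)" using q_ge_2 by (simp add: of_nat_diff del: of_nat_power)
  moreover have "s = - int (nat (- s))" using s by simp
  ultimately show ?thesis unfolding q_even_def by (metis dvd_minus_iff of_nat_dvd_iff)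
qed

end

theorem theorem2p11:
  fixes v :: "'a::{field,finite} poly"
    and \<iota> :: "'a poly fract \<Rightarrow> 'k::{field,metric_space}"
    and s :: "int list" and p f :: nat
  assumes "prime p" and "CARD('a) = p ^ f"
    and "irreducible v" and "lead_coeff v = 1" and "degree v = 1"
    and "vadic_completion v \<iota>"
    and "length s \<ge> 1" and "\<forall>x\<in>set s. x \<le> 0"
  shows "zeta_v v \<iota> s = 0 \<longleftrightarrow>
           (length s > 1 \<and> trivial_zero p f s) \<or>
           (length s = 1 \<and> q_even (p ^ f) (s ! 0))"
proof -
  have "card {0, 1 :: 'a} \<le> CARD('a)" by (intro card_mono) auto
  hence "f \<noteq> 0" using assms(2) by (intro notI) simp
  then interpret finite_field_card p f "TYPE('a)"
    by unfold_locales (use assms(1,2) prime_ge_2_nat in auto)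
  define k where "k = map (\<lambda>x. nat (- x)) s"
  define N where "N = (\<Sum>i<length s. nat (- (s ! i))) + 1 + length s"
  obtain c where v: "v = [:- c, 1:]"
  proof -
    obtain a b where "v = [:a, b:]" using assms(5) by (metis degree1_coeffs)
    moreover have "b = 1" using \<open>v = [:a, b:]\<close> assms(4,5) by (auto split: if_splits)
    ultimately have "v = [:- (- a), 1:]" by simp
    thus thesis by (rule that)
  qed
  have zeta: "zeta_v v \<iota> s = 0 \<longleftrightarrow> multi_sum k N = 0"
    unfolding k_def by (rule zeta_v_eq_0_iff[OF v assms(3,6,8)]) (simp add: N_def)
  have len: "length k = length s" by (simp add: k_def)
  show ?thesis
  proof (cases "length s = 1")
    case True
    then obtain x where x: "s = [x]" by (auto simp: length_Suc_conv)
    have "multi_sum [nat (- x)] N = 0 \<longleftrightarrow> (p ^ f - 1) dvd nat (- x)"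
      using multi_sum_even[of "nat (- x)" N] multi_sum_odd[of "nat (- x)" N] by (auto simp: N_def x)
    thus ?thesis unfolding zeta using q_even_iff[of x] assms(8) by (simp add: x k_def)
  next
    case False
    hence r: "length k \<ge> 2" using assms(7) len by simp
    have "multi_sum k N = 0 \<longleftrightarrow> trivial_zero p f s"
    proof
      assume "trivial_zero p f s"
      thus "multi_sum k N = 0" unfolding trivial_zero_iff using multi_sum_eq_0[of _ k N] len by (auto simp: k_def)
    next
      assume 0: "multi_sum k N = 0"
      show "trivial_zero p f s"
      proof (rule ccontr)
        assume "\<not> ?thesis"
        hence "length k - 1 - i = 0 \<or> feasible (length k - 1 - i - 1) (k ! i)" if "i < length k" for i
          using that unfolding trivial_zero_iff k_def by auto
        thus False using multi_sum_neq_0[OF r, of N] 0 len by (simp add: N_def)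
      qed
    qed
    thus ?thesis unfolding zeta using r len by simp
  qed
qed

end
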